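(* Let $\mathcal{F}$ be a saturated fusion system on a finite $p$-group $S$ and let $\mathcal{H}=N_{\mathcal{F}}(S)$. If $[S,\mathcal{F}]\neq[S,\mathcal{H}]$ (that is, if $\mathcal{H}$ does not control transfer in $\mathcal{F}$), then the wreath product $C_p\wr C_p$ is a homomorphic image of $S$.
   Context: $p$ is a prime. A fusion system $\mathcal{F}$ on a finite $p$-group $S$ is a category whose objects are the subgroups of $S$ and whose morphism sets consist of injective group homomorphisms, with $\mathrm{Hom}_S(P,Q)\subseteq \mathrm{Hom}_{\mathcal{F}}(P,Q)$ (where $\mathrm{Hom}_S(P,Q)$ is the set of maps induced by conjugation by elements of $S$), such that every morphism is the composite of an isomorphism in $\mathcal{F}$ and an inclusion. Saturation is in the sense of Broto–Levi–Oliver: call $P\le S$ fully normalized (resp. fully centralized) if $|N_S(P)|\ge|N_S(Q)|$ (resp. $|C_S(P)|\ge |C_S(Q)|$) for all $Q$ that are $\mathcal{F}$-isomorphic to $P$; then $\mathcal{F}$ is saturated if (I) every fully normalized $P$ is fully centralized and $\mathrm{Aut}_S(P)$ is a Sylow $p$-subgroup of $\mathrm{Aut}_{\mathcal{F}}(P)$, and (II) every $\varphi\in \mathrm{Hom}_{\mathcal{F}}(P,S)$ with $\varphi(P)$ fully centralized extends to a morphism in $\mathcal{F}$ on $N_\varphi=\{g\in N_S(P)\mid \varphi c_g\varphi^{-1}\in \mathrm{Aut}_S(\varphi(P))\}$. A fusion subsystem of $\mathcal{F}$ on $T\le S$ is a subcategory of $\mathcal{F}$ that is a fusion system on $T$.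 $N_{\mathcal{F}}(S)$ is the (saturated) fusion subsystem of $\mathcal{F}$ on $S$ whose morphisms $P\to Q$ are those $\varphi\in\mathrm{Hom}_{\mathcal{F}}(P,Q)$ that extend to an element of $\mathrm{Aut}_{\mathcal{F}}(S)$. The focal subgroup is $[S,\mathcal{F}]=\langle u^{-1}\alpha(u)\mid u\in P\le S,\ \alpha\in\mathrm{Aut}_{\mathcal{F}}(P)\rangle$, and likewise for $\mathcal{H}$. A saturated fusion subsystem $\mathcal{H}$ of $\mathcal{F}$ on $S$ controls transfer in $\mathcal{F}$ if $[S,\mathcal{F}]=[S,\mathcal{H}]$. $C_p$ is the cyclic group of order $p$. *)

theory Defs
  imports "HOL-Algebra.Algebra"
begin

text \<open>
  A category whose objects are subgroups of a group \<open>S\<close> and whose morphisms are maps between them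
  is given by its morphism sets: \<open>F P Q\<close> is \<open>Hom\<^sub>F(P,Q)\<close>. Its values matter only when \<open>P\<close> and \<open>Q\<close>
  are subgroups of \<open>S\<close>. A morphism with source \<open>P\<close> is an extensional function on \<open>P\<close>, so that
  equality of morphisms is equality of functions, composition is \<^const>\<open>compose\<close>, and the
  inclusion of \<open>P\<close> in \<open>Q\<close> is \<open>\<lambda>x\<in>P. x\<close>.
\<close>

type_synonym 'a hom_sets = "'a set \<Rightarrow> 'a set \<Rightarrow> ('a \<Rightarrow> 'a) set"

definition Iso_in :: "'a hom_sets \<Rightarrow> 'a set \<Rightarrow> 'a set \<Rightarrow> ('a \<Rightarrow> 'a) set" where
  "Iso_in F P Q =
    {\<phi> \<in> F P Q. \<exists>\<psi>\<in>F Q P. compose P \<psi> \<phi> = (\<lambda>x\<in>P. x) \<and> compose Q \<phi> \<psi> = (\<lambda>y\<in>Q. y)}"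

definition Aut_in :: "'a hom_sets \<Rightarrow> 'a set \<Rightarrow> ('a \<Rightarrow> 'a) set" where
  "Aut_in F P = Iso_in F P P"

definition Aut_group :: "'a hom_sets \<Rightarrow> 'a set \<Rightarrow> ('a \<Rightarrow> 'a) monoid" where
  "Aut_group F P = (BijGroup P)\<lparr>carrier := Aut_in F P\<rparr>"

definition conj_map :: "('a, 'm) monoid_scheme \<Rightarrow> 'a \<Rightarrow> 'a set \<Rightarrow> 'a \<Rightarrow> 'a" where
  "conj_map S g P = (\<lambda>x\<in>P. g \<otimes>\<^bsub>S\<^esub> x \<otimes>\<^bsub>S\<^esub> inv\<^bsub>S\<^esub> g)"

definition conj_hom :: "('a, 'm) monoid_scheme \<Rightarrow> 'a hom_sets" where
  "conj_hom S P Q = {conj_map S g P | g. g \<in> carrier S \<and> conj_map S g P ` P \<subseteq> Q}"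

definition centralizer :: "('a, 'm) monoid_scheme \<Rightarrow> 'a set \<Rightarrow> 'a set" where
  "centralizer S P = {g \<in> carrier S. \<forall>x\<in>P. g \<otimes>\<^bsub>S\<^esub> x = x \<otimes>\<^bsub>S\<^esub> g}"

definition sylow_subgroup :: "nat \<Rightarrow> 'a set \<Rightarrow> ('a, 'm) monoid_scheme \<Rightarrow> bool" where
  "sylow_subgroup p H G \<longleftrightarrow> subgroup H G \<and> card H = p ^ multiplicity p (order G)"

text \<open>Identities and inclusions are morphisms because they are conjugation by \<open>\<one>\<close>.\<close>

locale fusion_system = group S for p :: nat and S (structure) +
  fixes F :: "'a hom_sets"
  assumes prime_p: "Factorial_Ring.prime p"
    and finite_carrier: "finite (carrier S)"
    and p_group: "\<exists>n. order S = p ^ n"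
    and morphisms_injective:
      "\<lbrakk>subgroup P S; subgroup Q S\<rbrakk>
        \<Longrightarrow> F P Q \<subseteq> mon (S\<lparr>carrier := P\<rparr>) (S\<lparr>carrier := Q\<rparr>) \<inter> extensional P"
    and compose_closed:
      "\<lbrakk>subgroup P S; subgroup Q S; subgroup R S; \<phi> \<in> F P Q; \<psi> \<in> F Q R\<rbrakk>
        \<Longrightarrow> compose P \<psi> \<phi> \<in> F P R"
    and conj_hom_subset: "\<lbrakk>subgroup P S; subgroup Q S\<rbrakk> \<Longrightarrow> conj_hom S P Q \<subseteq> F P Q"
    and iso_then_inclusion:
      "\<lbrakk>subgroup P S; subgroup Q S; \<phi> \<in> F P Q\<rbrakk>
        \<Longrightarrow> \<exists>R \<psi>. subgroup R S \<and> R \<subseteq> Q \<and> \<psi> \<in> Iso_in F P R \<and> \<phi> = compose P (\<lambda>x\<in>R. x) \<psi>"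

definition fully_normalized :: "('a, 'm) monoid_scheme \<Rightarrow> 'a hom_sets \<Rightarrow> 'a set \<Rightarrow> bool" where
  "fully_normalized S F P \<longleftrightarrow>
    (\<forall>Q. subgroup Q S \<and> Iso_in F P Q \<noteq> {} \<longrightarrow> card (normalizer S P) \<ge> card (normalizer S Q))"

definition fully_centralized :: "('a, 'm) monoid_scheme \<Rightarrow> 'a hom_sets \<Rightarrow> 'a set \<Rightarrow> bool" where
  "fully_centralized S F P \<longleftrightarrow>
    (\<forall>Q. subgroup Q S \<and> Iso_in F P Q \<noteq> {} \<longrightarrow> card (centralizer S P) \<ge> card (centralizer S Q))"

text \<open>The group \<open>N\<^sub>\<phi>\<close>; the map below is \<open>\<phi> c\<^sub>g \<phi>\<inverse>\<close> on \<open>\<phi>(P)\<close>.\<close>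

definition ext_domain :: "('a, 'm) monoid_scheme \<Rightarrow> 'a set \<Rightarrow> ('a \<Rightarrow> 'a) \<Rightarrow> 'a set" where
  "ext_domain S P \<phi> =
    {g \<in> normalizer S P.
      (\<lambda>y\<in>\<phi> ` P. \<phi> (conj_map S g P (inv_into P \<phi> y))) \<in> Aut_in (conj_hom S) (\<phi> ` P)}"

locale saturated_fusion_system = fusion_system +
  assumes saturation_I:
      "\<lbrakk>subgroup P S; fully_normalized S F P\<rbrakk>
        \<Longrightarrow> fully_centralized S F P \<and> sylow_subgroup p (Aut_in (conj_hom S) P) (Aut_group F P)"
    and saturation_II:
      "\<lbrakk>subgroup P S; \<phi> \<in> F P (carrier S); fully_centralized S F (\<phi> ` P)\<rbrakk>
        \<Longrightarrow> \<exists>\<psi>\<in>F (ext_domain S P \<phi>) (carrier S). restrict \<psi> P = \<phi>"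

definition normalizer_system :: "('a, 'm) monoid_scheme \<Rightarrow> 'a hom_sets \<Rightarrow> 'a hom_sets" where
  "normalizer_system S F P Q = {\<phi> \<in> F P Q. \<exists>\<psi>\<in>Aut_in F (carrier S). restrict \<psi> P = \<phi>}"

definition focal_subgroup :: "('a, 'm) monoid_scheme \<Rightarrow> 'a hom_sets \<Rightarrow> 'a set" where
  "focal_subgroup S F =
    generate S {inv\<^bsub>S\<^esub> u \<otimes>\<^bsub>S\<^esub> \<alpha> u | u \<alpha> P. subgroup P S \<and> u \<in> P \<and> \<alpha> \<in> Aut_in F P}"

text \<open>
  The regular wreath product \<open>A \<wr> B\<close>: the semidirect product of the base group of all functions
  \<open>f\<close> from \<open>B\<close> to \<open>A\<close> by \<open>B\<close>, where \<open>b\<close> acts by \<open>(b \<cdot> f) x = f (b\<inverse> x)\<close>.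
\<close>

definition wreath_product ::
  "('a, 'm) monoid_scheme \<Rightarrow> ('b, 'n) monoid_scheme \<Rightarrow> (('b \<Rightarrow> 'a) \<times> 'b) monoid" where
  "wreath_product A B =
    (let N = product_group (carrier B) (\<lambda>_. A) in
      \<lparr>carrier = carrier N \<times> carrier B,
       monoid.mult = \<lambda>(f, b) (g, c). (f \<otimes>\<^bsub>N\<^esub> (\<lambda>x\<in>carrier B. g (inv\<^bsub>B\<^esub> b \<otimes>\<^bsub>B\<^esub> x)), b \<otimes>\<^bsub>B\<^esub> c),
       one = (\<one>\<^bsub>N\<^esub>, \<one>\<^bsub>B\<^esub>)\<rparr>)"

end

theory Submission
  imports Defs "HOL-Number_Theory.Cong"
begin

text \<open>
  Choose a character \<open>\<lambda>: S \<rightarrow> \<complex>\<^sup>*\<close> that is trivial on \<open>[S, N\<^sub>F(S)]\<close> and has order \<open>p\<close> on \<open>[S, F]\<close>. It is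
  invariant under \<open>Aut\<^sub>F(S)\<close>. Consider monomial \<open>S\<close>-sets \<open>Ind\<^sub>P \<chi>\<close> with \<open>\<chi> = \<lambda> \<circ> \<psi>\<close>, \<open>\<psi> \<in> Hom\<^sub>F(P, S)\<close>. As in the
  construction of the characteristic biset of Broto, Levi and Oliver, going down through the subgroups
  of \<open>S\<close>, integer multiples of such sets with \<open>P < S\<close> can be added to \<open>Ind\<^sub>S \<lambda>\<close> until all fixed point
  numbers are invariant under \<open>F\<close>: saturation and Burnside's lemma give the required congruences. The
  product of all weights of such a combination is a character of \<open>S\<close> that depends only on fixed point
  numbers, so it is trivial on \<open>[S, F]\<close>, while the summand \<open>Ind\<^sub>S \<lambda>\<close> contributes \<open>\<lambda>\<close>. Hence for \<open>u\<close> in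
  \<open>[S, F]\<close> with \<open>\<lambda>(u) \<noteq> 1\<close> some transfer from a proper subgroup \<open>P\<close> is nontrivial at \<open>u\<close>, and
  it remains nontrivial when \<open>\<chi>\<close> is replaced by \<open>\<nu> = \<chi>/\<lambda>\<close>, which takes values in the \<open>p\<close>-th roots of
  unity. Take \<open>u\<close> of minimal order. Points that \<open>u\<close> moves contribute trivially to its transfer, so \<open>u\<close>
  lies in every subgroup of index \<open>p\<close> containing \<open>P\<close>. The action of \<open>S\<close> on the blocks of \<open>S/P\<close> over
  such a subgroup \<open>Q\<close> maps \<open>S\<close> to \<open>C\<^sub>p \<wr> S/Q\<close>, and the image of \<open>u\<close> generates the whole base group as a
  module, because its coordinate sum is nonzero.
\<close>

subsection \<open>Group actions and linear characters\<close>

text \<open>The descent works because the table of marks is triangular: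
  \<open>Ind\<^sub>P \<chi>\<close> has mark 0 at every pair that is not conjugate into
  \<open>(P, \<chi>)\<close>, so marks at subgroups of one order can be adjusted without disturbing
  those at larger subgroups. The adjustment is integral only if the defect at a pair is divisible by
  the diagonal mark, which is the index of the subgroup in the stabilizer of the pair. The obstacle
  is that saturation speaks of subgroups, whereas here a morphism must extend to the stabilizer of a
  subgroup together with a character; a good choice of the conjugate character on a fully normalized
  subgroup overcomes this. Fixed point numbers determine the product of weights because those of all
  powers of g tell, by another triangular inversion, how many cycles of each length and weight g
  has. Permutation signs are left out of this product: for p = 2 they would bring in characters
  unrelated to \<lambda>.\<close>

lemma prod_powi: "(\<Prod>i\<in>A. f i) powi n = (\<Prod>i\<in>A. f i powi n)" for f :: "'i \<Rightarrow> complex"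
  by (induction A rule: infinite_finite_induct) (auto simp: power_int_mult_distrib)

lemma powi_sum: "x \<noteq> 0 \<Longrightarrow> x powi (\<Sum>i\<in>A. f i) = (\<Prod>i\<in>A. x powi f i)" for x :: complex
  by (induction A rule: infinite_finite_induct) (auto simp: power_int_add)

text \<open>Bridge to the library, where an action is a homomorphism into \<open>BijGroup\<close>
  and hence consists of extensional maps. The actions below are plain functions such as
  \<open>l_coset G\<close>.\<close>

lemma group_actionI:
  assumes "group G"
    and closed: "\<And>g x. g \<in> carrier G \<Longrightarrow> x \<in> \<Omega> \<Longrightarrow> act g x \<in> \<Omega>"
    and one: "\<And>x. x \<in> \<Omega> \<Longrightarrow> act (\<one>\<^bsub>G\<^esub>) x = x"
    and mult: "\<And>g h x. g \<in> carrier G \<Longrightarrow> h \<in> carrier G \<Longrightarrow> x \<in> \<Omega> \<Longrightarrow>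
        act (g \<otimes>\<^bsub>G\<^esub> h) x = act g (act h x)"
  shows "group_action G \<Omega> (\<lambda>g. \<lambda>x\<in>\<Omega>. act g x)"
proof -
  interpret G: group G by fact
  have inv: "act (inv\<^bsub>G\<^esub> g) (act g x) = x" "act g (act (inv\<^bsub>G\<^esub> g) x) = x"
    if "g \<in> carrier G" "x \<in> \<Omega>" for g x
    using that mult[of "inv\<^bsub>G\<^esub> g" g x] mult[of g "inv\<^bsub>G\<^esub> g" x] one by auto
  have bij: "(\<lambda>x\<in>\<Omega>. act g x) \<in> Bij \<Omega>" if g: "g \<in> carrier G" for g
  proof -
    have "bij_betw (act g) \<Omega> \<Omega>"
      by (rule bij_betwI[where g = "act (inv\<^bsub>G\<^esub> g)"]) (use g closed inv in auto)
    then show ?thesis by (simp add: Bij_def)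
  qed
  have "(\<lambda>g. \<lambda>x\<in>\<Omega>. act g x) \<in> hom G (BijGroup \<Omega>)"
  proof (rule homI)
    fix g h assume gh: "g \<in> carrier G" "h \<in> carrier G"
    have "(\<lambda>x\<in>\<Omega>. act (g \<otimes>\<^bsub>G\<^esub> h) x) = compose \<Omega> (\<lambda>x\<in>\<Omega>. act g x) (\<lambda>x\<in>\<Omega>. act h x)"
      using gh closed mult by (auto simp: compose_def restrict_def fun_eq_iff)
    then show "(\<lambda>x\<in>\<Omega>. act (g \<otimes>\<^bsub>G\<^esub> h) x) = (\<lambda>x\<in>\<Omega>. act g x) \<otimes>\<^bsub>BijGroup \<Omega>\<^esub> (\<lambda>x\<in>\<Omega>. act h x)"
      using gh bij by (simp add: BijGroup_def)
  qed (use bij in \<open>simp add: BijGroup_def\<close>)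
  then show ?thesis
    by (simp add: group_action_def group_hom_def group_hom_axioms_def group_BijGroup G.is_group)
qed

text \<open>The sum is the group order times the number of orbits. Only this divisibility is used;
  it is the source of all congruences between marks.\<close>

lemma burnside_dvd:
  assumes "group G" "finite (carrier G)" "finite \<Omega>"
    and closed: "\<And>g x. g \<in> carrier G \<Longrightarrow> x \<in> \<Omega> \<Longrightarrow> act g x \<in> \<Omega>"
    and one: "\<And>x. x \<in> \<Omega> \<Longrightarrow> act (\<one>\<^bsub>G\<^esub>) x = x"
    and mult: "\<And>g h x. g \<in> carrier G \<Longrightarrow> h \<in> carrier G \<Longrightarrow> x \<in> \<Omega> \<Longrightarrow>
        act (g \<otimes>\<^bsub>G\<^esub> h) x = act g (act h x)"
  shows "card (carrier G) dvd (\<Sum>g\<in>carrier G. card {x \<in> \<Omega>. act g x = x})"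
proof -
  interpret group_action G \<Omega> "\<lambda>g. \<lambda>x\<in>\<Omega>. act g x"
    using assms by (intro group_actionI)
  have "invariants \<Omega> (\<lambda>g. \<lambda>x\<in>\<Omega>. act g x) g = {x \<in> \<Omega>. act g x = x}" for g
    by (auto simp: invariants_def)
  then show ?thesis
    using burnside[OF assms(2,3)] by (simp add: order_def) (metis dvd_triv_right)
qed

text \<open>Orbit lengths are powers of p, so some orbit has length 1 as soon as p does not divide
  the number of points.\<close>

lemma p_group_fixed_point:
  assumes "group G" and p: "Factorial_Ring.prime (p::nat)" and ord: "order G = p ^ n"
    and ndvd: "\<not> p dvd card \<Omega>"
    and closed: "\<And>g x. g \<in> carrier G \<Longrightarrow> x \<in> \<Omega> \<Longrightarrow> act g x \<in> \<Omega>"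
    and one: "\<And>x. x \<in> \<Omega> \<Longrightarrow> act (\<one>\<^bsub>G\<^esub>) x = x"
    and mult: "\<And>g h x. g \<in> carrier G \<Longrightarrow> h \<in> carrier G \<Longrightarrow> x \<in> \<Omega> \<Longrightarrow>
        act (g \<otimes>\<^bsub>G\<^esub> h) x = act g (act h x)"
  shows "\<exists>x\<in>\<Omega>. \<forall>g\<in>carrier G. act g x = x"
proof -
  let ?a = "\<lambda>g. \<lambda>x\<in>\<Omega>. act g x"
  interpret group_action G \<Omega> ?a
    using assms by (intro group_actionI)
  have fin: "finite \<Omega>" using ndvd by (metis card.infinite dvd_0_right)
  have "card \<Omega> = (\<Sum>orb\<in>orbits G \<Omega> ?a. card orb)"
    using disjoint_sum[OF fin, of "\<lambda>_. 1::nat"] by simp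
  then obtain orb where orb: "orb \<in> orbits G \<Omega> ?a" and nd: "\<not> p dvd card orb"
    using ndvd dvd_sum by metis
  obtain x where x: "x \<in> \<Omega>" "orb = orbit G ?a x"
    using orb by (auto simp: orbits_def)
  have "card orb dvd p ^ n"
    using orbit_stabilizer_theorem[OF x(1)] x(2) ord by (metis dvd_triv_left)
  then obtain k where "card orb = p ^ k"
    using p by (auto simp: divides_primepow_nat)
  with nd have "card orb = 1" by (cases k) auto
  moreover have "x \<in> orb" using orbit_refl x by simp
  ultimately have "orb = {x}" by (metis card_1_singletonE singletonD)
  then have "\<forall>g\<in>carrier G. act g x = x"
    using x by (auto simp: orbit_def)
  then show ?thesis using x by blast
qed

text \<open>\<open>N\<close> acts through \<open>f\<close> on the left cosets of \<open>P\<close>,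
  whose number is prime to p, and a fixed coset \<open>aP\<close> conjugates the image of
  \<open>f\<close> into \<open>P\<close>. A homomorphism is allowed, not just a subgroup, because
  conjugation maps \<open>c\<^sub>g\<close> are fed in later.\<close>

lemma sylow_contains_conjugate:
  assumes "group G" "finite (carrier G)" "group N"
    and p: "Factorial_Ring.prime (p::nat)" and N: "order N = p ^ n"
    and f: "f \<in> hom N G" and P: "sylow_subgroup p P G"
  shows "\<exists>a\<in>carrier G. \<forall>x\<in>carrier N. inv\<^bsub>G\<^esub> a \<otimes>\<^bsub>G\<^esub> f x \<otimes>\<^bsub>G\<^esub> a \<in> P"
proof -
  interpret G: group G by fact
  interpret N: group N by fact
  have subP: "subgroup P G" and cardP: "card P = p ^ multiplicity p (order G)"
    using P by (auto simp: sylow_subgroup_def)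
  interpret P: subgroup P G by fact
  have fc: "f x \<in> carrier G" if "x \<in> carrier N" for x
    using f that by (auto simp: hom_def)
  have fm: "f (x \<otimes>\<^bsub>N\<^esub> y) = f x \<otimes>\<^bsub>G\<^esub> f y" if "x \<in> carrier N" "y \<in> carrier N" for x y
    using f that by (auto simp: hom_def)
  have f1: "f (\<one>\<^bsub>N\<^esub>) = \<one>\<^bsub>G\<^esub>"
    using hom_one[OF f] assms by blast
  have ord: "order G > 0"
    using assms(2) G.one_closed by (auto simp: order_def card_gt_0_iff)
  have ndvd: "\<not> p dvd card (lcosets\<^bsub>G\<^esub> P)"
  proof
    assume "p dvd card (lcosets\<^bsub>G\<^esub> P)"
    then have "p * p ^ multiplicity p (order G) dvd order G"
      using G.l_lagrange[OF assms(2) subP] cardP by (metis mult_dvd_mono dvd_refl)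
    then have "Suc (multiplicity p (order G)) \<le> multiplicity p (order G)"
      using ord p by (intro multiplicity_geI) (auto simp: not_prime_unit)
    then show False by simp
  qed
  have "\<exists>C\<in>lcosets\<^bsub>G\<^esub> P. \<forall>x\<in>carrier N. f x <#\<^bsub>G\<^esub> C = C"
  proof (rule p_group_fixed_point[OF \<open>group N\<close> p N ndvd, of "\<lambda>x C. f x <#\<^bsub>G\<^esub> C"])
    show "f x <#\<^bsub>G\<^esub> C \<in> lcosets\<^bsub>G\<^esub> P" if "x \<in> carrier N" "C \<in> lcosets\<^bsub>G\<^esub> P" for x C
      using that fc by (auto simp: LCOSETS_def G.lcos_m_assoc P.subset)
    show "f (\<one>\<^bsub>N\<^esub>) <#\<^bsub>G\<^esub> C = C" if "C \<in> lcosets\<^bsub>G\<^esub> P" for C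
      using that f1 by (auto simp: LCOSETS_def G.lcos_m_assoc P.subset)
    show "f (x \<otimes>\<^bsub>N\<^esub> y) <#\<^bsub>G\<^esub> C = f x <#\<^bsub>G\<^esub> (f y <#\<^bsub>G\<^esub> C)"
      if "x \<in> carrier N" "y \<in> carrier N" "C \<in> lcosets\<^bsub>G\<^esub> P" for x y C
      using that fc fm by (auto simp: LCOSETS_def G.lcos_m_assoc P.subset G.m_assoc)
  qed
  then obtain a where a: "a \<in> carrier G" "\<forall>x\<in>carrier N. f x <#\<^bsub>G\<^esub> (a <#\<^bsub>G\<^esub> P) = a <#\<^bsub>G\<^esub> P"
    by (auto simp: LCOSETS_def)
  have "inv\<^bsub>G\<^esub> a \<otimes>\<^bsub>G\<^esub> f x \<otimes>\<^bsub>G\<^esub> a \<in> P" if x: "x \<in> carrier N" for x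
  proof -
    have "f x \<otimes>\<^bsub>G\<^esub> a \<in> f x <#\<^bsub>G\<^esub> (a <#\<^bsub>G\<^esub> P)"
      using G.lcos_self[OF _ subP, of "f x \<otimes>\<^bsub>G\<^esub> a"] a fc[OF x] by (simp add: G.lcos_m_assoc P.subset)
    then have "f x \<otimes>\<^bsub>G\<^esub> a \<in> a <#\<^bsub>G\<^esub> P" using a x by simp
    then show ?thesis
      using P.lcos_module_imp[OF \<open>group G\<close> a(1)] a fc[OF x] by (simp add: G.m_assoc)
  qed
  then show ?thesis using a by blast
qed

section \<open>Linear characters of subgroups and their extension\<close>

definition character :: "('a, 'm) monoid_scheme \<Rightarrow> 'a set \<Rightarrow> ('a \<Rightarrow> complex) \<Rightarrow> bool" where
  "character G B \<chi> \<longleftrightarrow> (\<forall>x\<in>B. \<chi> x \<noteq> 0) \<and> (\<forall>x\<in>B. \<forall>y\<in>B. \<chi> (x \<otimes>\<^bsub>G\<^esub> y) = \<chi> x * \<chi> y)"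

context group
begin

lemma character_nonzero: "character G B \<chi> \<Longrightarrow> x \<in> B \<Longrightarrow> \<chi> x \<noteq> 0"
  and character_mult: "character G B \<chi> \<Longrightarrow> x \<in> B \<Longrightarrow> y \<in> B \<Longrightarrow> \<chi> (x \<otimes> y) = \<chi> x * \<chi> y"
  by (auto simp: character_def)

lemma character_one: "character G B \<chi> \<Longrightarrow> subgroup B G \<Longrightarrow> \<chi> \<one> = 1"
  using character_mult[of B \<chi> \<one> \<one>] character_nonzero[of B \<chi> \<one>]
  by (simp add: subgroup.one_closed)

lemma character_inv:
  assumes "character G B \<chi>" "subgroup B G" "x \<in> B"
  shows "\<chi> (inv x) = inverse (\<chi> x)"
proof -
  have "\<chi> (inv x) * \<chi> x = 1"
    using character_mult[OF assms(1), of "inv x" x] character_one[OF assms(1,2)] assms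
    by (simp add: subgroup.m_inv_closed subgroup.mem_carrier)
  then show ?thesis by (metis inverse_unique mult.commute)
qed

lemma inv_mult_cancel:
  assumes "x \<in> carrier G" "y \<in> carrier G"
  shows "inv x \<otimes> (x \<otimes> y) = y" "x \<otimes> (inv x \<otimes> y) = y"
  using assms by (simp_all flip: m_assoc)

lemma subgroup_nat_pow_closed: "subgroup B G \<Longrightarrow> x \<in> B \<Longrightarrow> x [^] (n::nat) \<in> B"
  by (induction n) (auto simp: subgroup.one_closed subgroup.m_closed)

lemma character_pow:
  assumes "character G B \<chi>" "subgroup B G" "x \<in> B"
  shows "\<chi> (x [^] (n::nat)) = \<chi> x ^ n"
proof (induction n)
  case (Suc n)
  have "x [^] n \<in> B"
    using assms subgroup_nat_pow_closed by blast
  then show ?case using Suc character_mult[OF assms(1), of "x [^] n" x] assms by simp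
qed (use character_one assms in simp)

text \<open>Every element of the larger group is some \<open>b \<otimes> s [^] i\<close>, and the
  new value is \<open>\<chi> b * z ^ i\<close>. The only relation to respect is the one at the least
  power of \<open>s\<close> in \<open>B\<close>. Since commutators lie in the kernel of \<chi>,
  conjugation by \<open>s\<close> preserves \<open>B\<close> and \<chi>, which makes the new map
  multiplicative.\<close>

lemma extend_character:
  assumes B: "subgroup B G" and chi: "character G B \<chi>" and s: "s \<in> carrier G"
    and comm: "\<And>x y. x \<in> carrier G \<Longrightarrow> y \<in> carrier G \<Longrightarrow>
      x \<otimes> y \<otimes> inv x \<otimes> inv y \<in> B \<and> \<chi> (x \<otimes> y \<otimes> inv x \<otimes> inv y) = 1"
    and r: "s [^] (r::nat) \<in> B" "0 < r"
    and min: "\<And>t::nat. 0 < t \<Longrightarrow> t < r \<Longrightarrow> s [^] t \<notin> B" and z: "z ^ r = \<chi> (s [^] r)"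
  shows "\<exists>B' \<chi>'. subgroup B' G \<and> B \<subseteq> B' \<and> s \<in> B' \<and> character G B' \<chi>' \<and>
    (\<forall>x\<in>B. \<chi>' x = \<chi> x) \<and> \<chi>' s = z"
proof -
  interpret B: subgroup B G by fact
  note Bc[simp] = B.mem_carrier
  have z0: "z \<noteq> 0" using z r character_nonzero[OF chi] by (metis power_0_left zero_power)
  \<comment> \<open>Minimality of \<open>r\<close> forces \<open>r\<close> to divide
    \<open>d\<close>, so \<open>z ^ r = \<chi> (s [^] r)\<close> takes care of every power of
    \<open>s\<close> in \<open>B\<close>.\<close>
  have powB: "s [^] d \<in> B \<Longrightarrow> \<chi> (s [^] d) = z ^ d" for d :: nat
  proof -
    assume d: "s [^] d \<in> B"
    have eq: "s [^] d = (s [^] r) [^] (d div r) \<otimes> s [^] (d mod r)"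
      using s by (simp add: nat_pow_pow nat_pow_mult)
    have "(s [^] r) [^] (d div r) \<in> B" by (rule subgroup_nat_pow_closed[OF B r(1)])
    then have "inv ((s [^] r) [^] (d div r)) \<otimes> s [^] d \<in> B" using d by simp
    then have "s [^] (d mod r) \<in> B" using s eq by (simp add: inv_solve_left' flip: m_assoc)
    then have "d mod r = 0" using min[of "d mod r"] r(2) by (metis mod_less_divisor neq0_conv)
    then have "s [^] d = (s [^] r) [^] (d div r)" and "d = r * (d div r)"
      using eq s by auto
    then show "\<chi> (s [^] d) = z ^ d"
      using character_pow[OF chi B r(1)] z by (metis power_mult)
  qed
  have wd0: "\<chi> b * z ^ i = \<chi> b' * z ^ j"
    if "b \<in> B" "b' \<in> B" "b \<otimes> s [^] i = b' \<otimes> s [^] j" "i \<le> j" for b b' and i j :: nat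
  proof -
    have "b' \<otimes> s [^] j = b' \<otimes> s [^] (j - i) \<otimes> s [^] i"
      using that s by (simp add: m_assoc nat_pow_mult)
    then have b: "b = b' \<otimes> s [^] (j - i)"
      using that s by (metis Bc m_closed nat_pow_closed r_cancel)
    then have "s [^] (j - i) = inv b' \<otimes> b" using that s by (simp flip: m_assoc)
    then have "s [^] (j - i) \<in> B" using that by simp
    then have "\<chi> b = \<chi> b' * z ^ (j - i)" using b powB that character_mult[OF chi] by metis
    then show ?thesis using that by (simp flip: power_add)
  qed
  then have wd: "\<chi> b * z ^ i = \<chi> b' * z ^ j"
    if "b \<in> B" "b' \<in> B" "b \<otimes> s [^] i = b' \<otimes> s [^] j" for b b' and i j :: nat
    using that by (metis nle_le)
  define B' where "B' = {b \<otimes> s [^] i | b i. b \<in> B \<and> (i::nat) \<in> UNIV}"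
  \<comment> \<open>The representation \<open>b \<otimes> s [^] i\<close> is not unique; by
    \<open>wd\<close> every choice gives the same value.\<close>
  define \<chi>' where "\<chi>' x = (SOME v. \<exists>b i. b \<in> B \<and> x = b \<otimes> s [^] (i::nat) \<and> v = \<chi> b * z ^ i)" for x
  have chi': "\<chi>' (b \<otimes> s [^] i) = \<chi> b * z ^ i" if "b \<in> B" for b and i :: nat
  proof -
    have "\<exists>b' j. b' \<in> B \<and> b \<otimes> s [^] i = b' \<otimes> s [^] (j::nat) \<and> \<chi>' (b \<otimes> s [^] i) = \<chi> b' * z ^ j"
      unfolding \<chi>'_def by (rule someI_ex) (use that in blast)
    then show ?thesis using wd that by metis
  qed
  have conj: "s [^] i \<otimes> b \<otimes> inv (s [^] i) \<in> B" "\<chi> (s [^] i \<otimes> b \<otimes> inv (s [^] i)) = \<chi> b"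
    if "b \<in> B" for b and i :: nat
  proof -
    let ?c = "s [^] i \<otimes> b \<otimes> inv (s [^] i) \<otimes> inv b"
    have c: "?c \<in> B" "\<chi> ?c = 1" using comm[of "s [^] i" b] that s by auto
    have eq: "s [^] i \<otimes> b \<otimes> inv (s [^] i) = ?c \<otimes> b" using that s by (simp add: m_assoc)
    show "s [^] i \<otimes> b \<otimes> inv (s [^] i) \<in> B"
      by (subst eq) (rule B.m_closed[OF c(1) that])
    show "\<chi> (s [^] i \<otimes> b \<otimes> inv (s [^] i)) = \<chi> b"
      by (subst eq) (simp only: character_mult[OF chi c(1) that] c(2) mult_1_left)
  qed
  have mult: "b \<otimes> s [^] i \<otimes> (b' \<otimes> s [^] j) = b \<otimes> (s [^] i \<otimes> b' \<otimes> inv (s [^] i)) \<otimes> s [^] (i + j)"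
    if "b \<in> B" "b' \<in> B" for b b' and i j :: nat
  proof -
    have "s [^] i \<otimes> b' \<otimes> s [^] j = s [^] i \<otimes> b' \<otimes> inv (s [^] i) \<otimes> (s [^] i \<otimes> s [^] j)"
      using that s by (simp add: m_assoc inv_mult_cancel)
    moreover have "b \<otimes> s [^] i \<otimes> (b' \<otimes> s [^] j) = b \<otimes> (s [^] i \<otimes> b' \<otimes> s [^] j)"
      using that s by (simp add: m_assoc)
    moreover have "s [^] i \<otimes> s [^] j = s [^] (i + j)" using s by (rule nat_pow_mult)
    ultimately show ?thesis using that s by (simp add: m_assoc del: nat_pow_mult)
  qed
  have fin_inv: "inv (b \<otimes> s [^] i) \<in> B'" if b: "b \<in> B" for b and i :: nat
  proof -
    \<comment> \<open>Exponents are natural numbers, so the inverse of \<open>s [^] i\<close> is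
      written with the exponent \<open>i * r - i\<close> and the element
      \<open>s [^] (i * r)\<close> of \<open>B\<close>.\<close>
    let ?k = "i * r - i"
    have ir: "i \<le> i * r" using r(2) by simp
    have rB: "s [^] (i * r) \<in> B"
      using subgroup_nat_pow_closed[OF B r(1), of i] s by (simp add: nat_pow_pow mult.commute)
    have e: "s [^] i \<otimes> s [^] ?k = s [^] (i * r)" using s ir by (simp add: nat_pow_mult)
    have "inv (s [^] i) = s [^] ?k \<otimes> inv (s [^] i \<otimes> s [^] ?k)"
      using s by (simp add: inv_mult_group inv_mult_cancel)
    then have "inv (s [^] i) = s [^] ?k \<otimes> inv (s [^] (i * r))" unfolding e .
    then have e1: "inv (b \<otimes> s [^] i) = s [^] ?k \<otimes> (inv (s [^] (i * r)) \<otimes> inv b)"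
      using s b by (simp add: inv_mult_group m_assoc)
    let ?c = "inv (s [^] (i * r)) \<otimes> inv b"
    have c: "?c \<in> B" using b rB by simp
    have "s [^] ?k \<otimes> ?c = (s [^] ?k \<otimes> ?c \<otimes> inv (s [^] ?k)) \<otimes> s [^] ?k"
      using s c b by (simp add: m_assoc)
    then show ?thesis unfolding e1 B'_def using conj(1)[OF c] by blast
  qed
  have subB': "subgroup B' G"
  proof (rule subgroupI)
    show "B' \<subseteq> carrier G" unfolding B'_def using s by auto
    show "B' \<noteq> {}" unfolding B'_def using B.one_closed by blast
    show "inv a \<in> B'" if "a \<in> B'" for a
      using that fin_inv unfolding B'_def by blast
    show "a \<otimes> b \<in> B'" if ab: "a \<in> B'" "b \<in> B'" for a b
    proof -
      obtain c i where a: "a = c \<otimes> s [^] (i::nat)" "c \<in> B"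
        using ab(1) by (auto simp: B'_def)
      obtain d j where b: "b = d \<otimes> s [^] (j::nat)" "d \<in> B"
        using ab(2) by (auto simp: B'_def)
      show ?thesis unfolding a(1) b(1) mult[OF a(2) b(2)] B'_def using conj(1)[OF b(2)] a b by blast
    qed
  qed
  have "character G B' \<chi>'"
    unfolding character_def
  proof (intro conjI ballI)
    fix a assume "a \<in> B'"
    then obtain c i where a: "a = c \<otimes> s [^] (i::nat)" "c \<in> B" by (auto simp: B'_def)
    then show "\<chi>' a \<noteq> 0" using chi' z0 character_nonzero[OF chi] by simp
    fix b assume "b \<in> B'"
    then obtain d j where b: "b = d \<otimes> s [^] (j::nat)" "d \<in> B" by (auto simp: B'_def)
    show "\<chi>' (a \<otimes> b) = \<chi>' a * \<chi>' b"
      unfolding a(1) b(1) mult[OF a(2) b(2)]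
      using conj[OF b(2)] a b character_mult[OF chi] by (simp add: chi' power_add)
  qed
  moreover have mem: "b \<otimes> s [^] i \<in> B'" if "b \<in> B" for b and i :: nat
    unfolding B'_def using that by blast
  moreover have "\<chi>' x = \<chi> x" "x \<in> B'" if "x \<in> B" for x
    using chi'[OF that, of 0] mem[OF that, of 0] that by auto
  moreover have "\<chi>' s = z" "s \<in> B'"
    using chi'[OF B.one_closed, of 1] mem[OF B.one_closed, of 1] character_one[OF chi B] s by auto
  ultimately show ?thesis using subB' by blast
qed

text \<open>On the group generated by \<open>L\<close> and \<open>k\<close> send \<open>k\<close> to
  a root of unity other than 1, which exists because at least the second power of \<open>k\<close>
  is needed to reach \<open>L\<close>. Roots exist in the complex numbers, so a largest group
  carrying such a character is the whole group. All groups above \<open>L\<close> contain the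
  commutators, as the extension step requires.\<close>

lemma exists_separating_character:
  assumes fin: "finite (carrier G)" and L: "subgroup L G" and k: "k \<in> carrier G" "k \<notin> L"
    and comm: "\<And>x y. x \<in> carrier G \<Longrightarrow> y \<in> carrier G \<Longrightarrow> x \<otimes> y \<otimes> inv x \<otimes> inv y \<in> L"
  shows "\<exists>\<chi>. character G (carrier G) \<chi> \<and> (\<forall>x\<in>L. \<chi> x = 1) \<and> \<chi> k \<noteq> 1"
proof -
  have minpow: "\<exists>r>0. s [^] (r::nat) \<in> B \<and> (\<forall>t. 0 < t \<longrightarrow> t < r \<longrightarrow> s [^] (t::nat) \<notin> B)"
    if "subgroup B G" "s \<in> carrier G" for B s
  proof -
    have "s [^] order G \<in> B" "order G > 0"
      using that pow_order_eq_1 fin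
      by (auto simp: subgroup.one_closed order_gt_0_iff_finite)
    then have "\<exists>r. r > 0 \<and> s [^] (r::nat) \<in> B" by blast
    then show ?thesis
      using exists_least_iff[of "\<lambda>r. r > 0 \<and> s [^] (r::nat) \<in> B"] by blast
  qed
  define P where "P B \<longleftrightarrow> subgroup B G \<and> L \<subseteq> B \<and> k \<in> B \<and>
    (\<exists>\<chi>. character G B \<chi> \<and> (\<forall>x\<in>L. \<chi> x = 1) \<and> \<chi> k \<noteq> 1)" for B
  have "\<exists>B. P B"
  proof -
    obtain r where r: "r > 0" "k [^] (r::nat) \<in> L"
        "\<forall>t. 0 < t \<longrightarrow> t < r \<longrightarrow> k [^] (t::nat) \<notin> L"
      using minpow[OF L k(1)] by metis
    have "r \<noteq> 1" using r(2) k by (metis nat_pow_eone)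
    have "\<exists>z::complex. z ^ r = 1 \<and> z \<noteq> 1"
    proof (rule ccontr)
      assume "\<not> ?thesis"
      then have "{z::complex. z ^ r = 1} \<subseteq> {1}" by auto
      then have "card {z::complex. z ^ r = 1} \<le> 1"
        using card_mono[of "{1::complex}"] by simp
      then show False using card_roots_unity_eq[OF r(1)] r(1) \<open>r \<noteq> 1\<close> by simp
    qed
    then obtain z :: complex where z: "z ^ r = 1" "z \<noteq> 1" by blast
    have "\<exists>B' \<chi>'. subgroup B' G \<and> L \<subseteq> B' \<and> k \<in> B' \<and> character G B' \<chi>' \<and>
        (\<forall>x\<in>L. \<chi>' x = (\<lambda>_. 1) x) \<and> \<chi>' k = z"
      by (rule extend_character[OF L _ k(1) _ r(2,1) r(3)[rule_format]])
        (use comm z in \<open>auto simp: character_def\<close>)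
    then show ?thesis unfolding P_def using z by metis
  qed
  then obtain B where B: "P B" "\<And>B'. P B' \<Longrightarrow> card B' \<le> card B"
    using ex_has_greatest_nat[of P _ card "Suc (card (carrier G))"]
    by (metis P_def card_mono fin less_Suc_eq_le subgroup.subset)
  obtain \<chi> where chi: "character G B \<chi>" "\<forall>x\<in>L. \<chi> x = 1" "\<chi> k \<noteq> 1" and subB: "subgroup B G"
      and LB: "L \<subseteq> B" and kB: "k \<in> B"
    using B(1) unfolding P_def by blast
  have "B = carrier G"
  proof (rule ccontr)
    assume "B \<noteq> carrier G"
    then obtain s where s: "s \<in> carrier G" "s \<notin> B" using subgroup.subset[OF subB] by blast
    obtain r where r: "r > 0" "s [^] (r::nat) \<in> B"
        "\<forall>t. 0 < t \<longrightarrow> t < r \<longrightarrow> s [^] (t::nat) \<notin> B"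
      using minpow[OF subB s(1)] by metis
    have "card {z. z ^ r = \<chi> (s [^] r)} = r"
      using card_nth_roots[OF character_nonzero[OF chi(1) r(2)] r(1)] .
    then obtain z where z: "z ^ r = \<chi> (s [^] r)"
      using r(1) by (metis (mono_tags, lifting) card.empty empty_Collect_eq less_numeral_extra(3))
    obtain B' \<chi>' where B': "subgroup B' G" "B \<subseteq> B'" "s \<in> B'" "character G B' \<chi>'"
        "\<forall>x\<in>B. \<chi>' x = \<chi> x"
      using extend_character[OF subB chi(1) s(1) _ r(2,1) r(3)[rule_format] z] comm chi LB by blast
    have "P B'" unfolding P_def using B' chi LB kB by (metis subset_trans subsetD)
    then have "card B' \<le> card B" by (rule B(2))
    moreover have "finite B'" using B' fin by (meson finite_subset subgroup.subset)
    ultimately have "B = B'" using B' by (meson card_seteq)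
    then show False using B' s by blast
  qed
  then show ?thesis using chi by blast
qed

end

subsection \<open>Monomial sets\<close>

text \<open>All cycles of \<open>f\<close> on \<open>B\<close> have length exactly \<open>m\<close>
  and product \<open>a\<close>; the induction removes one cycle at a time.\<close>

lemma prod_over_cycles:
  fixes w :: "'x \<Rightarrow> 'c::comm_monoid_mult"
  assumes "finite B" "0 < m" "\<And>x. x \<in> B \<Longrightarrow> f x \<in> B"
    and "\<And>x. x \<in> B \<Longrightarrow> (f ^^ m) x = x"
    and "\<And>x i. x \<in> B \<Longrightarrow> 0 < i \<Longrightarrow> i < m \<Longrightarrow> (f ^^ i) x \<noteq> x"
    and "\<And>x. x \<in> B \<Longrightarrow> (\<Prod>i<m. w ((f ^^ i) x)) = a"
  shows "m dvd card B \<and> (\<Prod>x\<in>B. w x) = a ^ (card B div m)"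
  using assms
proof (induction "card B" arbitrary: B rule: less_induct)
  case less
  note fB = less.prems(3) and per = less.prems(4) and min = less.prems(5)
  show ?case
  proof (cases "B = {}")
    case False
    then obtain x where x: "x \<in> B" by blast
    have it: "(f ^^ i) y \<in> B" if "y \<in> B" for i y using that fB by (induction i) auto
    let ?O = "(\<lambda>i. (f ^^ i) x) ` {..<m}"
    have inj: "inj_on (\<lambda>i. (f ^^ i) x) {..<m}"
    proof (rule linorder_inj_onI)
      fix i j assume ij: "i < j" "i \<in> {..<m}" "j \<in> {..<m}"
      show "(f ^^ i) x \<noteq> (f ^^ j) x"
      proof
        assume "(f ^^ i) x = (f ^^ j) x"
        then have "(f ^^ (m - j)) ((f ^^ i) x) = (f ^^ (m - j)) ((f ^^ j) x)" by simp
        then have "(f ^^ (m - j + i)) x = (f ^^ m) x"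
          using ij by (simp flip: funpow_add[THEN fun_cong, unfolded comp_def])
        moreover have "0 < m - j + i" "m - j + i < m" using ij by auto
        ultimately show False using min[OF x] per[OF x] by metis
      qed
    qed auto
    have OB: "?O \<subseteq> B" using it[OF x] by auto
    have cO: "card ?O = m" using inj by (simp add: card_image)
    have prodO: "(\<Prod>y\<in>?O. w y) = a" using less.prems(6)[OF x] inj by (simp add: prod.reindex)
    \<comment> \<open>A point outside the cycle cannot enter it, since going round its own cycle,
      \<open>m - 1\<close> further steps lead from \<open>f y\<close> back to
      \<open>y\<close>.\<close>
    have clos: "f y \<in> B - ?O" if y: "y \<in> B - ?O" for y
    proof
      show "f y \<in> B" using y fB by blast
      show "f y \<notin> ?O"
      proof
        assume "f y \<in> ?O"
        then obtain i where i: "f y = (f ^^ i) x" "i < m" by auto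
        have "y = (f ^^ m) y" using per[of y] y by simp
        also have "\<dots> = (f ^^ (m - 1)) (f y)"
          using less.prems(2) funpow_Suc_right[of "m - 1" f] by (simp add: comp_def)
        also have "\<dots> = (f ^^ (m - 1 + i)) x" by (simp only: i(1) funpow_add comp_def)
        also have "\<dots> = (f ^^ ((m - 1 + i) mod m)) x"
          by (rule funpow_mod_eq[OF per[OF x], symmetric])
        finally show False using y less.prems(2) by auto
      qed
    qed
    have finB: "finite B" by fact
    have cB: "card (B - ?O) = card B - m"
      using OB cO finB by (simp add: card_Diff_subset finite_subset)
    have mB: "m \<le> card B" using card_mono[OF finB OB] cO by simp
    have IH: "m dvd card (B - ?O) \<and> (\<Prod>x\<in>B - ?O. w x) = a ^ (card (B - ?O) div m)"
    proof (rule less.hyps)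
      show "card (B - ?O) < card B" using cB mB less.prems(2) by simp
      show "finite (B - ?O)" using finB by simp
      show "f y \<in> B - ?O" if "y \<in> B - ?O" for y by (rule clos[OF that])
    qed (use per min less.prems(2,6) in \<open>simp_all\<close>)
    have "(\<Prod>x\<in>B. w x) = (\<Prod>x\<in>B - ?O. w x) * a"
      using prod.subset_diff[OF OB finB, of w] prodO by simp
    moreover have "card B div m = Suc ((card B - m) div m)"
      using mB less.prems(2) by (simp add: le_div_geq)
    moreover have "m dvd card B" using dvd_add[of m "card B - m" m] IH cB mB by simp
    ultimately show ?thesis using IH cB by (simp add: mult.commute)
  qed simp
qed

lemma (in group) finite_divisor_roots:
  assumes "finite (carrier G)"
  shows "finite {(d, b::complex). d dvd order G \<and> b ^ order G = 1}"
proof -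
  have "0 < order G" using assms by (simp add: order_gt_0_iff_finite)
  then have "finite ({d. d dvd order G} \<times> {b::complex. b ^ order G = 1})"
    using finite_roots_unity[of "order G"] by (intro finite_cartesian_product finite_divisors_nat) auto
  then show ?thesis by (rule finite_subset[rotated]) auto
qed

text \<open>
  A monomial set is a finite set of lines permuted by \<open>G\<close>: each line carries a basis vector, and \<open>g\<close>
  maps the one of \<open>x\<close> to \<open>\<kappa> g x\<close> times the one of \<open>act g x\<close>. Its determinant, up to the sign of
  the permutation, is the character \<open>transfer\<close>.
\<close>

locale monomial_set = group +
  fixes \<Omega> :: "'x set" and act :: "'a \<Rightarrow> 'x \<Rightarrow> 'x" and \<kappa> :: "'a \<Rightarrow> 'x \<Rightarrow> complex"
  assumes fin: "finite (carrier G)" and fin_points: "finite \<Omega>"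
    and act_closed: "g \<in> carrier G \<Longrightarrow> x \<in> \<Omega> \<Longrightarrow> act g x \<in> \<Omega>"
    and act_one: "x \<in> \<Omega> \<Longrightarrow> act \<one> x = x"
    and act_mult: "g \<in> carrier G \<Longrightarrow> h \<in> carrier G \<Longrightarrow> x \<in> \<Omega> \<Longrightarrow>
      act (g \<otimes> h) x = act g (act h x)"
    and weight_nonzero: "g \<in> carrier G \<Longrightarrow> x \<in> \<Omega> \<Longrightarrow> \<kappa> g x \<noteq> 0"
    and weight_mult: "g \<in> carrier G \<Longrightarrow> h \<in> carrier G \<Longrightarrow> x \<in> \<Omega> \<Longrightarrow>
      \<kappa> (g \<otimes> h) x = \<kappa> g (act h x) * \<kappa> h x"
begin

definition fixed :: "'a set \<Rightarrow> ('a \<Rightarrow> complex) \<Rightarrow> 'x set" where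
  "fixed R \<rho> = {x \<in> \<Omega>. \<forall>r\<in>R. act r x = x \<and> \<kappa> r x = \<rho> r}"

definition transfer :: "'a \<Rightarrow> complex" where
  "transfer g = (\<Prod>x\<in>\<Omega>. \<kappa> g x)"

lemma act_inv:
  assumes "g \<in> carrier G" "x \<in> \<Omega>"
  shows "act (inv g) (act g x) = x" "act g (act (inv g) x) = x"
  using act_mult[of "inv g" g x] act_mult[of g "inv g" x] assms act_one by auto

lemma act_bij: "g \<in> carrier G \<Longrightarrow> bij_betw (act g) \<Omega> \<Omega>"
  by (rule bij_betwI[where g = "act (inv g)"]) (use act_closed act_inv in auto)

lemma weight_one: "x \<in> \<Omega> \<Longrightarrow> \<kappa> \<one> x = 1"
  using weight_mult[of \<one> \<one> x] weight_nonzero[of \<one> x] by (simp add: act_one)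

text \<open>The weights satisfy a cocycle identity; reindexing the product along the permutation
  \<open>act h\<close> turns it into multiplicativity.\<close>

lemma character_transfer: "character G (carrier G) transfer"
  unfolding character_def
proof (intro conjI ballI)
  fix g assume g: "g \<in> carrier G"
  then show "transfer g \<noteq> 0"
    using fin_points weight_nonzero by (simp add: transfer_def)
  fix h assume h: "h \<in> carrier G"
  have "(\<Prod>x\<in>\<Omega>. \<kappa> g (act h x)) = (\<Prod>x\<in>\<Omega>. \<kappa> g x)"
    using prod.reindex_bij_betw[OF act_bij[OF h]] .
  then show "transfer (g \<otimes> h) = transfer g * transfer h"
    using g h by (simp add: transfer_def weight_mult prod.distrib)
qed

lemma act_pow:
  assumes "g \<in> carrier G" "x \<in> \<Omega>"
  shows "act (g [^] (n::nat)) x = (act g ^^ n) x"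
proof (induction n)
  case (Suc n)
  have "act (g [^] Suc n) x = act (g \<otimes> g [^] n) x"
    using assms nat_pow_Suc2 by metis
  then show ?case using Suc assms by (simp add: act_mult)
qed (use assms act_one in simp)

lemma weight_pow:
  assumes "g \<in> carrier G" "x \<in> \<Omega>"
  shows "\<kappa> (g [^] (n::nat)) x = (\<Prod>i<n. \<kappa> g ((act g ^^ i) x))"
proof (induction n)
  case (Suc n)
  have "\<kappa> (g [^] Suc n) x = \<kappa> (g \<otimes> g [^] n) x"
    using assms nat_pow_Suc2 by metis
  then show ?case using Suc assms by (simp add: weight_mult act_pow mult.commute)
qed (use assms weight_one in simp)

lemma weight_pow_fixed:
  assumes "g \<in> carrier G" "x \<in> \<Omega>" "act g x = x"
  shows "\<kappa> (g [^] (n::nat)) x = \<kappa> g x ^ n"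
proof -
  have "(act g ^^ i) x = x" for i using assms(3) by (induction i) auto
  then show ?thesis using weight_pow[OF assms(1,2)] by simp
qed

lemma subgroup_point_stabilizer:
  assumes "x \<in> \<Omega>"
  shows "subgroup {g \<in> carrier G. act g x = x} G"
proof (rule subgroupI)
  show "inv a \<in> {g \<in> carrier G. act g x = x}" if "a \<in> {g \<in> carrier G. act g x = x}" for a
    using that assms act_inv(1)[of a x] by auto
qed (use assms act_one act_mult in auto)

lemma fixed_conj:
  assumes x: "x \<in> fixed R \<rho>" and n: "n \<in> carrier G" and R: "R' \<subseteq> carrier G"
    and rel: "\<And>r. r \<in> R' \<Longrightarrow> inv n \<otimes> r \<otimes> n \<in> R \<and> \<rho>' r = \<rho> (inv n \<otimes> r \<otimes> n)"
  shows "act n x \<in> fixed R' \<rho>'"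
proof -
  have xO: "x \<in> \<Omega>" using x by (simp add: fixed_def)
  have "act r (act n x) = act n x \<and> \<kappa> r (act n x) = \<rho>' r" if r: "r \<in> R'" for r
  proof -
    let ?s = "inv n \<otimes> r \<otimes> n"
    have rc: "r \<in> carrier G" using R r by blast
    have s: "act ?s x = x" "\<kappa> ?s x = \<rho>' r" "?s \<in> carrier G"
      using x rel[OF r] rc n by (auto simp: fixed_def)
    have eq: "r \<otimes> n = n \<otimes> ?s" using rc n by (simp add: m_assoc inv_mult_cancel)
    have "act r (act n x) = act (n \<otimes> ?s) x" using act_mult[OF rc n xO] eq by simp
    also have "\<dots> = act n x" using act_mult[OF n s(3) xO] s by simp
    finally have 1: "act r (act n x) = act n x" .
    have "\<kappa> r (act n x) * \<kappa> n x = \<kappa> (n \<otimes> ?s) x" using weight_mult[OF rc n xO] eq by simp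
    also have "\<dots> = \<kappa> n x * \<rho>' r" using weight_mult[OF n s(3) xO] s by simp
    finally show ?thesis using 1 weight_nonzero[OF n xO] by simp
  qed
  then show ?thesis using xO n by (auto simp: fixed_def act_closed)
qed

lemma card_fixed_conj:
  assumes n: "n \<in> carrier G" and R: "R \<subseteq> carrier G"
    and R': "R' = (\<lambda>r. n \<otimes> r \<otimes> inv n) ` R" and rho: "\<And>r. r \<in> R \<Longrightarrow> \<rho>' (n \<otimes> r \<otimes> inv n) = \<rho> r"
  shows "card (fixed R' \<rho>') = card (fixed R \<rho>)"
proof -
  have R'c: "R' \<subseteq> carrier G" using R R' n by auto
  have "bij_betw (act n) (fixed R \<rho>) (fixed R' \<rho>')"
  proof (rule bij_betwI[where g = "act (inv n)"])
    show "act n \<in> fixed R \<rho> \<rightarrow> fixed R' \<rho>'"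
    proof
      fix x assume "x \<in> fixed R \<rho>"
      then show "act n x \<in> fixed R' \<rho>'"
        by (rule fixed_conj[OF _ n R'c]) (use R R' n rho in \<open>auto simp: m_assoc inv_mult_cancel subset_iff\<close>)
    qed
    show "act (inv n) \<in> fixed R' \<rho>' \<rightarrow> fixed R \<rho>"
    proof
      fix x assume "x \<in> fixed R' \<rho>'"
      then show "act (inv n) x \<in> fixed R \<rho>"
        by (rule fixed_conj[OF _ inv_closed[OF n] R]) (use R R' n rho in auto)
    qed
  qed (use act_inv n in \<open>auto simp: fixed_def\<close>)
  then show ?thesis by (metis bij_betw_same_card)
qed

text \<open>The hypothesis says that \<open>N\<close> stabilizes the pair
  \<open>(R, \<rho>)\<close>, so \<open>N\<close> permutes its fixed points and Burnside's lemma
  applies to them.\<close>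

lemma dvd_sum_card_fixed:
  assumes N: "subgroup N G" and R: "R \<subseteq> carrier G"
    and norm: "\<And>n r. n \<in> N \<Longrightarrow> r \<in> R \<Longrightarrow> inv n \<otimes> r \<otimes> n \<in> R \<and> \<rho> (inv n \<otimes> r \<otimes> n) = \<rho> r"
  shows "card N dvd (\<Sum>n\<in>N. card {x \<in> fixed R \<rho>. act n x = x})"
proof -
  interpret N: subgroup N G by fact
  have "card (carrier (G\<lparr>carrier := N\<rparr>)) dvd
    (\<Sum>n\<in>carrier (G\<lparr>carrier := N\<rparr>). card {x \<in> fixed R \<rho>. act n x = x})"
  proof (rule burnside_dvd)
    show "group (G\<lparr>carrier := N\<rparr>)" by (rule N.subgroup_is_group[OF is_group])
    show "finite (carrier (G\<lparr>carrier := N\<rparr>))" using fin N.subset finite_subset by auto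
    show "finite (fixed R \<rho>)" using fin_points by (simp add: fixed_def)
    show "act g x \<in> fixed R \<rho>" if "g \<in> carrier (G\<lparr>carrier := N\<rparr>)" "x \<in> fixed R \<rho>" for g x
      using that norm by (intro fixed_conj[OF that(2) _ R]) auto
  qed (use N.subset act_one act_mult in \<open>auto simp: fixed_def subset_iff\<close>)
  then show ?thesis by simp
qed

text \<open>\<open>Q\<close> acts on the line of each of its fixed points through exactly one
  character. Extensionality makes different members of \<open>Ch Q\<close> differ somewhere on
  \<open>Q\<close>, hence the pieces disjoint.\<close>

lemma card_fixed_by_characters:
  assumes "finite (Ch Q)" "Ch Q \<subseteq> extensional Q"
    and "\<And>x. x \<in> \<Omega> \<Longrightarrow> (\<And>q. q \<in> Q \<Longrightarrow> act q x = x) \<Longrightarrow> restrict (\<lambda>q. \<kappa> q x) Q \<in> Ch Q"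
  shows "card {x \<in> \<Omega>. (\<forall>q\<in>Q. act q x = x) \<and> P (restrict (\<lambda>q. \<kappa> q x) Q)} =
    (\<Sum>\<rho> \<in> {\<rho> \<in> Ch Q. P \<rho>}. card (fixed Q \<rho>))"
proof -
  have "{x \<in> \<Omega>. (\<forall>q\<in>Q. act q x = x) \<and> P (restrict (\<lambda>q. \<kappa> q x) Q)} =
      (\<Union>\<rho> \<in> {\<rho> \<in> Ch Q. P \<rho>}. fixed Q \<rho>)"
  proof (intro equalityI subsetI)
    fix x assume "x \<in> (\<Union>\<rho> \<in> {\<rho> \<in> Ch Q. P \<rho>}. fixed Q \<rho>)"
    then obtain \<rho> where rho: "\<rho> \<in> Ch Q" "P \<rho>" "x \<in> fixed Q \<rho>" by blast
    then have "restrict (\<lambda>q. \<kappa> q x) Q = \<rho>"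
      using assms(2) by (intro extensionalityI[of _ Q]) (auto simp: fixed_def)
    then show "x \<in> {x \<in> \<Omega>. (\<forall>q\<in>Q. act q x = x) \<and> P (restrict (\<lambda>q. \<kappa> q x) Q)}"
      using rho by (auto simp: fixed_def)
  next
    fix x assume x: "x \<in> {x \<in> \<Omega>. (\<forall>q\<in>Q. act q x = x) \<and> P (restrict (\<lambda>q. \<kappa> q x) Q)}"
    then have "restrict (\<lambda>q. \<kappa> q x) Q \<in> Ch Q" using assms(3) by blast
    moreover have "x \<in> fixed Q (restrict (\<lambda>q. \<kappa> q x) Q)" using x by (simp add: fixed_def)
    ultimately show "x \<in> (\<Union>\<rho> \<in> {\<rho> \<in> Ch Q. P \<rho>}. fixed Q \<rho>)" using x by blast
  qed
  moreover have "card (\<Union>\<rho> \<in> {\<rho> \<in> Ch Q. P \<rho>}. fixed Q \<rho>) =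
      (\<Sum>\<rho> \<in> {\<rho> \<in> Ch Q. P \<rho>}. card (fixed Q \<rho>))"
  proof (rule card_UN_disjoint)
    show "\<forall>\<rho>\<in>{\<rho> \<in> Ch Q. P \<rho>}. \<forall>\<sigma>\<in>{\<rho> \<in> Ch Q. P \<rho>}. \<rho> \<noteq> \<sigma> \<longrightarrow> fixed Q \<rho> \<inter> fixed Q \<sigma> = {}"
    proof (intro ballI impI)
      fix \<rho> \<sigma> assume *: "\<rho> \<in> {\<rho> \<in> Ch Q. P \<rho>}" "\<sigma> \<in> {\<rho> \<in> Ch Q. P \<rho>}" "\<rho> \<noteq> \<sigma>"
      then obtain q where "q \<in> Q" "\<rho> q \<noteq> \<sigma> q"
        using assms(2) extensionalityI[of \<rho> Q \<sigma>] by blast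
      then show "fixed Q \<rho> \<inter> fixed Q \<sigma> = {}" by (auto simp: fixed_def)
    qed
  qed (use assms(1) fin_points in \<open>auto simp: fixed_def\<close>)
  ultimately show ?thesis by simp
qed

section \<open>Cycles of a single element\<close>

definition period :: "'a \<Rightarrow> 'x \<Rightarrow> nat" where
  "period g x = (LEAST d. 0 < d \<and> (act g ^^ d) x = x)"

lemma period:
  assumes "g \<in> carrier G" "x \<in> \<Omega>"
  shows period_pos: "0 < period g x" and funpow_period: "(act g ^^ period g x) x = x"
    and period_le: "\<And>i. 0 < i \<Longrightarrow> i < period g x \<Longrightarrow> (act g ^^ i) x \<noteq> x"
    and period_dvd: "(act g ^^ d) x = x \<longleftrightarrow> period g x dvd d"
    and period_dvd_order: "period g x dvd order G"
proof -
  have ex: "0 < order G \<and> (act g ^^ order G) x = x"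
    using assms pow_order_eq_1[of g] act_pow[of g x "order G"] fin act_one
    by (simp add: order_gt_0_iff_finite)
  show pos: "0 < period g x" and per: "(act g ^^ period g x) x = x"
    using LeastI[of "\<lambda>d. 0 < d \<and> (act g ^^ d) x = x", OF ex] by (auto simp: period_def)
  show min: "(act g ^^ i) x \<noteq> x" if "0 < i" "i < period g x" for i
    using that not_less_Least[of i "\<lambda>d. 0 < d \<and> (act g ^^ d) x = x"] by (auto simp: period_def)
  show dvd: "(act g ^^ d) x = x \<longleftrightarrow> period g x dvd d" for d
  proof -
    have "(act g ^^ d) x = (act g ^^ (d mod period g x)) x"
      using per by (metis funpow_mod_eq)
    then show ?thesis
      using min[of "d mod period g x"] pos by (metis dvd_eq_mod_eq_0 funpow_0 mod_less_divisor neq0_conv)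
  qed
  show "period g x dvd order G" using dvd ex by blast
qed

text \<open>By \<open>weight_pow\<close>, the weight of \<open>g [^] d\<close> at a point of period
  \<open>d\<close> is the product of the weights of \<open>g\<close> along its cycle. So these are
  the points on cycles of length \<open>d\<close> that contribute the factor \<open>a\<close> to the
  transfer.\<close>

definition exact :: "'a \<Rightarrow> nat \<Rightarrow> complex \<Rightarrow> 'x set" where
  "exact g d a = {x \<in> \<Omega>. period g x = d \<and> \<kappa> (g [^] d) x = a}"

lemma period_act:
  assumes "g \<in> carrier G" "x \<in> \<Omega>"
  shows "period g (act g x) = period g x"
proof -
  have "(act g ^^ d) (act g x) = act g x \<longleftrightarrow> (act g ^^ d) x = x" for d
  proof -
    have "(act g ^^ d) (act g x) = act g ((act g ^^ d) x)" by (metis funpow_swap1)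
    moreover have "(act g ^^ d) x \<in> \<Omega>" using assms act_pow[of g x d] act_closed[of "g [^] d" x] by simp
    ultimately show ?thesis using act_inv(1)[OF assms(1)] assms(2) by metis
  qed
  then show ?thesis by (simp add: period_def)
qed

text \<open>The weight of a cycle does not depend on its starting point because \<open>g\<close>
  commutes with \<open>g [^] d\<close>.\<close>

lemma exact_closed:
  assumes g: "g \<in> carrier G" and x: "x \<in> exact g d a"
  shows "act g x \<in> exact g d a"
proof -
  have xO: "x \<in> \<Omega>" and d: "period g x = d" "\<kappa> (g [^] d) x = a" using x by (auto simp: exact_def)
  have fix_x: "act (g [^] d) x = x" using act_pow[OF g xO] funpow_period[OF g xO] d by simp
  have "g [^] d \<otimes> g = g \<otimes> g [^] d" using g by (metis nat_pow_Suc nat_pow_Suc2)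
  then have "\<kappa> (g [^] d) (act g x) * \<kappa> g x = \<kappa> g (act (g [^] d) x) * \<kappa> (g [^] d) x"
    using weight_mult[of "g [^] d" g x] weight_mult[of g "g [^] d" x] g xO by simp
  then have "\<kappa> (g [^] d) (act g x) = a" using weight_nonzero[OF g xO] fix_x d by simp
  then show ?thesis using xO d g by (simp add: exact_def act_closed period_act)
qed

lemma exact_prod:
  assumes g: "g \<in> carrier G" and d: "0 < d"
  shows "d dvd card (exact g d a) \<and> (\<Prod>x\<in>exact g d a. \<kappa> g x) = a ^ (card (exact g d a) div d)"
proof (rule prod_over_cycles[where f = "act g"])
  show "finite (exact g d a)" using fin_points by (simp add: exact_def)
  show "(act g ^^ d) x = x" if "x \<in> exact g d a" for x
    using that funpow_period[OF g] by (auto simp: exact_def)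
  show "(act g ^^ i) x \<noteq> x" if "x \<in> exact g d a" "0 < i" "i < d" for x i
    using that period_le[OF g, of x i] by (simp add: exact_def)
  show "(\<Prod>i<d. \<kappa> g ((act g ^^ i) x)) = a" if "x \<in> exact g d a" for x
    using that weight_pow[OF g, of x d] by (simp add: exact_def)
qed (use d exact_closed[OF g] in auto)

lemma weight_root_of_unity:
  assumes "g \<in> carrier G" "x \<in> \<Omega>" "act g x = x"
  shows "\<kappa> g x ^ order G = 1"
  using weight_pow_fixed[OF assms, of "order G"] assms pow_order_eq_1 fin weight_one by simp

text \<open>A point on a cycle of length \<open>d\<close> and weight \<open>b\<close> is fixed by
  \<open>g [^] e\<close> iff \<open>d\<close> divides \<open>e\<close>, and \<open>g [^] e\<close>
  then runs \<open>e div d\<close> times round the cycle. The conditions involving the group order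
  hold automatically and keep the index set finite.\<close>

lemma exact_union:
  assumes g: "g \<in> carrier G"
  shows "{x \<in> \<Omega>. act (g [^] e) x = x \<and> \<kappa> (g [^] e) x = a} =
    (\<Union>(d, b) \<in> {(d, b). d dvd e \<and> d dvd order G \<and> b ^ order G = 1 \<and> b ^ (e div d) = a}. exact g d b)"
    (is "?L = (\<Union>(d, b) \<in> ?I. exact g d b)")
proof -
  have key: "act (g [^] e) x = x \<and> \<kappa> (g [^] e) x = a \<longleftrightarrow>
      period g x dvd e \<and> \<kappa> (g [^] period g x) x ^ (e div period g x) = a"
    if x: "x \<in> \<Omega>" for x
  proof (cases "period g x dvd e")
    case True
    let ?d = "period g x"
    have fx: "act (g [^] ?d) x = x" using act_pow[OF g x] funpow_period[OF g x] by simp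
    have "g [^] e = (g [^] ?d) [^] (e div ?d)" using True g by (simp add: nat_pow_pow)
    then have "\<kappa> (g [^] e) x = \<kappa> (g [^] ?d) x ^ (e div ?d)"
      using weight_pow_fixed[OF _ x fx] g by simp
    then show ?thesis using True period_dvd[OF g x, of e] act_pow[OF g x, of e] by simp
  qed (use period_dvd[OF g x, of e] act_pow[OF g x, of e] in simp)
  have root: "\<kappa> (g [^] period g x) x ^ order G = 1" if x: "x \<in> \<Omega>" for x
    using weight_root_of_unity[of "g [^] period g x" x] x g act_pow[OF g x] funpow_period[OF g x]
    by simp
  show ?thesis
  proof (intro equalityI subsetI)
    fix x assume "x \<in> ?L"
    then have "(period g x, \<kappa> (g [^] period g x) x) \<in> ?I \<and> x \<in> exact g (period g x) (\<kappa> (g [^] period g x) x)"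
      using key root period_dvd_order[OF g] by (auto simp: exact_def)
    then show "x \<in> (\<Union>(d, b) \<in> ?I. exact g d b)" by blast
  next
    fix x assume "x \<in> (\<Union>(d, b) \<in> ?I. exact g d b)"
    then show "x \<in> ?L" using key by (auto simp: exact_def)
  qed
qed

lemma card_weight_eq_sum_exact:
  assumes g: "g \<in> carrier G"
  shows "card {x \<in> \<Omega>. act (g [^] e) x = x \<and> \<kappa> (g [^] e) x = a} =
    (\<Sum>(d, b) \<in> {(d, b). d dvd e \<and> d dvd order G \<and> b ^ order G = 1 \<and> b ^ (e div d) = a}. card (exact g d b))"
  unfolding exact_union[OF g] case_prod_unfold
  by (rule card_UN_disjoint)
    (use fin_points in \<open>auto simp: exact_def case_prod_unfold
      intro!: finite_subset[OF _ finite_divisor_roots[OF fin]]\<close>)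

text \<open>Each cycle contributes its weight once, so the transfer is determined by the sizes of
  the sets \<open>exact g d b\<close>.\<close>

lemma transfer_eq_prod_exact:
  assumes g: "g \<in> carrier G"
  shows "transfer g = (\<Prod>(d, b) \<in> {(d, b). d dvd order G \<and> b ^ order G = 1}. b ^ (card (exact g d b) div d))"
proof -
  let ?I = "{(d, b::complex). d dvd order G \<and> b ^ order G = 1}"
  have ord: "0 < order G" using fin by (simp add: order_gt_0_iff_finite)
  have I: "finite ?I" by (rule finite_divisor_roots[OF fin])
  have "\<Omega> = (\<Union>i \<in> ?I. exact g (fst i) (snd i))"
  proof (intro equalityI subsetI)
    fix x assume x: "x \<in> \<Omega>"
    have "\<kappa> (g [^] period g x) x ^ order G = 1"
      using weight_root_of_unity[of "g [^] period g x" x] x g act_pow[OF g x] funpow_period[OF g x]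
      by simp
    then show "x \<in> (\<Union>i \<in> ?I. exact g (fst i) (snd i))"
      using x period_dvd_order[OF g x] by (auto simp: exact_def)
  qed (auto simp: exact_def)
  then have "transfer g = (\<Prod>x\<in>(\<Union>i \<in> ?I. exact g (fst i) (snd i)). \<kappa> g x)"
    by (simp add: transfer_def)
  also have "\<dots> = (\<Prod>i\<in>?I. \<Prod>x\<in>exact g (fst i) (snd i). \<kappa> g x)"
    by (rule prod.UNION_disjoint) (use I fin_points in \<open>auto simp: exact_def\<close>)
  also have "\<dots> = (\<Prod>i\<in>?I. snd i ^ (card (exact g (fst i) (snd i)) div fst i))"
    by (rule prod.cong) (use exact_prod[OF g] ord in \<open>auto intro!: Nat.gr0I\<close>)
  finally show ?thesis by (simp add: case_prod_unfold)
qed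

end

subsection \<open>Induced monomial sets\<close>

definition coset_rep :: "'a set \<Rightarrow> 'a" where
  "coset_rep C = (SOME x. x \<in> C)"

text \<open>The cocycle of the classical transfer: if \<open>t\<close> and \<open>t'\<close>
  represent \<open>C\<close> and \<open>g C\<close>, then \<open>g t = t' x\<close> with
  \<open>x\<close> in the subgroup, and the weight is \<open>\<chi> x\<close>.\<close>

definition ind_weight ::
  "('a, 'm) monoid_scheme \<Rightarrow> ('a \<Rightarrow> complex) \<Rightarrow> 'a \<Rightarrow> 'a set \<Rightarrow> complex" where
  "ind_weight G \<chi> g C = \<chi> (inv\<^bsub>G\<^esub> (coset_rep (g <#\<^bsub>G\<^esub> C)) \<otimes>\<^bsub>G\<^esub> g \<otimes>\<^bsub>G\<^esub> coset_rep C)"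

text \<open>
  The number of points of the monomial set induced from \<open>(P, \<chi>)\<close> that \<open>R\<close> fixes and on whose lines it
  acts through \<open>\<rho>\<close>.
\<close>

definition mark :: "('a, 'm) monoid_scheme \<Rightarrow> 'a set \<Rightarrow> ('a \<Rightarrow> complex) \<Rightarrow>
    'a set \<Rightarrow> ('a \<Rightarrow> complex) \<Rightarrow> nat" where
  "mark G P \<chi> R \<rho> =
    card {C \<in> lcosets\<^bsub>G\<^esub> P. \<forall>r\<in>R. r <#\<^bsub>G\<^esub> C = C \<and> ind_weight G \<chi> r C = \<rho> r}"

text \<open>The stabilizer of the pair \<open>(P, \<chi>)\<close> under conjugation, that is, the
  inertia group of \<chi> in the normalizer of \<open>P\<close>.\<close>

definition char_normalizer ::
  "('a, 'm) monoid_scheme \<Rightarrow> 'a set \<Rightarrow> ('a \<Rightarrow> complex) \<Rightarrow> 'a set" where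
  "char_normalizer G P \<chi> = {g \<in> carrier G. (\<lambda>x. g \<otimes>\<^bsub>G\<^esub> x \<otimes>\<^bsub>G\<^esub> inv\<^bsub>G\<^esub> g) ` P = P \<and>
    (\<forall>x\<in>P. \<chi> (g \<otimes>\<^bsub>G\<^esub> x \<otimes>\<^bsub>G\<^esub> inv\<^bsub>G\<^esub> g) = \<chi> x)}"

context group
begin

lemma coset_rep:
  assumes P: "subgroup P G" and C: "C \<in> lcosets P"
  shows coset_rep_mem: "coset_rep C \<in> C" and coset_rep_closed: "coset_rep C \<in> carrier G"
    and coset_rep_coset: "coset_rep C <# P = C"
proof -
  obtain a where a: "a \<in> carrier G" "C = a <# P" using C by (auto simp: LCOSETS_def)
  show mem: "coset_rep C \<in> C"
    unfolding coset_rep_def using lcos_self[OF a(1) P] a(2) by (metis someI)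
  show "coset_rep C \<in> carrier G" using mem a P l_coset_carrier by metis
  show "coset_rep C <# P = C" using mem a P l_repr_independence by metis
qed

lemma lcosets_act:
  assumes P: "subgroup P G" and C: "C \<in> lcosets P" and g: "g \<in> carrier G"
  shows "g <# C \<in> lcosets P" and "inv (coset_rep (g <# C)) \<otimes> g \<otimes> coset_rep C \<in> P"
proof -
  interpret P: subgroup P G by fact
  let ?t = "coset_rep C"
  have t: "?t \<in> carrier G" "?t <# P = C" using coset_rep[OF P C] by auto
  have gC: "g <# C = (g \<otimes> ?t) <# P"
    using lcos_m_assoc[OF P.subset g t(1)] t(2) by simp
  then show 1: "g <# C \<in> lcosets P" using g t by (auto simp: LCOSETS_def)
  have "coset_rep (g <# C) <# P = (g \<otimes> ?t) <# P" using coset_rep_coset[OF P 1] gC by simp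
  then have "g \<otimes> ?t \<in> coset_rep (g <# C) <# P"
    using lcos_self[OF _ P, of "g \<otimes> ?t"] g t by simp
  then show "inv (coset_rep (g <# C)) \<otimes> g \<otimes> ?t \<in> P"
    using P.lcos_module_imp[OF is_group] coset_rep_closed[OF P 1] g t by (simp add: m_assoc)
qed

lemma lcoset_fixed_iff:
  assumes P: "subgroup P G" and t: "t \<in> carrier G" and g: "g \<in> carrier G"
  shows "g <# (t <# P) = t <# P \<longleftrightarrow> inv t \<otimes> g \<otimes> t \<in> P"
proof -
  interpret P: subgroup P G by fact
  have eq: "g <# (t <# P) = (g \<otimes> t) <# P" using lcos_m_assoc[OF P.subset g t] .
  have "(g \<otimes> t) <# P = t <# P \<longleftrightarrow> g \<otimes> t \<in> t <# P"
    using l_repr_independence[of "g \<otimes> t" t P] lcos_self[OF _ P, of "g \<otimes> t"] P t g by auto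
  also have "\<dots> \<longleftrightarrow> inv t \<otimes> (g \<otimes> t) \<in> P"
    using P.lcos_module_imp[OF is_group t] P.lcos_module_rev[OF is_group t, of "g \<otimes> t"] t g by auto
  finally show ?thesis using eq t g by (simp add: m_assoc)
qed

lemma ind_weight_fixed:
  "g <# C = C \<Longrightarrow> ind_weight G \<chi> g C = \<chi> (inv (coset_rep C) \<otimes> g \<otimes> coset_rep C)"
  by (simp add: ind_weight_def)

lemma monomial_set_induced:
  assumes fin: "finite (carrier G)" and P: "subgroup P G" and chi: "character G P \<chi>"
  shows "monomial_set G (lcosets P) (l_coset G) (ind_weight G \<chi>)"
proof unfold_locales
  interpret P: subgroup P G by fact
  show "finite (carrier G)" by fact
  show "finite (lcosets P)" 
    using finite_subset[OF lcosets_subset_PowG[OF P]] fin by simp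
  fix g C assume g: "g \<in> carrier G" and C: "C \<in> lcosets P"
  show "g <# C \<in> lcosets P" using lcosets_act[OF P C g] by simp
  show "ind_weight G \<chi> g C \<noteq> 0"
    unfolding ind_weight_def using lcosets_act(2)[OF P C g] character_nonzero[OF chi] by blast
  fix h assume h: "h \<in> carrier G"
  have CG: "C \<subseteq> carrier G" using C P.lcosets_carrier[OF is_group] by blast
  show gh: "(g \<otimes> h) <# C = g <# (h <# C)" using lcos_m_assoc[OF CG g h] by simp
  have hC: "h <# C \<in> lcosets P" using lcosets_act[OF P C h] by simp
  have ghC: "g <# (h <# C) \<in> lcosets P" using lcosets_act[OF P hC g] by simp
  let ?a = "inv (coset_rep (g <# (h <# C))) \<otimes> g \<otimes> coset_rep (h <# C)"
  let ?b = "inv (coset_rep (h <# C)) \<otimes> h \<otimes> coset_rep C"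
  have "inv (coset_rep (g <# (h <# C))) \<otimes> (g \<otimes> h) \<otimes> coset_rep C = ?a \<otimes> ?b"
    using g h coset_rep_closed[OF P C] coset_rep_closed[OF P hC] coset_rep_closed[OF P ghC]
    by (simp add: m_assoc inv_mult_cancel)
  then show "ind_weight G \<chi> (g \<otimes> h) C = ind_weight G \<chi> g (h <# C) * ind_weight G \<chi> h C"
    unfolding ind_weight_def gh
    using character_mult[OF chi] lcosets_act(2)[OF P C h] lcosets_act(2)[OF P hC g] by simp
next
  interpret P: subgroup P G by fact
  fix C assume "C \<in> lcosets P"
  then show "\<one> <# C = C" using P.lcosets_carrier[OF is_group] lcos_mult_one by blast
qed

lemma mark_eq_card_fixed:
  assumes "finite (carrier G)" "subgroup P G" "character G P \<chi>"
  shows "mark G P \<chi> R \<rho> = card (monomial_set.fixed (lcosets P) (l_coset G) (ind_weight G \<chi>) R \<rho>)"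
  using monomial_set.fixed_def[OF monomial_set_induced[OF assms]] by (simp add: mark_def)

text \<open>Triangularity of the table of marks: a fixed coset conjugates \<open>(R, \<rho>)\<close>
  into \<open>(P, \<chi>)\<close>, the conjugating element being its representative.\<close>

lemma mark_pos_imp_conj:
  assumes P: "subgroup P G" and R: "R \<subseteq> carrier G" and pos: "mark G P \<chi> R \<rho> \<noteq> 0"
  shows "\<exists>t\<in>carrier G. \<forall>r\<in>R. inv t \<otimes> r \<otimes> t \<in> P \<and> \<chi> (inv t \<otimes> r \<otimes> t) = \<rho> r"
proof -
  have "{C \<in> lcosets P. \<forall>r\<in>R. r <# C = C \<and> ind_weight G \<chi> r C = \<rho> r} \<noteq> {}"
    using pos unfolding mark_def by (metis card.empty)
  then obtain C where C: "C \<in> lcosets P" "\<forall>r\<in>R. r <# C = C \<and> ind_weight G \<chi> r C = \<rho> r"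
    by blast
  let ?t = "coset_rep C"
  have t: "?t \<in> carrier G" "?t <# P = C" using coset_rep[OF P C(1)] by auto
  have "inv ?t \<otimes> r \<otimes> ?t \<in> P \<and> \<chi> (inv ?t \<otimes> r \<otimes> ?t) = \<rho> r" if r: "r \<in> R" for r
    using lcoset_fixed_iff[OF P t(1), of r] t(2) C(2) r R ind_weight_fixed[of r C \<chi>] by auto
  then show ?thesis using t by blast
qed

lemma card_conj_subset:
  assumes t: "t \<in> carrier G" and R: "R \<subseteq> carrier G"
  shows "card ((\<lambda>r. inv t \<otimes> r \<otimes> t) ` R) = card R"
proof (rule card_image, rule inj_onI)
  fix x y assume xy: "x \<in> R" "y \<in> R" "inv t \<otimes> x \<otimes> t = inv t \<otimes> y \<otimes> t"
  then have "x \<in> carrier G" "y \<in> carrier G" using R by auto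
  then show "x = y" using xy(3) t by (metis inv_closed l_cancel m_closed r_cancel)
qed

lemma mark_smaller_eq_0:
  assumes fin: "finite (carrier G)" and P: "subgroup P G" and R: "R \<subseteq> carrier G"
    and less: "card P < card R"
  shows "mark G P \<chi> R \<rho> = 0"
proof (rule ccontr)
  assume "mark G P \<chi> R \<rho> \<noteq> 0"
  then obtain t where t: "t \<in> carrier G" "\<forall>r\<in>R. inv t \<otimes> r \<otimes> t \<in> P"
    using mark_pos_imp_conj[OF P R] by blast
  then have "card R \<le> card P"
    using card_conj_subset[OF t(1) R] card_mono[of P "(\<lambda>r. inv t \<otimes> r \<otimes> t) ` R"] fin
      finite_subset[OF subgroup.subset[OF P]] by fastforce
  then show False using less by simp
qed

lemma subgroup_char_normalizer:
  assumes P: "subgroup P G"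
  shows "subgroup (char_normalizer G P \<chi>) G"
proof (rule subgroupI)
  interpret P: subgroup P G by fact
  show "char_normalizer G P \<chi> \<subseteq> carrier G" by (auto simp: char_normalizer_def)
  have "(\<lambda>x. \<one> \<otimes> x \<otimes> inv \<one>) ` P = (\<lambda>x. x) ` P" by (rule image_cong) auto
  then have "\<one> \<in> char_normalizer G P \<chi>" by (auto simp: char_normalizer_def)
  then show "char_normalizer G P \<chi> \<noteq> {}" by blast
  show "inv a \<in> char_normalizer G P \<chi>" if a: "a \<in> char_normalizer G P \<chi>" for a
  proof -
    have ac: "a \<in> carrier G" and im: "(\<lambda>x. a \<otimes> x \<otimes> inv a) ` P = P"
      and ch: "\<And>x. x \<in> P \<Longrightarrow> \<chi> (a \<otimes> x \<otimes> inv a) = \<chi> x"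
      using a by (auto simp: char_normalizer_def)
    have undo: "inv a \<otimes> (a \<otimes> x \<otimes> inv a) \<otimes> inv (inv a) = x" if "x \<in> P" for x
      using that ac by (simp add: m_assoc inv_mult_cancel)
    have "(\<lambda>x. inv a \<otimes> x \<otimes> inv (inv a)) ` ((\<lambda>x. a \<otimes> x \<otimes> inv a) ` P) = (\<lambda>x. x) ` P"
      unfolding image_image by (rule image_cong) (use undo in auto)
    then have 1: "(\<lambda>x. inv a \<otimes> x \<otimes> inv (inv a)) ` P = P" using im by simp
    have "\<chi> (inv a \<otimes> y \<otimes> inv (inv a)) = \<chi> y" if y: "y \<in> P" for y
    proof -
      obtain x where x: "x \<in> P" "y = a \<otimes> x \<otimes> inv a" using im y by blast
      then show ?thesis using undo ch by simp
    qed
    then show ?thesis using ac 1 by (simp add: char_normalizer_def)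
  qed
  show "a \<otimes> b \<in> char_normalizer G P \<chi>"
    if ab: "a \<in> char_normalizer G P \<chi>" "b \<in> char_normalizer G P \<chi>" for a b
  proof -
    have c: "a \<in> carrier G" "b \<in> carrier G" using ab by (auto simp: char_normalizer_def)
    have eq: "a \<otimes> b \<otimes> x \<otimes> inv (a \<otimes> b) = a \<otimes> (b \<otimes> x \<otimes> inv b) \<otimes> inv a" if "x \<in> P" for x
      using c that by (simp add: m_assoc inv_mult_group)
    have "(\<lambda>x. a \<otimes> b \<otimes> x \<otimes> inv (a \<otimes> b)) ` P =
        (\<lambda>x. a \<otimes> x \<otimes> inv a) ` ((\<lambda>x. b \<otimes> x \<otimes> inv b) ` P)"
      unfolding image_image by (rule image_cong) (use eq in auto)
    moreover have "\<chi> (a \<otimes> b \<otimes> x \<otimes> inv (a \<otimes> b)) = \<chi> x" if x: "x \<in> P" for x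
    proof -
      have "b \<otimes> x \<otimes> inv b \<in> P" using ab(2) x by (auto simp: char_normalizer_def)
      then show ?thesis using ab x eq[OF x] by (simp add: char_normalizer_def)
    qed
    ultimately show ?thesis using ab c by (simp add: char_normalizer_def)
  qed
qed

lemma char_normalizer_contains:
  assumes P: "subgroup P G" and chi: "character G P \<chi>"
  shows "P \<subseteq> char_normalizer G P \<chi>"
proof
  interpret P: subgroup P G by fact
  fix g assume g: "g \<in> P"
  have "(\<lambda>x. g \<otimes> x \<otimes> inv g) ` P = P"
  proof (intro equalityI subsetI)
    fix y assume y: "y \<in> P"
    have "y = g \<otimes> (inv g \<otimes> y \<otimes> g) \<otimes> inv g" using g y by (simp add: m_assoc inv_mult_cancel)
    then show "y \<in> (\<lambda>x. g \<otimes> x \<otimes> inv g) ` P" using g y by blast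
  qed (use g in auto)
  moreover have "\<chi> (g \<otimes> x \<otimes> inv g) = \<chi> x" if "x \<in> P" for x
    using that g character_mult[OF chi] character_inv[OF chi P g] character_nonzero[OF chi g] by simp
  ultimately show "g \<in> char_normalizer G P \<chi>" using g by (simp add: char_normalizer_def)
qed

text \<open>Fixed cosets yield conjugation by \<open>inv t\<close> and only an inclusion of images.
  Finiteness turns the inclusion into an equality, and closure under inverses changes the
  direction.\<close>

lemma char_normalizer_iff:
  assumes fin: "finite (carrier G)" and P: "subgroup P G" and t: "t \<in> carrier G"
  shows "t \<in> char_normalizer G P \<chi> \<longleftrightarrow> (\<forall>r\<in>P. inv t \<otimes> r \<otimes> t \<in> P \<and> \<chi> (inv t \<otimes> r \<otimes> t) = \<chi> r)"
proof
  interpret P: subgroup P G by fact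
  assume "t \<in> char_normalizer G P \<chi>"
  then have "inv t \<in> char_normalizer G P \<chi>"
    using subgroup_char_normalizer[OF P] by (simp add: subgroup.m_inv_closed)
  then show "\<forall>r\<in>P. inv t \<otimes> r \<otimes> t \<in> P \<and> \<chi> (inv t \<otimes> r \<otimes> t) = \<chi> r"
    using t by (auto simp: char_normalizer_def)
next
  interpret P: subgroup P G by fact
  assume *: "\<forall>r\<in>P. inv t \<otimes> r \<otimes> t \<in> P \<and> \<chi> (inv t \<otimes> r \<otimes> t) = \<chi> r"
  have "finite P" using fin P.subset finite_subset by blast
  moreover have "(\<lambda>r. inv t \<otimes> r \<otimes> t) ` P \<subseteq> P" using * by blast
  ultimately have im: "(\<lambda>r. inv t \<otimes> r \<otimes> t) ` P = P"
    using card_conj_subset[OF t P.subset] by (meson card_subset_eq)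
  then have "inv t \<in> char_normalizer G P \<chi>" using * t by (simp add: char_normalizer_def)
  then show "t \<in> char_normalizer G P \<chi>"
    using subgroup.m_inv_closed[OF subgroup_char_normalizer[OF P]] t by fastforce
qed

text \<open>A coset \<open>tP\<close> is fixed by \<open>P\<close> with the character \<chi> exactly
  if \<open>t\<close> stabilizes the pair, so the diagonal mark is an index. It becomes the modulus
  in the correction of marks.\<close>

lemma card_mult_mark_self:
  assumes fin: "finite (carrier G)" and P: "subgroup P G" and chi: "character G P \<chi>"
  shows "card P * mark G P \<chi> P \<chi> = card (char_normalizer G P \<chi>)"
proof -
  interpret P: subgroup P G by fact
  let ?N = "char_normalizer G P \<chi>"
  have N: "subgroup ?N G" by (rule subgroup_char_normalizer[OF P])
  interpret N: group "G\<lparr>carrier := ?N\<rparr>" by (rule subgroup.subgroup_is_group[OF N is_group])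
  have PN: "P \<subseteq> ?N" by (rule char_normalizer_contains[OF P chi])
  have PsN: "subgroup P (G\<lparr>carrier := ?N\<rparr>)" using subgroup_incl[OF P N PN] .
  have "{C \<in> lcosets P. \<forall>r\<in>P. r <# C = C \<and> ind_weight G \<chi> r C = \<chi> r} = lcosets\<^bsub>G\<lparr>carrier := ?N\<rparr>\<^esub> P"
  proof (intro equalityI subsetI)
    fix C assume C: "C \<in> {C \<in> lcosets P. \<forall>r\<in>P. r <# C = C \<and> ind_weight G \<chi> r C = \<chi> r}"
    let ?t = "coset_rep C"
    have t: "?t \<in> carrier G" "?t <# P = C" using coset_rep[OF P] C by auto
    have "?t \<in> ?N"
      unfolding char_normalizer_iff[OF fin P t(1)]
      using lcoset_fixed_iff[OF P t(1)] t(2) C ind_weight_fixed[of _ C \<chi>] by fastforce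
    then show "C \<in> lcosets\<^bsub>G\<lparr>carrier := ?N\<rparr>\<^esub> P" using t(2) by (auto simp: LCOSETS_def)
  next
    fix C assume "C \<in> lcosets\<^bsub>G\<lparr>carrier := ?N\<rparr>\<^esub> P"
    then obtain a where a: "a \<in> ?N" "C = a <# P" by (auto simp: LCOSETS_def)
    have ac: "a \<in> carrier G" using a by (simp add: char_normalizer_def)
    have C: "C \<in> lcosets P" using a ac by (auto simp: LCOSETS_def)
    let ?t = "coset_rep C"
    have t: "?t \<in> carrier G" "?t <# P = C" using coset_rep[OF P C] by auto
    have "?t \<in> a <# P" using coset_rep_mem[OF P C] a by simp
    then obtain x where x: "x \<in> P" "?t = a \<otimes> x" by (auto simp: l_coset_def)
    have tN: "?t \<in> ?N" using x a PN subgroup.m_closed[OF N] by auto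
    have "r <# C = C \<and> ind_weight G \<chi> r C = \<chi> r" if r: "r \<in> P" for r
    proof -
      have "inv ?t \<otimes> r \<otimes> ?t \<in> P" "\<chi> (inv ?t \<otimes> r \<otimes> ?t) = \<chi> r"
        using tN r char_normalizer_iff[OF fin P t(1)] by blast+
      then show ?thesis
        using lcoset_fixed_iff[OF P t(1), of r] t(2) r ind_weight_fixed[of r C \<chi>] by simp
    qed
    then show "C \<in> {C \<in> lcosets P. \<forall>r\<in>P. r <# C = C \<and> ind_weight G \<chi> r C = \<chi> r}"
      using C by blast
  qed
  moreover have "finite ?N" using fin subgroup.subset[OF N] finite_subset by blast
  ultimately show ?thesis
    using N.l_lagrange[OF _ PsN] by (simp add: mark_def order_def mult.commute)
qed

end

subsection \<open>Morphisms of fusion systems\<close>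

lemma image_compose_self: "compose B f g ` B = f ` (g ` B)"
  by (auto simp: compose_def image_image)

lemma (in group) subgroup_conj_image:
  assumes a: "a \<in> carrier G" and H: "subgroup H G"
  shows "subgroup ((\<lambda>x. inv a \<otimes> x \<otimes> a) ` H) G"
proof (rule subgroupI)
  interpret H: subgroup H G by fact
  show "(\<lambda>x. inv a \<otimes> x \<otimes> a) ` H \<subseteq> carrier G" using a by auto
  show "(\<lambda>x. inv a \<otimes> x \<otimes> a) ` H \<noteq> {}" using H.one_closed by blast
  show "inv y \<in> (\<lambda>x. inv a \<otimes> x \<otimes> a) ` H" if y: "y \<in> (\<lambda>x. inv a \<otimes> x \<otimes> a) ` H" for y
  proof -
    obtain x where x: "x \<in> H" "y = inv a \<otimes> x \<otimes> a" using y by blast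
    then have "inv y = inv a \<otimes> inv x \<otimes> a" using a by (simp add: inv_mult_group m_assoc)
    then show ?thesis using x by blast
  qed
  show "y \<otimes> z \<in> (\<lambda>x. inv a \<otimes> x \<otimes> a) ` H"
    if yz: "y \<in> (\<lambda>x. inv a \<otimes> x \<otimes> a) ` H" "z \<in> (\<lambda>x. inv a \<otimes> x \<otimes> a) ` H" for y z
  proof -
    obtain u v where u: "u \<in> H" "y = inv a \<otimes> u \<otimes> a" and v: "v \<in> H" "z = inv a \<otimes> v \<otimes> a"
      using yz by blast
    then have "y \<otimes> z = inv a \<otimes> (u \<otimes> v) \<otimes> a" using a by (simp add: m_assoc inv_mult_cancel)
    then show ?thesis using u v by blast
  qed
qed

lemma (in group) mem_normalizer_iff:
  assumes "P \<subseteq> carrier G"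
  shows "g \<in> normalizer G P \<longleftrightarrow> g \<in> carrier G \<and> (\<lambda>x. g \<otimes> x \<otimes> inv g) ` P = P"
proof -
  have "g <# P #> inv g = (\<lambda>x. g \<otimes> x \<otimes> inv g) ` P" by (auto simp: l_coset_def r_coset_def)
  then show ?thesis using assms by (simp add: normalizer_def stabilizer_def)
qed

context fusion_system
begin

lemma mor_hom:
  assumes "subgroup P S" "subgroup Q S" "\<phi> \<in> F P Q"
  shows mor_ext: "\<phi> \<in> extensional P" and mor_inj: "inj_on \<phi> P" and mor_image: "\<phi> ` P \<subseteq> Q"
    and mor_closed: "\<And>x. x \<in> P \<Longrightarrow> \<phi> x \<in> Q"
    and mor_mult: "\<And>x y. x \<in> P \<Longrightarrow> y \<in> P \<Longrightarrow> \<phi> (x \<otimes> y) = \<phi> x \<otimes> \<phi> y"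
  using morphisms_injective[OF assms(1,2)] assms(3) by (auto simp: mon_def hom_def)

lemma mor_group_hom:
  assumes P: "subgroup P S" and phi: "\<phi> \<in> F P (carrier S)"
  shows "group_hom (S\<lparr>carrier := P\<rparr>) S \<phi>"
proof -
  have "\<phi> \<in> hom (S\<lparr>carrier := P\<rparr>) S"
    using mor_closed[OF P subgroup_self phi] mor_mult[OF P subgroup_self phi] by (auto simp: hom_def)
  then show ?thesis
    using subgroup.subgroup_is_group[OF P is_group] by (simp add: group_hom_def group_hom_axioms_def)
qed

lemma mor_one: "subgroup P S \<Longrightarrow> \<phi> \<in> F P (carrier S) \<Longrightarrow> \<phi> \<one> = \<one>"
  using group_hom.hom_one[OF mor_group_hom] by fastforce

lemma mor_inv:
  assumes P: "subgroup P S" and phi: "\<phi> \<in> F P (carrier S)" and x: "x \<in> P"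
  shows "\<phi> (inv x) = inv (\<phi> x)"
  using group_hom.hom_inv[OF mor_group_hom[OF P phi], of x] x m_inv_consistent[OF P x] by simp

lemma mor_pow:
  assumes P: "subgroup P S" and phi: "\<phi> \<in> F P (carrier S)" and x: "x \<in> P"
  shows "\<phi> (x [^] (n::nat)) = \<phi> x [^] n"
proof (induction n)
  case (Suc n)
  then show ?case using mor_mult[OF P subgroup_self phi] subgroup_nat_pow_closed[OF P x] x by simp
qed (use mor_one[OF P phi] in simp)

lemma mor_image_subgroup:
  assumes P: "subgroup P S" and phi: "\<phi> \<in> F P (carrier S)"
  shows "subgroup (\<phi> ` P) S"
  using group_hom.img_is_subgroup[OF mor_group_hom[OF P phi]] by simp

lemma mor_conj:
  assumes "subgroup P S" "subgroup Q S" "g \<in> carrier S" "\<And>x. x \<in> P \<Longrightarrow> g \<otimes> x \<otimes> inv g \<in> Q"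
  shows "conj_map S g P \<in> F P Q"
proof -
  have "conj_map S g P ` P \<subseteq> Q" using assms(4) by (auto simp: conj_map_def)
  then show ?thesis using conj_hom_subset[OF assms(1,2)] assms(3) by (auto simp: conj_hom_def)
qed

lemma mor_incl:
  assumes P: "subgroup P S" and Q: "subgroup Q S" and PQ: "P \<subseteq> Q"
  shows "(\<lambda>x\<in>P. x) \<in> F P Q"
proof -
  have "\<one> \<otimes> x \<otimes> inv \<one> = x" if "x \<in> P" for x using that subgroup.mem_carrier[OF P] by simp
  then have "conj_map S \<one> P = (\<lambda>x\<in>P. x)" "\<And>x. x \<in> P \<Longrightarrow> \<one> \<otimes> x \<otimes> inv \<one> \<in> Q"
    using PQ by (auto simp: conj_map_def fun_eq_iff)
  then show ?thesis using mor_conj[OF P Q one_closed] by metis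
qed

lemma mor_mono:
  assumes P: "subgroup P S" and Q: "subgroup Q S" and R: "subgroup R S" and QR: "Q \<subseteq> R"
    and phi: "\<phi> \<in> F P Q"
  shows "\<phi> \<in> F P R"
proof -
  have "compose P (\<lambda>x\<in>Q. x) \<phi> = \<phi>"
    using mor_ext[OF P Q phi] mor_closed[OF P Q phi]
    by (intro extensionalityI[of _ P]) (auto simp: compose_def)
  then show ?thesis using compose_closed[OF P Q R phi mor_incl[OF Q R QR]] by simp
qed

lemma mor_restrict:
  assumes P: "subgroup P S" and P': "subgroup P' S" and Q: "subgroup Q S" and sub: "P' \<subseteq> P"
    and phi: "\<phi> \<in> F P Q"
  shows "restrict \<phi> P' \<in> F P' Q"
proof -
  have "compose P' \<phi> (\<lambda>x\<in>P'. x) = restrict \<phi> P'" by (auto simp: compose_def)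
  then show ?thesis using compose_closed[OF P' P Q mor_incl[OF P' P sub] phi] by simp
qed

text \<open>The factorization axiom supplies an isomorphism onto some subgroup. It has the same
  values as the given morphism, so this subgroup can only be the image.\<close>

lemma mor_iso:
  assumes P: "subgroup P S" and Q: "subgroup Q S" and phi: "\<phi> \<in> F P Q"
  shows "\<phi> \<in> Iso_in F P (\<phi> ` P)"
proof -
  obtain R \<psi> where R: "subgroup R S" "\<psi> \<in> Iso_in F P R" "\<phi> = compose P (\<lambda>x\<in>R. x) \<psi>"
    using iso_then_inclusion[OF P Q phi] by blast
  have psi: "\<psi> \<in> F P R" using R(2) by (simp add: Iso_in_def)
  have eq: "\<phi> = \<psi>"
    using mor_ext[OF P R(1) psi] mor_closed[OF P R(1) psi] R(3)
    by (intro extensionalityI[of _ P]) (auto simp: compose_def)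
  obtain \<theta> where th: "\<theta> \<in> F R P" "compose R \<psi> \<theta> = (\<lambda>y\<in>R. y)"
    using R(2) by (auto simp: Iso_in_def)
  have "R \<subseteq> \<psi> ` P"
  proof
    fix y assume y: "y \<in> R"
    then have "y = \<psi> (\<theta> y)" using fun_cong[OF th(2), of y] by (simp add: compose_def)
    then show "y \<in> \<psi> ` P" using mor_closed[OF R(1) P th(1) y] by blast
  qed
  then have "\<psi> ` P = R" using mor_image[OF P R(1) psi] by blast
  then show ?thesis using R(2) eq by simp
qed

lemma mor_codomain:
  assumes "subgroup P S" "subgroup Q S" "\<phi> \<in> F P Q"
  shows "\<phi> \<in> F P (\<phi> ` P)"
  using mor_iso[OF assms] by (simp add: Iso_in_def)

lemma mor_compose:
  assumes P: "subgroup P S" and Q: "subgroup Q S" and phi: "\<phi> \<in> F P (carrier S)"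
    and psi: "\<psi> \<in> F Q (carrier S)" and sub: "\<phi> ` P \<subseteq> Q"
  shows "compose P \<psi> \<phi> \<in> F P (carrier S)"
  using compose_closed[OF P Q subgroup_self
      mor_mono[OF P mor_image_subgroup[OF P phi] Q sub mor_codomain[OF P subgroup_self phi]] psi] .

lemma mor_inverse:
  assumes P: "subgroup P S" and phi: "\<phi> \<in> F P (carrier S)"
  shows "restrict (inv_into P \<phi>) (\<phi> ` P) \<in> F (\<phi> ` P) (carrier S)"
proof -
  note Q = mor_image_subgroup[OF P phi]
  have "\<phi> \<in> Iso_in F P (\<phi> ` P)" by (rule mor_iso[OF P subgroup_self phi])
  then obtain \<psi> where psi: "\<psi> \<in> F (\<phi> ` P) P" "compose P \<psi> \<phi> = (\<lambda>x\<in>P. x)"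
    by (auto simp: Iso_in_def)
  have "\<psi> = restrict (inv_into P \<phi>) (\<phi> ` P)"
  proof (rule extensionalityI[of _ "\<phi> ` P"])
    fix y assume "y \<in> \<phi> ` P"
    then obtain x where x: "x \<in> P" "y = \<phi> x" by blast
    then have "\<psi> y = x" using fun_cong[OF psi(2), of x] by (simp add: compose_def)
    then show "\<psi> y = restrict (inv_into P \<phi>) (\<phi> ` P) y"
      using x mor_inj[OF P subgroup_self phi] by simp
  qed (use mor_ext[OF Q P psi(1)] in simp_all)
  then show ?thesis using mor_mono[OF Q P subgroup_self subgroup.subset[OF P] psi(1)] by simp
qed

text \<open>Lets every isomorphism be handled as a morphism into \<open>S\<close> with a prescribed
  image, which is how morphisms are quantified from here on.\<close>

lemma Iso_in_eq:
  assumes P: "subgroup P S" and Q: "subgroup Q S"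
  shows "Iso_in F P Q = {\<phi> \<in> F P (carrier S). \<phi> ` P = Q}"
proof (intro equalityI subsetI)
  fix \<phi> assume "\<phi> \<in> Iso_in F P Q"
  then obtain \<psi> where phi: "\<phi> \<in> F P Q" and psi: "\<psi> \<in> F Q P" "compose Q \<phi> \<psi> = (\<lambda>y\<in>Q. y)"
    by (auto simp: Iso_in_def)
  have "Q \<subseteq> \<phi> ` P"
  proof
    fix y assume y: "y \<in> Q"
    then have "y = \<phi> (\<psi> y)" using fun_cong[OF psi(2), of y] by (simp add: compose_def)
    then show "y \<in> \<phi> ` P" using mor_closed[OF Q P psi(1) y] by blast
  qed
  then show "\<phi> \<in> {\<phi> \<in> F P (carrier S). \<phi> ` P = Q}"
    using mor_image[OF P Q phi] mor_mono[OF P Q subgroup_self subgroup.subset[OF Q] phi] by blast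
next
  fix \<phi> assume "\<phi> \<in> {\<phi> \<in> F P (carrier S). \<phi> ` P = Q}"
  then show "\<phi> \<in> Iso_in F P Q" using mor_iso[OF P subgroup_self] by blast
qed

lemma Aut_in_eq: "subgroup P S \<Longrightarrow> Aut_in F P = {\<phi> \<in> F P (carrier S). \<phi> ` P = P}"
  by (simp add: Aut_in_def Iso_in_eq)

lemma finite_subset_carrier: "A \<subseteq> carrier S \<Longrightarrow> finite A"
  using finite_carrier finite_subset by blast

lemma finite_mor: "subgroup P S \<Longrightarrow> finite (F P (carrier S))"
proof -
  assume P: "subgroup P S"
  have "F P (carrier S) \<subseteq> (\<Pi>\<^sub>E x\<in>P. carrier S)"
    using mor_ext[OF P subgroup_self] mor_closed[OF P subgroup_self] by (auto simp: PiE_def)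
  moreover have "finite (\<Pi>\<^sub>E x\<in>P. carrier S)"
    using finite_carrier finite_subset_carrier[OF subgroup.subset[OF P]] by (intro finite_PiE)
  ultimately show ?thesis by (rule finite_subset)
qed

lemma Aut_group:
  assumes P: "subgroup P S"
  shows group_Aut_group: "group (Aut_group F P)"
    and finite_Aut_group: "finite (carrier (Aut_group F P))"
    and carrier_Aut_group: "carrier (Aut_group F P) = Aut_in F P"
    and Aut_group_mult: "\<And>f g. f \<in> Aut_in F P \<Longrightarrow> g \<in> Aut_in F P \<Longrightarrow>
        f \<otimes>\<^bsub>Aut_group F P\<^esub> g = compose P f g"
    and Aut_group_inv: "\<And>f x. f \<in> Aut_in F P \<Longrightarrow> x \<in> P \<Longrightarrow>
        f ((inv\<^bsub>Aut_group F P\<^esub> f) x) = x \<and> (inv\<^bsub>Aut_group F P\<^esub> f) (f x) = x"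
proof -
  have bij: "Aut_in F P \<subseteq> Bij P"
  proof
    fix f assume "f \<in> Aut_in F P"
    then have f: "f \<in> F P (carrier S)" "f ` P = P" using Aut_in_eq[OF P] by auto
    then show "f \<in> Bij P"
      using mor_ext[OF P subgroup_self f(1)] mor_inj[OF P subgroup_self f(1)]
      by (simp add: Bij_def bij_betw_def)
  qed
  have comp: "compose P f g \<in> Aut_in F P" if fg: "f \<in> Aut_in F P" "g \<in> Aut_in F P" for f g
  proof -
    have f: "f \<in> F P (carrier S)" "f ` P = P" and g: "g \<in> F P (carrier S)" "g ` P = P"
      using Aut_in_eq[OF P] fg by auto
    have "compose P f g ` P = f ` g ` P" by (auto simp: compose_def image_image)
    then show ?thesis using mor_compose[OF P P g(1) f(1)] f g by (simp add: Aut_in_eq[OF P])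
  qed
  have inv: "restrict (inv_into P f) P \<in> Aut_in F P" if fA: "f \<in> Aut_in F P" for f
  proof -
    have f: "f \<in> F P (carrier S)" "f ` P = P" using Aut_in_eq[OF P] fA by auto
    have "restrict (inv_into P f) P \<in> Bij P" using bij fA by (intro restrict_inv_into_Bij) blast
    then have "restrict (inv_into P f) P ` P = P"
      unfolding Bij_def using bij_betw_imp_surj_on by blast
    then show ?thesis using mor_inverse[OF P f(1)] f(2) by (simp add: Aut_in_eq[OF P])
  qed
  have sub: "subgroup (Aut_in F P) (BijGroup P)"
  proof (rule group.subgroupI[OF group_BijGroup])
    show "Aut_in F P \<subseteq> carrier (BijGroup P)" using bij by (simp add: BijGroup_def)
    have "(\<lambda>x\<in>P. x) ` P = P" by auto
    then show "Aut_in F P \<noteq> {}"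
      using mor_incl[OF P subgroup_self subgroup.subset[OF P]] Aut_in_eq[OF P] by blast
    show "inv\<^bsub>BijGroup P\<^esub> f \<in> Aut_in F P" if "f \<in> Aut_in F P" for f
      using inv[OF that] inv_BijGroup[of f P] that bij by auto
    show "f \<otimes>\<^bsub>BijGroup P\<^esub> g \<in> Aut_in F P" if "f \<in> Aut_in F P" "g \<in> Aut_in F P" for f g
    proof -
      have "f \<in> Bij P" "g \<in> Bij P" using that bij by auto
      then show ?thesis using comp[OF that] by (simp add: BijGroup_def)
    qed
  qed
  show "group (Aut_group F P)"
    unfolding Aut_group_def by (rule subgroup.subgroup_is_group[OF sub group_BijGroup])
  show carr: "carrier (Aut_group F P) = Aut_in F P" by (simp add: Aut_group_def)
  then show "finite (carrier (Aut_group F P))"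
    using finite_mor[OF P] Aut_in_eq[OF P] by simp
  show "f \<otimes>\<^bsub>Aut_group F P\<^esub> g = compose P f g" if "f \<in> Aut_in F P" "g \<in> Aut_in F P" for f g
    using that bij by (auto simp: Aut_group_def BijGroup_def)
  show "f ((inv\<^bsub>Aut_group F P\<^esub> f) x) = x \<and> (inv\<^bsub>Aut_group F P\<^esub> f) (f x) = x"
    if f: "f \<in> Aut_in F P" and x: "x \<in> P" for f x
  proof -
    have "inv\<^bsub>Aut_group F P\<^esub> f = restrict (inv_into P f) P"
      unfolding Aut_group_def using group.m_inv_consistent[OF group_BijGroup sub f]
        inv_BijGroup[of f P] f bij by auto
    moreover have "inj_on f P" "f ` P = P" using f bij by (auto simp: Bij_def bij_betw_def)
    ultimately show ?thesis using x f_inv_into_f[of x f P] by auto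
  qed
qed

lemma Aut_conj_hom_imp:
  assumes "f \<in> Aut_in (conj_hom S) P"
  obtains h where "h \<in> carrier S" "f = conj_map S h P"
  using assms by (auto simp: Aut_in_def Iso_in_def conj_hom_def)

lemma conj_map_Aut:
  assumes P: "subgroup P S" and h: "h \<in> carrier S" and im: "(\<lambda>x. h \<otimes> x \<otimes> inv h) ` P = P"
  shows "conj_map S h P \<in> Aut_in (conj_hom S) P"
proof -
  have Pc: "x \<in> carrier S" if "x \<in> P" for x using that subgroup.mem_carrier[OF P] by blast
  have cl: "h \<otimes> x \<otimes> inv h \<in> P" if "x \<in> P" for x using im that by blast
  have cl': "inv h \<otimes> y \<otimes> h \<in> P" if y: "y \<in> P" for y
  proof -
    obtain x where x: "x \<in> P" "y = h \<otimes> x \<otimes> inv h" using im y by blast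
    then show ?thesis using h Pc by (simp add: m_assoc inv_mult_cancel)
  qed
  have "conj_map S h P ` P \<subseteq> P" "conj_map S (inv h) P ` P \<subseteq> P"
    using h cl cl' by (auto simp: conj_map_def)
  then have 1: "conj_map S h P \<in> conj_hom S P P" "conj_map S (inv h) P \<in> conj_hom S P P"
    unfolding conj_hom_def using h inv_closed by blast+
  have 2: "compose P (conj_map S (inv h) P) (conj_map S h P) = (\<lambda>x\<in>P. x)"
    "compose P (conj_map S h P) (conj_map S (inv h) P) = (\<lambda>x\<in>P. x)"
    using h Pc cl cl' by (auto simp: compose_def conj_map_def fun_eq_iff m_assoc inv_mult_cancel)
  show ?thesis using 1 2 unfolding Aut_in_def Iso_in_def by blast
qed

text \<open>Describes \<open>N\<^sub>\<phi>\<close> without inverting \<phi>: conjugation by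
  \<open>g\<close> on the source corresponds under \<phi> to conjugation by some \<open>h\<close> on
  the image.\<close>

lemma ext_domain_iff:
  assumes P: "subgroup P S" and phi: "\<phi> \<in> F P (carrier S)"
  shows "g \<in> ext_domain S P \<phi> \<longleftrightarrow> g \<in> carrier S \<and> (\<lambda>x. g \<otimes> x \<otimes> inv g) ` P = P \<and>
    (\<exists>h\<in>carrier S. \<forall>x\<in>P. \<phi> (g \<otimes> x \<otimes> inv g) = h \<otimes> \<phi> x \<otimes> inv h)"
    (is "?L \<longleftrightarrow> ?R")
proof -
  have inj: "inv_into P \<phi> (\<phi> x) = x" if "x \<in> P" for x
    using mor_inj[OF P subgroup_self phi] that by simp
  let ?f = "\<lambda>y\<in>\<phi> ` P. \<phi> (conj_map S g P (inv_into P \<phi> y))"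
  show ?thesis
  proof
    assume L: ?L
    then have g: "g \<in> carrier S" "(\<lambda>x. g \<otimes> x \<otimes> inv g) ` P = P"
      using mem_normalizer_iff[OF subgroup.subset[OF P]] by (auto simp: ext_domain_def)
    obtain h where h: "h \<in> carrier S" "?f = conj_map S h (\<phi> ` P)"
      using L Aut_conj_hom_imp by (auto simp: ext_domain_def)
    have "\<phi> (g \<otimes> x \<otimes> inv g) = h \<otimes> \<phi> x \<otimes> inv h" if x: "x \<in> P" for x
      using fun_cong[OF h(2), of "\<phi> x"] x inj by (simp add: conj_map_def)
    then show ?R using g h by blast
  next
    assume R: ?R
    then obtain h where h: "h \<in> carrier S" "\<And>x. x \<in> P \<Longrightarrow> \<phi> (g \<otimes> x \<otimes> inv g) = h \<otimes> \<phi> x \<otimes> inv h"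
      by blast
    have "(\<lambda>y. h \<otimes> y \<otimes> inv h) ` \<phi> ` P = \<phi> ` ((\<lambda>x. g \<otimes> x \<otimes> inv g) ` P)"
      unfolding image_image by (rule image_cong) (use h(2) in auto)
    then have "conj_map S h (\<phi> ` P) \<in> Aut_in (conj_hom S) (\<phi> ` P)"
      using R by (intro conj_map_Aut mor_image_subgroup[OF P phi] h) simp
    moreover have "?f = conj_map S h (\<phi> ` P)"
    proof (rule extensionalityI[of _ "\<phi> ` P"])
      fix y assume "y \<in> \<phi> ` P"
      then show "?f y = conj_map S h (\<phi> ` P) y" using inj h(2) by (auto simp: conj_map_def)
    qed (simp_all add: conj_map_def)
    ultimately show ?L
      using R mem_normalizer_iff[OF subgroup.subset[OF P]] by (simp add: ext_domain_def)
  qed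
qed

text \<open>The axioms of a fusion system govern morphism sets between subgroups only, so an
  extension to \<open>N\<^sub>\<phi>\<close> can be restricted further only once this is
  known.\<close>

lemma subgroup_ext_domain:
  assumes P: "subgroup P S" and phi: "\<phi> \<in> F P (carrier S)"
  shows "subgroup (ext_domain S P \<phi>) S"
proof (rule subgroupI)
  note iff = ext_domain_iff[OF P phi]
  have Pc: "x \<in> carrier S" if "x \<in> P" for x using that subgroup.mem_carrier[OF P] by blast
  have phic: "\<phi> x \<in> carrier S" if "x \<in> P" for x using mor_closed[OF P subgroup_self phi that] .
  show "ext_domain S P \<phi> \<subseteq> carrier S" using iff by blast
  have "(\<lambda>x. \<one> \<otimes> x \<otimes> inv \<one>) ` P = (\<lambda>x. x) ` P" by (rule image_cong) (use Pc in auto)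
  then have "\<one> \<in> ext_domain S P \<phi>" unfolding iff using Pc phic by (auto intro!: bexI[of _ \<one>])
  then show "ext_domain S P \<phi> \<noteq> {}" by blast
  show "inv a \<in> ext_domain S P \<phi>" if a: "a \<in> ext_domain S P \<phi>" for a
  proof -
    obtain h where ac: "a \<in> carrier S" and im: "(\<lambda>x. a \<otimes> x \<otimes> inv a) ` P = P"
      and h: "h \<in> carrier S" "\<And>x. x \<in> P \<Longrightarrow> \<phi> (a \<otimes> x \<otimes> inv a) = h \<otimes> \<phi> x \<otimes> inv h"
      using a[unfolded iff] by blast
    have undo: "inv a \<otimes> (a \<otimes> x \<otimes> inv a) \<otimes> inv (inv a) = x" if "x \<in> P" for x
      using that ac Pc by (simp add: m_assoc inv_mult_cancel)
    have "(\<lambda>x. inv a \<otimes> x \<otimes> inv (inv a)) ` ((\<lambda>x. a \<otimes> x \<otimes> inv a) ` P) = (\<lambda>x. x) ` P"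
      unfolding image_image by (rule image_cong) (use undo in auto)
    then have A: "(\<lambda>x. inv a \<otimes> x \<otimes> inv (inv a)) ` P = P" using im by simp
    have B: "\<phi> (inv a \<otimes> y \<otimes> inv (inv a)) = inv h \<otimes> \<phi> y \<otimes> inv (inv h)" if y: "y \<in> P" for y
    proof -
      obtain x where x: "x \<in> P" "y = a \<otimes> x \<otimes> inv a" using im y by blast
      have "inv a \<otimes> y \<otimes> inv (inv a) = x" using undo[OF x(1)] x(2) by simp
      moreover have "\<phi> y = h \<otimes> \<phi> x \<otimes> inv h" using h(2)[OF x(1)] x(2) by simp
      ultimately show ?thesis using h(1) phic[OF x(1)] by (simp add: m_assoc inv_mult_cancel)
    qed
    show ?thesis
      unfolding iff
    proof (intro conjI bexI[of _ "inv h"] ballI)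
      show "inv a \<in> carrier S" "inv h \<in> carrier S" using ac h(1) by auto
    qed (use A B in blast)+
  qed
  show "a \<otimes> b \<in> ext_domain S P \<phi>" if ab: "a \<in> ext_domain S P \<phi>" "b \<in> ext_domain S P \<phi>" for a b
  proof -
    obtain h where a: "a \<in> carrier S" "(\<lambda>x. a \<otimes> x \<otimes> inv a) ` P = P"
      and h: "h \<in> carrier S" "\<And>x. x \<in> P \<Longrightarrow> \<phi> (a \<otimes> x \<otimes> inv a) = h \<otimes> \<phi> x \<otimes> inv h"
      using ab(1)[unfolded iff] by blast
    obtain k where b: "b \<in> carrier S" "(\<lambda>x. b \<otimes> x \<otimes> inv b) ` P = P"
      and k: "k \<in> carrier S" "\<And>x. x \<in> P \<Longrightarrow> \<phi> (b \<otimes> x \<otimes> inv b) = k \<otimes> \<phi> x \<otimes> inv k"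
      using ab(2)[unfolded iff] by blast
    have eq: "a \<otimes> b \<otimes> x \<otimes> inv (a \<otimes> b) = a \<otimes> (b \<otimes> x \<otimes> inv b) \<otimes> inv a" if "x \<in> P" for x
      using a b that Pc by (simp add: m_assoc inv_mult_group)
    have "(\<lambda>x. a \<otimes> b \<otimes> x \<otimes> inv (a \<otimes> b)) ` P =
        (\<lambda>x. a \<otimes> x \<otimes> inv a) ` ((\<lambda>x. b \<otimes> x \<otimes> inv b) ` P)"
      unfolding image_image by (rule image_cong) (use eq in auto)
    moreover have "\<phi> (a \<otimes> b \<otimes> x \<otimes> inv (a \<otimes> b)) = (h \<otimes> k) \<otimes> \<phi> x \<otimes> inv (h \<otimes> k)" if x: "x \<in> P" for x
    proof -
      have "b \<otimes> x \<otimes> inv b \<in> P" using b x by blast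
      then have "\<phi> (a \<otimes> b \<otimes> x \<otimes> inv (a \<otimes> b)) = h \<otimes> (k \<otimes> \<phi> x \<otimes> inv k) \<otimes> inv h"
        using eq[OF x] h(2) k(2)[OF x] by simp
      then show ?thesis using h k phic[OF x] by (simp add: m_assoc inv_mult_group)
    qed
    ultimately show ?thesis unfolding iff using a b h(1) k(1) by auto
  qed
qed

lemma p_power_subgroup:
  assumes "subgroup P S"
  shows "\<exists>k. card P = p ^ k"
proof -
  obtain n where n: "order S = p ^ n" using p_group by blast
  have "card P dvd p ^ n" using lagrange[OF assms] n by (metis dvd_triv_right)
  then show ?thesis using prime_p by (auto simp: divides_primepow_nat)
qed

text \<open>
  Unlike in \<^const>\<open>focal_subgroup\<close>, the generators come from all morphisms. Both groups agree by
  Alperin's fusion theorem, but the inclusion of the focal subgroup in this one suffices here.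
\<close>

definition focal :: "'a set" where
  "focal = generate S {inv u \<otimes> \<phi> u | u \<phi> P. subgroup P S \<and> u \<in> P \<and> \<phi> \<in> F P (carrier S)}"

lemma focal_gen: "subgroup P S \<Longrightarrow> u \<in> P \<Longrightarrow> \<phi> \<in> F P (carrier S) \<Longrightarrow> inv u \<otimes> \<phi> u \<in> focal"
  unfolding focal_def by (rule generate.incl) blast

lemma subgroup_focal: "subgroup focal S"
  unfolding focal_def
  by (rule generate_is_subgroup) (use mor_closed[OF _ subgroup_self] subgroup.mem_carrier in fastforce)

lemma focal_closed:
  assumes P: "subgroup P S" and u: "u \<in> P" "u \<in> focal" and phi: "\<phi> \<in> F P (carrier S)"
  shows "\<phi> u \<in> focal"
proof -
  have "u \<otimes> (inv u \<otimes> \<phi> u) = \<phi> u"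
    using mor_closed[OF P subgroup_self phi u(1)] subgroup.mem_carrier[OF P u(1)] by (simp add: inv_mult_cancel)
  then show ?thesis
    using subgroup.m_closed[OF subgroup_focal u(2) focal_gen[OF P u(1) phi]] by simp
qed

end

section \<open>Saturation for pairs of a subgroup and a character\<close>

context saturated_fusion_system
begin

text \<open>
  The analogue of a fully normalized subgroup for pairs of a subgroup and a character: take
  \<open>R\<^sub>0\<close> fully normalized and \<open>\<rho>\<^sub>0\<close> such that the stabilizer of \<open>\<rho>\<^sub>0\<close> in \<open>Aut\<^sub>S(R\<^sub>0)\<close> is a Sylow subgroup
  of its stabilizer in \<open>Aut\<^sub>F(R\<^sub>0)\<close>.
\<close>

lemma receptive_pair:
  assumes R: "subgroup R S"
  obtains \<phi> R\<^sub>0 \<rho>\<^sub>0 where "\<phi> \<in> F R (carrier S)" "\<phi> ` R = R\<^sub>0" "\<And>x. x \<in> R \<Longrightarrow> \<rho>\<^sub>0 (\<phi> x) = \<rho> x"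
    and "\<And>R' \<rho>' \<phi>'. subgroup R' S \<Longrightarrow> character S R' \<rho>' \<Longrightarrow> \<phi>' \<in> F R' (carrier S) \<Longrightarrow>
      \<phi>' ` R' = R\<^sub>0 \<Longrightarrow> (\<And>x. x \<in> R' \<Longrightarrow> \<rho>\<^sub>0 (\<phi>' x) = \<rho>' x) \<Longrightarrow>
      \<exists>\<Phi>\<in>F (char_normalizer S R' \<rho>') (carrier S). \<Phi> ` R' = R\<^sub>0 \<and> (\<forall>x\<in>R'. \<rho>\<^sub>0 (\<Phi> x) = \<rho>' x)"
proof -
  \<comment> \<open>A conjugate of \<open>R\<close> whose normalizer has the greatest order is fully
    normalized, so saturation makes its \<open>Aut\<^sub>S\<close> a Sylow subgroup and the
    conjugate fully centralized.\<close>
  have "\<exists>\<phi>. \<phi> \<in> F R (carrier S) \<and> (\<forall>\<psi>. \<psi> \<in> F R (carrier S) \<longrightarrow>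
      card (normalizer S (\<psi> ` R)) \<le> card (normalizer S (\<phi> ` R)))"
  proof (rule ex_has_greatest_nat[where b = "Suc (card (carrier S))"])
    show "(\<lambda>x\<in>R. x) \<in> F R (carrier S)" using mor_incl[OF R subgroup_self] subgroup.subset[OF R] .
    show "\<forall>y. y \<in> F R (carrier S) \<longrightarrow> card (normalizer S (y ` R)) < Suc (card (carrier S))"
    proof (intro allI impI)
      fix y assume "y \<in> F R (carrier S)"
      then have "y ` R \<subseteq> carrier S" using mor_image[OF R subgroup_self] by blast
      then have "normalizer S (y ` R) \<subseteq> carrier S" using mem_normalizer_iff by blast
      then show "card (normalizer S (y ` R)) < Suc (card (carrier S))"
        using card_mono[OF finite_carrier] by (simp add: less_Suc_eq_le)
    qed
  qed
  then obtain \<phi>\<^sub>1 where phi1: "\<phi>\<^sub>1 \<in> F R (carrier S)"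
    and max: "\<And>\<psi>. \<psi> \<in> F R (carrier S) \<Longrightarrow> card (normalizer S (\<psi> ` R)) \<le> card (normalizer S (\<phi>\<^sub>1 ` R))"
    by blast
  define T where "T = \<phi>\<^sub>1 ` R"
  have T: "subgroup T S" unfolding T_def by (rule mor_image_subgroup[OF R phi1])
  have Tc: "x \<in> carrier S" if "x \<in> T" for x using that subgroup.mem_carrier[OF T] by blast
  have "fully_normalized S F T"
    unfolding fully_normalized_def
  proof (intro allI impI)
    fix Q assume Q: "subgroup Q S \<and> Iso_in F T Q \<noteq> {}"
    then obtain \<alpha> where al: "\<alpha> \<in> F T (carrier S)" "\<alpha> ` T = Q" using Iso_in_eq[OF T] by blast
    have "compose R \<alpha> \<phi>\<^sub>1 \<in> F R (carrier S)" using mor_compose[OF R T phi1 al(1)] T_def by simp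
    moreover have "compose R \<alpha> \<phi>\<^sub>1 ` R = Q" using al(2) by (auto simp: T_def compose_def image_image)
    ultimately show "card (normalizer S Q) \<le> card (normalizer S T)" using max T_def by metis
  qed
  then have fc: "fully_centralized S F T"
    and syl: "sylow_subgroup p (Aut_in (conj_hom S) T) (Aut_group F T)"
    using saturation_I[OF T] by auto
  define A where "A = Aut_group F T"
  interpret A: group A unfolding A_def by (rule group_Aut_group[OF T])
  have carA: "carrier A = Aut_in F T" unfolding A_def by (rule carrier_Aut_group[OF T])
  have finA: "finite (carrier A)" unfolding A_def by (rule finite_Aut_group[OF T])
  have Amem: "f \<in> carrier A \<longleftrightarrow> f \<in> F T (carrier S) \<and> f ` T = T" for f
    using carA Aut_in_eq[OF T] by simp
  have Acl: "f x \<in> T" if "f \<in> carrier A" "x \<in> T" for f x using that Amem by blast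
  have Amult: "(f \<otimes>\<^bsub>A\<^esub> g) x = f (g x)" if "f \<in> carrier A" "g \<in> carrier A" "x \<in> T" for f g x
    using that carA Aut_group_mult[OF T, of f g] by (simp add: A_def compose_def)
  have Ainv: "f ((inv\<^bsub>A\<^esub> f) x) = x" "(inv\<^bsub>A\<^esub> f) (f x) = x" if "f \<in> carrier A" "x \<in> T" for f x
    using that carA Aut_group_inv[OF T, of f x] by (auto simp: A_def)
  have Aone: "(\<one>\<^bsub>A\<^esub>) x = x" if "x \<in> T" for x
    using Ainv(1)[OF A.one_closed that] Amult[OF A.one_closed A.one_closed that] by simp
  have Aeq: "f = g" if "f \<in> carrier A" "g \<in> carrier A" "\<And>x. x \<in> T \<Longrightarrow> f x = g x" for f g
    using that Amem mor_ext[OF T subgroup_self] extensionalityI[of f T g] by blast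
  define stab where "stab \<sigma> = {f \<in> carrier A. \<forall>x\<in>T. \<sigma> (f x) = \<sigma> x}" for \<sigma> :: "'a \<Rightarrow> complex"
  have stab: "subgroup (stab \<sigma>) A" for \<sigma>
  proof (rule A.subgroupI)
    have "\<one>\<^bsub>A\<^esub> \<in> stab \<sigma>" using Aone by (simp add: stab_def)
    then show "stab \<sigma> \<noteq> {}" by blast
    show "inv\<^bsub>A\<^esub> f \<in> stab \<sigma>" if f: "f \<in> stab \<sigma>" for f
    proof -
      have fA: "f \<in> carrier A" using f by (simp add: stab_def)
      have "\<sigma> ((inv\<^bsub>A\<^esub> f) x) = \<sigma> x" if x: "x \<in> T" for x
      proof -
        have "(inv\<^bsub>A\<^esub> f) x \<in> T" using Acl[OF A.inv_closed[OF fA] x] .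
        then have "\<sigma> (f ((inv\<^bsub>A\<^esub> f) x)) = \<sigma> ((inv\<^bsub>A\<^esub> f) x)" using f by (simp add: stab_def)
        then show ?thesis using Ainv(1)[OF fA x] by simp
      qed
      then show ?thesis using fA by (simp add: stab_def)
    qed
    show "f \<otimes>\<^bsub>A\<^esub> g \<in> stab \<sigma>" if "f \<in> stab \<sigma>" "g \<in> stab \<sigma>" for f g
      using that Acl Amult by (auto simp: stab_def)
  qed (auto simp: stab_def)
  define \<rho>\<^sub>1 where "\<rho>\<^sub>1 y = \<rho> (inv_into R \<phi>\<^sub>1 y)" for y
  have rho1: "\<rho>\<^sub>1 (\<phi>\<^sub>1 x) = \<rho> x" if "x \<in> R" for x
    using that mor_inj[OF R subgroup_self phi1] by (simp add: \<rho>\<^sub>1_def)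
  define H where "H = stab \<rho>\<^sub>1"
  have H: "subgroup H A" unfolding H_def by (rule stab)
  have finH: "finite H" using finite_subset[OF subgroup.subset[OF H] finA] .
  define a where "a = multiplicity p (card H)"
  have cardH0: "card H \<noteq> 0" using finH subgroup.one_closed[OF H] by auto
  obtain m where "card H = p ^ a * m" unfolding a_def by (metis dvdE multiplicity_dvd)
  then obtain K where K: "subgroup K (A\<lparr>carrier := H\<rparr>)" "card K = p ^ a"
    using sylow_thm[OF prime_p subgroup.subgroup_is_group[OF H A.is_group], of a m] finH
    by (auto simp: order_def)
  have KA: "subgroup K A" using A.incl_subgroup[OF H K(1)] .
  have KH: "K \<subseteq> H" using subgroup.subset[OF K(1)] by simp
  \<comment> \<open>\<open>K\<close> is a Sylow subgroup of the stabilizer \<open>H\<close> of the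
    transported character. It is a p-group, hence conjugate into the Sylow subgroup
    \<open>Aut\<^sub>S(T)\<close>.\<close>
  have "\<exists>\<beta>\<in>carrier A. \<forall>x\<in>carrier (A\<lparr>carrier := K\<rparr>). inv\<^bsub>A\<^esub> \<beta> \<otimes>\<^bsub>A\<^esub> id x \<otimes>\<^bsub>A\<^esub> \<beta> \<in> Aut_in (conj_hom S) T"
  proof (rule sylow_contains_conjugate[OF A.is_group finA _ prime_p])
    show "group (A\<lparr>carrier := K\<rparr>)" by (rule subgroup.subgroup_is_group[OF KA A.is_group])
    show "order (A\<lparr>carrier := K\<rparr>) = p ^ a" using K(2) by (simp add: order_def)
    show "id \<in> hom (A\<lparr>carrier := K\<rparr>) A" using subgroup.subset[OF KA] by (auto simp: hom_def)
    show "sylow_subgroup p (Aut_in (conj_hom S) T) A" using syl by (simp add: A_def)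
  qed
  then obtain \<beta> where be: "\<beta> \<in> carrier A"
    "\<And>k. k \<in> K \<Longrightarrow> inv\<^bsub>A\<^esub> \<beta> \<otimes>\<^bsub>A\<^esub> k \<otimes>\<^bsub>A\<^esub> \<beta> \<in> Aut_in (conj_hom S) T" by auto
  \<comment> \<open>Twisting the character by \<beta> conjugates its stabilizer, so that the new
    stabilizer \<open>H\<^sub>0\<close> has a Sylow subgroup \<open>L\<close> inside
    \<open>Aut\<^sub>S(T)\<close>.\<close>
  define \<rho>\<^sub>0 where "\<rho>\<^sub>0 y = \<rho>\<^sub>1 (\<beta> y)" for y
  define L where "L = (\<lambda>x. inv\<^bsub>A\<^esub> \<beta> \<otimes>\<^bsub>A\<^esub> x \<otimes>\<^bsub>A\<^esub> \<beta>) ` K"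
  define H\<^sub>0 where "H\<^sub>0 = stab \<rho>\<^sub>0"
  have conjH: "(\<lambda>x. inv\<^bsub>A\<^esub> \<beta> \<otimes>\<^bsub>A\<^esub> x \<otimes>\<^bsub>A\<^esub> \<beta>) ` H = H\<^sub>0"
  proof (intro equalityI subsetI)
    fix f assume "f \<in> (\<lambda>x. inv\<^bsub>A\<^esub> \<beta> \<otimes>\<^bsub>A\<^esub> x \<otimes>\<^bsub>A\<^esub> \<beta>) ` H"
    then obtain g where g: "g \<in> H" "f = inv\<^bsub>A\<^esub> \<beta> \<otimes>\<^bsub>A\<^esub> g \<otimes>\<^bsub>A\<^esub> \<beta>" by blast
    have gA: "g \<in> carrier A" using g by (simp add: H_def stab_def)
    have "\<rho>\<^sub>0 (f x) = \<rho>\<^sub>0 x" if x: "x \<in> T" for x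
    proof -
      have 1: "\<beta> x \<in> T" "g (\<beta> x) \<in> T" using Acl be(1) gA x by auto
      then have "f x = (inv\<^bsub>A\<^esub> \<beta>) (g (\<beta> x))" using g be(1) gA x Amult by simp
      then have "\<rho>\<^sub>0 (f x) = \<rho>\<^sub>1 (g (\<beta> x))" using Ainv(1)[OF be(1) 1(2)] by (simp add: \<rho>\<^sub>0_def)
      also have "\<dots> = \<rho>\<^sub>1 (\<beta> x)" using g(1) 1(1) by (simp add: H_def stab_def)
      finally show ?thesis by (simp add: \<rho>\<^sub>0_def)
    qed
    then show "f \<in> H\<^sub>0" using g be(1) gA by (simp add: H\<^sub>0_def stab_def)
  next
    fix f assume f: "f \<in> H\<^sub>0"
    have fA: "f \<in> carrier A" using f by (simp add: H\<^sub>0_def stab_def)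
    let ?g = "\<beta> \<otimes>\<^bsub>A\<^esub> f \<otimes>\<^bsub>A\<^esub> inv\<^bsub>A\<^esub> \<beta>"
    have "\<rho>\<^sub>1 (?g x) = \<rho>\<^sub>1 x" if x: "x \<in> T" for x
    proof -
      have 1: "(inv\<^bsub>A\<^esub> \<beta>) x \<in> T" using Acl[OF A.inv_closed[OF be(1)] x] .
      have "?g x = \<beta> (f ((inv\<^bsub>A\<^esub> \<beta>) x))" using be(1) fA x 1 Amult by simp
      then have "\<rho>\<^sub>1 (?g x) = \<rho>\<^sub>0 (f ((inv\<^bsub>A\<^esub> \<beta>) x))" by (simp add: \<rho>\<^sub>0_def)
      also have "\<dots> = \<rho>\<^sub>0 ((inv\<^bsub>A\<^esub> \<beta>) x)" using f 1 by (simp add: H\<^sub>0_def stab_def)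
      also have "\<dots> = \<rho>\<^sub>1 x" using Ainv(1)[OF be(1) x] by (simp add: \<rho>\<^sub>0_def)
      finally show ?thesis .
    qed
    then have "?g \<in> H" using be(1) fA by (simp add: H_def stab_def)
    moreover have "f = inv\<^bsub>A\<^esub> \<beta> \<otimes>\<^bsub>A\<^esub> ?g \<otimes>\<^bsub>A\<^esub> \<beta>"
      using be(1) fA by (simp add: A.m_assoc A.inv_mult_cancel)
    ultimately show "f \<in> (\<lambda>x. inv\<^bsub>A\<^esub> \<beta> \<otimes>\<^bsub>A\<^esub> x \<otimes>\<^bsub>A\<^esub> \<beta>) ` H" by blast
  qed
  have H0: "subgroup H\<^sub>0 A" unfolding H\<^sub>0_def by (rule stab)
  have finH0: "finite H\<^sub>0" using finite_subset[OF subgroup.subset[OF H0] finA] .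
  have LH0: "L \<subseteq> H\<^sub>0" unfolding L_def conjH[symmetric] using KH by blast
  have Lsub: "subgroup L (A\<lparr>carrier := H\<^sub>0\<rparr>)"
    unfolding L_def
    by (rule A.subgroup_incl[OF A.subgroup_conj_image[OF be(1) KA] H0]) (use LH0 L_def in simp)
  have "card L = p ^ a" unfolding L_def using A.card_conj_subset[OF be(1) subgroup.subset[OF KA]] K(2) by simp
  moreover have "card H\<^sub>0 = card H"
    unfolding conjH[symmetric] using A.card_conj_subset[OF be(1) subgroup.subset[OF H]] .
  ultimately have sylL: "sylow_subgroup p L (A\<lparr>carrier := H\<^sub>0\<rparr>)"
    using Lsub by (simp add: sylow_subgroup_def order_def a_def)
  have Lconj: "f \<in> Aut_in (conj_hom S) T" if "f \<in> L" for f using that be(2) by (auto simp: L_def)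
  define \<phi> where "\<phi> = compose R (inv\<^bsub>A\<^esub> \<beta>) \<phi>\<^sub>1"
  have ibe: "inv\<^bsub>A\<^esub> \<beta> \<in> F T (carrier S)" "(inv\<^bsub>A\<^esub> \<beta>) ` T = T" using Amem A.inv_closed[OF be(1)] by auto
  show thesis
  proof (rule that)
    show "\<phi> \<in> F R (carrier S)" unfolding \<phi>_def using mor_compose[OF R T phi1 ibe(1)] T_def by simp
    show "\<phi> ` R = T" using ibe(2) by (auto simp: \<phi>_def T_def compose_def image_image)
    show "\<rho>\<^sub>0 (\<phi> x) = \<rho> x" if x: "x \<in> R" for x
    proof -
      have "\<phi>\<^sub>1 x \<in> T" using x by (simp add: T_def)
      then show ?thesis using x Ainv(1)[OF be(1)] rho1[OF x] by (simp add: \<phi>_def \<rho>\<^sub>0_def compose_def)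
    qed
  next
    fix R' \<rho>' \<phi>'
    assume R': "subgroup R' S" and chi: "character S R' \<rho>'" and phi': "\<phi>' \<in> F R' (carrier S)"
      and im: "\<phi>' ` R' = T" and tr: "\<And>x. x \<in> R' \<Longrightarrow> \<rho>\<^sub>0 (\<phi>' x) = \<rho>' x"
    let ?N = "char_normalizer S R' \<rho>'"
    have N: "subgroup ?N S" by (rule subgroup_char_normalizer[OF R'])
    have R'c: "x \<in> carrier S" if "x \<in> R'" for x using that subgroup.mem_carrier[OF R'] by blast
    have Nc: "g \<in> carrier S" if "g \<in> ?N" for g using that by (simp add: char_normalizer_def)
    have Ncl: "g \<otimes> x \<otimes> inv g \<in> R'" if "g \<in> ?N" "x \<in> R'" for g x
      using that by (auto simp: char_normalizer_def)
    have inj: "inv_into R' \<phi>' (\<phi>' x) = x" if "x \<in> R'" for x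
      using mor_inj[OF R' subgroup_self phi'] that by simp
    \<comment> \<open>\<open>c g\<close> is \<phi>' followed after conjugation by \<open>g\<close>
      and the inverse of \<phi>'. As \<open>g\<close> fixes the character on \<open>R'\<close>,
      these automorphisms of \<open>T\<close> fix the one on \<open>T\<close>, so \<open>c\<close>
      maps into \<open>H\<^sub>0\<close>.\<close>
    define c where "c g = (\<lambda>y\<in>T. \<phi>' (g \<otimes> inv_into R' \<phi>' y \<otimes> inv g))" for g
    have c: "c g (\<phi>' x) = \<phi>' (g \<otimes> x \<otimes> inv g)" if "x \<in> R'" for g x
      using that im inj by (auto simp: c_def)
    have cA: "c g \<in> carrier A" if g: "g \<in> ?N" for g
    proof -
      have gc: "conj_map S g R' \<in> F R' R'" using Ncl[OF g] Nc[OF g] by (intro mor_conj R') auto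
      have gim: "conj_map S g R' ` R' = R'" using g by (simp add: conj_map_def char_normalizer_def)
      let ?i = "restrict (inv_into R' \<phi>') T"
      have i: "?i \<in> F T (carrier S)" "?i ` T = R'"
        using mor_inverse[OF R' phi'] im inj by (auto simp: image_iff)
      have gc': "conj_map S g R' \<in> F R' (carrier S)"
        using mor_mono[OF R' R' subgroup_self subgroup.subset[OF R'] gc] .
      have 1: "compose T (conj_map S g R') ?i \<in> F T (carrier S)"
        using mor_compose[OF T R' i(1) gc'] i(2) by simp
      have u1: "compose T (conj_map S g R') ?i ` T = R'"
        using i(2) gim by (simp add: image_compose_self)
      have 2: "compose T \<phi>' (compose T (conj_map S g R') ?i) \<in> F T (carrier S)"
        using mor_compose[OF T R' 1 phi'] u1 by simp
      have u2: "compose T \<phi>' (compose T (conj_map S g R') ?i) ` T = T"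
        using u1 im by (simp add: image_compose_self)
      have "c g = compose T \<phi>' (compose T (conj_map S g R') ?i)"
      proof (rule extensionalityI[of _ T])
        fix y assume "y \<in> T"
        then obtain x where "x \<in> R'" "y = \<phi>' x" using im by blast
        then show "c g y = compose T \<phi>' (compose T (conj_map S g R') ?i) y"
          using c inj \<open>y \<in> T\<close> by (simp add: compose_def conj_map_def)
      qed (simp_all add: c_def compose_def)
      then show ?thesis using 2 u2 Amem by simp
    qed
    have cH0: "c g \<in> H\<^sub>0" if g: "g \<in> ?N" for g
    proof -
      have "\<rho>\<^sub>0 (c g y) = \<rho>\<^sub>0 y" if "y \<in> T" for y
      proof -
        obtain x where x: "x \<in> R'" "y = \<phi>' x" using im \<open>y \<in> T\<close> by blast
        then have "\<rho>\<^sub>0 (c g y) = \<rho>' (g \<otimes> x \<otimes> inv g)" using c tr Ncl[OF g] by simp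
        also have "\<dots> = \<rho>' x" using g x by (simp add: char_normalizer_def)
        finally show ?thesis using tr x by simp
      qed
      then show ?thesis using cA[OF g] by (simp add: H\<^sub>0_def stab_def)
    qed
    obtain k where k: "card ?N = p ^ k" using p_power_subgroup[OF N] by blast
    \<comment> \<open>The image of the p-group \<open>?N\<close> in \<open>H\<^sub>0\<close> is
      conjugate into \<open>L\<close>. It is essential that \<open>b\<close> is taken from
      \<open>H\<^sub>0\<close> and not merely from \<open>A\<close>: changing \<phi>' by
      \<open>b\<close> then leaves the character alone.\<close>
    have "\<exists>b\<in>carrier (A\<lparr>carrier := H\<^sub>0\<rparr>). \<forall>g\<in>carrier (S\<lparr>carrier := ?N\<rparr>).
        inv\<^bsub>A\<lparr>carrier := H\<^sub>0\<rparr>\<^esub> b \<otimes>\<^bsub>A\<lparr>carrier := H\<^sub>0\<rparr>\<^esub> c g \<otimes>\<^bsub>A\<lparr>carrier := H\<^sub>0\<rparr>\<^esub> b \<in> L"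
    proof (rule sylow_contains_conjugate[OF _ _ _ prime_p _ _ sylL])
      show "group (A\<lparr>carrier := H\<^sub>0\<rparr>)" by (rule subgroup.subgroup_is_group[OF H0 A.is_group])
      show "finite (carrier (A\<lparr>carrier := H\<^sub>0\<rparr>))" using finH0 by simp
      show "group (S\<lparr>carrier := ?N\<rparr>)" by (rule subgroup.subgroup_is_group[OF N is_group])
      show "order (S\<lparr>carrier := ?N\<rparr>) = p ^ k" using k by (simp add: order_def)
      show "c \<in> hom (S\<lparr>carrier := ?N\<rparr>) (A\<lparr>carrier := H\<^sub>0\<rparr>)"
      proof (rule homI)
        fix g h assume "g \<in> carrier (S\<lparr>carrier := ?N\<rparr>)" "h \<in> carrier (S\<lparr>carrier := ?N\<rparr>)"
        then have gh: "g \<in> ?N" "h \<in> ?N" by auto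
        have "c (g \<otimes> h) = c g \<otimes>\<^bsub>A\<^esub> c h"
        proof (rule Aeq)
          show "c (g \<otimes> h) \<in> carrier A" using cA subgroup.m_closed[OF N] gh by blast
          show "c g \<otimes>\<^bsub>A\<^esub> c h \<in> carrier A" using cA gh by blast
          fix y assume y: "y \<in> T"
          then obtain x where x: "x \<in> R'" "y = \<phi>' x" using im by blast
          have "g \<otimes> h \<otimes> x \<otimes> inv (g \<otimes> h) = g \<otimes> (h \<otimes> x \<otimes> inv h) \<otimes> inv g"
            using gh Nc R'c x by (simp add: m_assoc inv_mult_group)
          then show "c (g \<otimes> h) y = (c g \<otimes>\<^bsub>A\<^esub> c h) y"
            using Amult[OF cA[OF gh(1)] cA[OF gh(2)] y] c x Ncl[OF gh(2)] by simp
        qed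
        then show "c (g \<otimes>\<^bsub>S\<lparr>carrier := ?N\<rparr>\<^esub> h) = c g \<otimes>\<^bsub>A\<lparr>carrier := H\<^sub>0\<rparr>\<^esub> c h" by simp
      qed (use cH0 in simp)
    qed
    then obtain b where b: "b \<in> H\<^sub>0" "\<And>g. g \<in> ?N \<Longrightarrow> inv\<^bsub>A\<^esub> b \<otimes>\<^bsub>A\<^esub> c g \<otimes>\<^bsub>A\<^esub> b \<in> L"
      using A.m_inv_consistent[OF H0] by auto
    have bA: "b \<in> carrier A" using b(1) by (simp add: H\<^sub>0_def stab_def)
    have ib: "inv\<^bsub>A\<^esub> b \<in> F T (carrier S)" "(inv\<^bsub>A\<^esub> b) ` T = T" using Amem A.inv_closed[OF bA] by auto
    \<comment> \<open>After this change every \<open>g\<close> in \<open>?N\<close> induces on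
      \<open>T\<close> an element of \<open>L\<close>, hence conjugation by an element of
      \<open>S\<close>, so \<open>?N\<close> lies in the domain \<open>N\<^sub>\<theta>\<close> of
      saturation II.\<close>
    define \<theta> where "\<theta> = compose R' (inv\<^bsub>A\<^esub> b) \<phi>'"
    have th: "\<theta> \<in> F R' (carrier S)" unfolding \<theta>_def using mor_compose[OF R' T phi' ib(1)] im by simp
    have thim: "\<theta> ` R' = T" using ib(2) im by (simp add: \<theta>_def image_compose_self)
    have thx: "\<theta> x = (inv\<^bsub>A\<^esub> b) (\<phi>' x)" if "x \<in> R'" for x using that by (simp add: \<theta>_def compose_def)
    have thtr: "\<rho>\<^sub>0 (\<theta> x) = \<rho>' x" if x: "x \<in> R'" for x
    proof -
      have "\<phi>' x \<in> T" using x im by blast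
      moreover have "inv\<^bsub>A\<^esub> b \<in> H\<^sub>0" using subgroup.m_inv_closed[OF H0 b(1)] .
      ultimately have "\<rho>\<^sub>0 (\<theta> x) = \<rho>\<^sub>0 (\<phi>' x)" using thx[OF x] by (simp add: H\<^sub>0_def stab_def)
      then show ?thesis using tr x by simp
    qed
    have sub: "?N \<subseteq> ext_domain S R' \<theta>"
    proof
      fix g assume g: "g \<in> ?N"
      obtain h where h: "h \<in> carrier S" "inv\<^bsub>A\<^esub> b \<otimes>\<^bsub>A\<^esub> c g \<otimes>\<^bsub>A\<^esub> b = conj_map S h T"
        using Aut_conj_hom_imp Lconj b(2)[OF g] by metis
      have "\<theta> (g \<otimes> x \<otimes> inv g) = h \<otimes> \<theta> x \<otimes> inv h" if x: "x \<in> R'" for x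
      proof -
        have px: "\<phi>' x \<in> T" and tx: "\<theta> x \<in> T" using x im thim by blast+
        have "b (\<theta> x) = \<phi>' x" using thx[OF x] Ainv(1)[OF bA px] by simp
        then have "(inv\<^bsub>A\<^esub> b \<otimes>\<^bsub>A\<^esub> c g \<otimes>\<^bsub>A\<^esub> b) (\<theta> x) = (inv\<^bsub>A\<^esub> b) (c g (\<phi>' x))"
          using Amult bA cA[OF g] tx px by simp
        also have "\<dots> = \<theta> (g \<otimes> x \<otimes> inv g)" using c[OF x] thx[OF Ncl[OF g x]] by simp
        finally show ?thesis using h(2) tx by (simp add: conj_map_def)
      qed
      then show "g \<in> ext_domain S R' \<theta>"
        unfolding ext_domain_iff[OF R' th] using g h(1) by (auto simp: char_normalizer_def)
    qed
    obtain \<Psi> where Psi: "\<Psi> \<in> F (ext_domain S R' \<theta>) (carrier S)" "restrict \<Psi> R' = \<theta>"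
      using saturation_II[OF R' th] thim fc by auto
    have "restrict \<Psi> ?N \<in> F ?N (carrier S)"
      by (rule mor_restrict[OF subgroup_ext_domain[OF R' th] N subgroup_self sub Psi(1)])
    moreover have val: "restrict \<Psi> ?N x = \<theta> x" if "x \<in> R'" for x
      using that fun_cong[OF Psi(2), of x] char_normalizer_contains[OF R' chi] by auto
    moreover have "restrict \<Psi> ?N ` R' = T" using val thim by (metis image_cong)
    ultimately show "\<exists>\<Phi>\<in>F ?N (carrier S). \<Phi> ` R' = T \<and> (\<forall>x\<in>R'. \<rho>\<^sub>0 (\<Phi> x) = \<rho>' x)"
      using thtr by (intro bexI[of _ "restrict \<Psi> ?N"]) auto
  qed
qed

end

subsection \<open>Stable combinations of induced monomial sets\<close>

locale fusion_character = saturated_fusion_system +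
  fixes lam :: "'a \<Rightarrow> complex"
  assumes lam_char: "character S (carrier S) lam"
    and lam_stable: "\<alpha> \<in> F (carrier S) (carrier S) \<Longrightarrow> x \<in> carrier S \<Longrightarrow> lam (\<alpha> x) = lam x"
begin

text \<open>All F-conjugates of \<open>lam\<close> on subgroups. This family is finite, is preserved
  by pulling back along morphisms, and contains every character by which a subgroup acts on a line
  of the induced sets below. Restriction makes its members comparable as functions.\<close>

definition Ch :: "'a set \<Rightarrow> ('a \<Rightarrow> complex) set" where
  "Ch Q = {restrict (\<lambda>x. lam (\<psi> x)) Q | \<psi>. \<psi> \<in> F Q (carrier S)}"

lemma finite_Ch: "subgroup Q S \<Longrightarrow> finite (Ch Q)"
  using finite_mor[of Q] by (simp add: Ch_def setcompr_eq_image)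

lemma Ch_ext: "Ch Q \<subseteq> extensional Q"
  by (auto simp: Ch_def)

lemma Ch_character:
  assumes Q: "subgroup Q S" and rho: "\<rho> \<in> Ch Q"
  shows "character S Q \<rho>"
proof -
  obtain \<psi> where psi: "\<psi> \<in> F Q (carrier S)" "\<rho> = restrict (\<lambda>x. lam (\<psi> x)) Q"
    using rho by (auto simp: Ch_def)
  show ?thesis
    unfolding character_def psi(2)
    using mor_closed[OF Q subgroup_self psi(1)] mor_mult[OF Q subgroup_self psi(1)]
      character_nonzero[OF lam_char] character_mult[OF lam_char]
    by (simp add: subgroup.m_closed[OF Q])
qed

lemma Ch_pullback:
  assumes P: "subgroup P S" and Q: "subgroup Q S" and phi: "\<phi> \<in> F Q (carrier S)"
    and sub: "\<phi> ` Q \<subseteq> P" and rho: "\<rho> \<in> Ch P"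
  shows "restrict (\<lambda>x. \<rho> (\<phi> x)) Q \<in> Ch Q"
proof -
  obtain \<psi> where psi: "\<psi> \<in> F P (carrier S)" "\<rho> = restrict (\<lambda>x. lam (\<psi> x)) P"
    using rho by (auto simp: Ch_def)
  have "compose Q \<psi> \<phi> \<in> F Q (carrier S)" by (rule mor_compose[OF Q P phi psi(1) sub])
  moreover have "restrict (\<lambda>x. \<rho> (\<phi> x)) Q = restrict (\<lambda>x. lam (compose Q \<psi> \<phi> x)) Q"
    by (rule restrict_ext) (use psi(2) sub in \<open>auto simp: compose_def\<close>)
  ultimately show ?thesis unfolding Ch_def by blast
qed

lemma Ch_pushforward:
  assumes Q: "subgroup Q S" and phi: "\<phi> \<in> F Q (carrier S)" and rho: "\<rho> \<in> Ch Q"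
  shows "restrict (\<lambda>y. \<rho> (inv_into Q \<phi> y)) (\<phi> ` Q) \<in> Ch (\<phi> ` Q)"
proof -
  let ?i = "restrict (inv_into Q \<phi>) (\<phi> ` Q)"
  have "?i ` (\<phi> ` Q) \<subseteq> Q" by (auto simp: inv_into_into)
  then have "restrict (\<lambda>y. \<rho> (?i y)) (\<phi> ` Q) \<in> Ch (\<phi> ` Q)"
    using Ch_pullback[OF Q mor_image_subgroup[OF Q phi] mor_inverse[OF Q phi] _ rho] by blast
  moreover have "restrict (\<lambda>y. \<rho> (?i y)) (\<phi> ` Q) = restrict (\<lambda>y. \<rho> (inv_into Q \<phi> y)) (\<phi> ` Q)"
    by (rule restrict_ext) simp
  ultimately show ?thesis by simp
qed

lemma Ch_bij:
  assumes Q: "subgroup Q S" and phi: "\<phi> \<in> F Q (carrier S)"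
  shows "bij_betw (\<lambda>\<rho>. restrict (\<lambda>x. \<rho> (\<phi> x)) Q) (Ch (\<phi> ` Q)) (Ch Q)"
proof (rule bij_betwI[where g = "\<lambda>\<rho>. restrict (\<lambda>y. \<rho> (inv_into Q \<phi> y)) (\<phi> ` Q)"])
  have inj: "inv_into Q \<phi> (\<phi> x) = x" if "x \<in> Q" for x
    using mor_inj[OF Q subgroup_self phi] that by simp
  show "(\<lambda>\<rho>. restrict (\<lambda>x. \<rho> (\<phi> x)) Q) \<in> Ch (\<phi> ` Q) \<rightarrow> Ch Q"
    using Ch_pullback[OF mor_image_subgroup[OF Q phi] Q phi] by blast
  show "(\<lambda>\<rho>. restrict (\<lambda>y. \<rho> (inv_into Q \<phi> y)) (\<phi> ` Q)) \<in> Ch Q \<rightarrow> Ch (\<phi> ` Q)"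
    using Ch_pushforward[OF Q phi] by blast
  show "restrict (\<lambda>y. restrict (\<lambda>x. \<rho> (\<phi> x)) Q (inv_into Q \<phi> y)) (\<phi> ` Q) = \<rho>"
    if "\<rho> \<in> Ch (\<phi> ` Q)" for \<rho>
    by (rule extensionalityI[of _ "\<phi> ` Q"]) (use that Ch_ext inj in auto)
  show "restrict (\<lambda>x. restrict (\<lambda>y. \<rho> (inv_into Q \<phi> y)) (\<phi> ` Q) (\<phi> x)) Q = \<rho>"
    if "\<rho> \<in> Ch Q" for \<rho>
    by (rule extensionalityI[of _ Q]) (use that Ch_ext inj in auto)
qed

text \<open>On a fixed coset \<open>tP\<close> the action goes through \<chi> composed with
  conjugation by \<open>inv t\<close>, which is a morphism of the fusion system. Hence sums over
  \<open>Ch Q\<close> miss no fixed point.\<close>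

lemma Ch_weight:
  assumes P: "subgroup P S" and chi: "\<chi> \<in> Ch P" and Q: "subgroup Q S"
    and C: "C \<in> lcosets P" and fix_C: "\<And>q. q \<in> Q \<Longrightarrow> q <# C = C"
  shows "restrict (\<lambda>q. ind_weight S \<chi> q C) Q \<in> Ch Q"
proof -
  let ?t = "coset_rep C"
  have t: "?t \<in> carrier S" "?t <# P = C" using coset_rep[OF P C] by auto
  have mem: "inv ?t \<otimes> q \<otimes> ?t \<in> P" if "q \<in> Q" for q
    using lcoset_fixed_iff[OF P t(1), of q] t(2) fix_C[OF that] subgroup.mem_carrier[OF Q that] by simp
  have "conj_map S (inv ?t) Q \<in> F Q (carrier S)"
    using t subgroup.mem_carrier[OF Q] by (intro mor_conj[OF Q subgroup_self]) auto
  moreover have "conj_map S (inv ?t) Q ` Q \<subseteq> P" using mem t by (auto simp: conj_map_def)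
  ultimately have "restrict (\<lambda>q. \<chi> (conj_map S (inv ?t) Q q)) Q \<in> Ch Q"
    using Ch_pullback[OF P Q _ _ chi] by blast
  moreover have "restrict (\<lambda>q. \<chi> (conj_map S (inv ?t) Q q)) Q = restrict (\<lambda>q. ind_weight S \<chi> q C) Q"
    by (rule restrict_ext) (use fix_C t in \<open>simp add: ind_weight_fixed conj_map_def\<close>)
  ultimately show ?thesis by simp
qed

text \<open>The top of the descent: invariance under automorphisms of \<open>S\<close> leaves a
  single pair with the subgroup \<open>S\<close>.\<close>

lemma Ch_carrier: "Ch (carrier S) = {restrict lam (carrier S)}"
proof -
  have eq: "restrict (\<lambda>x. lam (\<psi> x)) (carrier S) = restrict lam (carrier S)"
    if "\<psi> \<in> F (carrier S) (carrier S)" for \<psi>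
    using lam_stable[OF that] by auto
  have id: "(\<lambda>x\<in>carrier S. x) \<in> F (carrier S) (carrier S)"
    using mor_incl[OF subgroup_self subgroup_self] by simp
  have "restrict lam (carrier S) \<in> Ch (carrier S)"
    unfolding Ch_def using eq[OF id, symmetric] id by blast
  then show ?thesis using eq by (auto simp: Ch_def)
qed

section \<open>Virtual monomial sets and their marks\<close>

definition pairs :: "('a set \<times> ('a \<Rightarrow> complex)) set" where
  "pairs = {(P, \<chi>). subgroup P S \<and> \<chi> \<in> Ch P}"

lemma finite_pairs: "finite pairs"
proof -
  have "pairs = (SIGMA P:{P. subgroup P S}. Ch P)" by (auto simp: pairs_def)
  moreover have "finite {P. subgroup P S}"
    by (rule finite_subset[of _ "Pow (carrier S)"]) (use finite_carrier subgroup.subset in auto)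
  ultimately show ?thesis using finite_Ch by (auto intro!: finite_SigmaI)
qed

lemma induced:
  "q \<in> pairs \<Longrightarrow> monomial_set S (lcosets (fst q)) (l_coset S) (ind_weight S (snd q))"
  using monomial_set_induced[OF finite_carrier] Ch_character by (auto simp: pairs_def)

lemma mark_eq_fixed:
  "q \<in> pairs \<Longrightarrow> mark S (fst q) (snd q) R \<rho> =
    card (monomial_set.fixed (lcosets (fst q)) (l_coset S) (ind_weight S (snd q)) R \<rho>)"
  using mark_eq_card_fixed[OF finite_carrier] Ch_character by (auto simp: pairs_def)

text \<open>
  A coefficient function \<open>c\<close> on \<open>pairs\<close> stands for the virtual monomial set
  \<open>\<Sum> c (P, \<chi>) Ind\<^sub>P \<chi>\<close>, whose marks are given by \<open>total c\<close>.
\<close>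

definition total :: "('a set \<times> ('a \<Rightarrow> complex) \<Rightarrow> int) \<Rightarrow> 'a set \<Rightarrow> ('a \<Rightarrow> complex) \<Rightarrow> int" where
  "total c R \<rho> = (\<Sum>q\<in>pairs. c q * int (mark S (fst q) (snd q) R \<rho>))"

text \<open>The virtual form of the summands in Burnside's lemma when a group acts on the points
  counted by \<open>total c R \<rho>\<close>.\<close>

definition fix_total ::
  "('a set \<times> ('a \<Rightarrow> complex) \<Rightarrow> int) \<Rightarrow> 'a set \<Rightarrow> ('a \<Rightarrow> complex) \<Rightarrow> 'a \<Rightarrow> int" where
  "fix_total c R \<rho> n = (\<Sum>q\<in>pairs. c q * int (card {C \<in> lcosets (fst q).
    (\<forall>r\<in>R. r <# C = C \<and> ind_weight S (snd q) r C = \<rho> r) \<and> n <# C = C}))"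

definition stable :: "('a set \<times> ('a \<Rightarrow> complex) \<Rightarrow> int) \<Rightarrow> 'a set \<Rightarrow> bool" where
  "stable c R \<longleftrightarrow> (\<forall>\<phi>\<in>F R (carrier S). \<forall>\<rho>\<in>Ch (\<phi> ` R).
    total c R (restrict (\<lambda>x. \<rho> (\<phi> x)) R) = total c (\<phi> ` R) \<rho>)"

lemma total_conj:
  assumes n: "n \<in> carrier S" and R: "R \<subseteq> carrier S"
    and R': "R' = (\<lambda>r. n \<otimes> r \<otimes> inv n) ` R" and rho: "\<And>r. r \<in> R \<Longrightarrow> \<rho>' (n \<otimes> r \<otimes> inv n) = \<rho> r"
  shows mark_conj: "q \<in> pairs \<Longrightarrow> mark S (fst q) (snd q) R' \<rho>' = mark S (fst q) (snd q) R \<rho>"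
    and "total c R' \<rho>' = total c R \<rho>"
proof -
  show *: "mark S (fst q) (snd q) R' \<rho>' = mark S (fst q) (snd q) R \<rho>" if "q \<in> pairs" for q
    unfolding mark_eq_fixed[OF that]
    by (rule monomial_set.card_fixed_conj[OF induced[OF that] n R R']) (rule rho)
  show "total c R' \<rho>' = total c R \<rho>"
    unfolding total_def by (rule sum.cong) (use * in auto)
qed

lemma fix_total_self:
  assumes "n \<in> R" shows "fix_total c R \<rho> n = total c R \<rho>"
proof -
  have "{C \<in> lcosets P. (\<forall>r\<in>R. r <# C = C \<and> ind_weight S \<chi> r C = \<rho> r) \<and> n <# C = C} =
      {C \<in> lcosets P. \<forall>r\<in>R. r <# C = C \<and> ind_weight S \<chi> r C = \<rho> r}" for P \<chi>
    using assms by blast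
  then show ?thesis by (simp add: fix_total_def total_def mark_def)
qed

lemma dvd_sum_fix_total:
  assumes N: "subgroup N S" and R: "R \<subseteq> carrier S"
    and norm: "\<And>n r. n \<in> N \<Longrightarrow> r \<in> R \<Longrightarrow> inv n \<otimes> r \<otimes> n \<in> R \<and> \<rho> (inv n \<otimes> r \<otimes> n) = \<rho> r"
  shows "int (card N) dvd (\<Sum>n\<in>N. fix_total c R \<rho> n)"
proof -
  have "(\<Sum>n\<in>N. fix_total c R \<rho> n) = (\<Sum>q\<in>pairs. c q * int (\<Sum>n\<in>N. card {C \<in> lcosets (fst q).
    (\<forall>r\<in>R. r <# C = C \<and> ind_weight S (snd q) r C = \<rho> r) \<and> n <# C = C}))"
    unfolding fix_total_def by (subst sum.swap) (simp add: sum_distrib_left)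
  moreover have "card N dvd (\<Sum>n\<in>N. card {C \<in> lcosets (fst q).
      (\<forall>r\<in>R. r <# C = C \<and> ind_weight S (snd q) r C = \<rho> r) \<and> n <# C = C})"
    if q: "q \<in> pairs" for q
    using monomial_set.dvd_sum_card_fixed[OF induced[OF q] N R norm]
    by (simp add: monomial_set.fixed_def[OF induced[OF q]] conj_assoc)
  ultimately show ?thesis
    by (auto intro!: dvd_sum dvd_mult simp: int_dvd_int_iff simp del: of_nat_sum)
qed

lemma sum_card_fixed_by_character:
  assumes Q: "subgroup Q S"
  shows "(\<Sum>q\<in>pairs. c q * int (card {C \<in> lcosets (fst q).
      (\<forall>x\<in>Q. x <# C = C) \<and> A (restrict (\<lambda>x. ind_weight S (snd q) x C) Q)})) =
    (\<Sum>\<rho>\<in>{\<rho> \<in> Ch Q. A \<rho>}. total c Q \<rho>)"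
proof -
  have "card {C \<in> lcosets (fst q). (\<forall>x\<in>Q. x <# C = C) \<and> A (restrict (\<lambda>x. ind_weight S (snd q) x C) Q)} =
      (\<Sum>\<rho>\<in>{\<rho> \<in> Ch Q. A \<rho>}. mark S (fst q) (snd q) Q \<rho>)" if q: "q \<in> pairs" for q
  proof -
    have P: "subgroup (fst q) S" "snd q \<in> Ch (fst q)" using q by (auto simp: pairs_def)
    show ?thesis
      using monomial_set.card_fixed_by_characters[OF induced[OF q], of Ch Q A, OF finite_Ch[OF Q] Ch_ext
          Ch_weight[OF P Q]] by (simp add: mark_eq_fixed[OF q])
  qed
  then have "(\<Sum>q\<in>pairs. c q * int (card {C \<in> lcosets (fst q).
      (\<forall>x\<in>Q. x <# C = C) \<and> A (restrict (\<lambda>x. ind_weight S (snd q) x C) Q)})) =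
      (\<Sum>q\<in>pairs. c q * int (\<Sum>\<rho>\<in>{\<rho> \<in> Ch Q. A \<rho>}. mark S (fst q) (snd q) Q \<rho>))"
    by (intro sum.cong) auto
  also have "\<dots> = (\<Sum>\<rho>\<in>{\<rho> \<in> Ch Q. A \<rho>}. total c Q \<rho>)"
    unfolding total_def by (subst sum.swap) (simp add: sum_distrib_left)
  finally show ?thesis .
qed

lemma generate_fixes_iff:
  assumes q: "q \<in> pairs" and C: "C \<in> lcosets (fst q)" and K: "K \<subseteq> carrier S"
  shows "(\<forall>x\<in>generate S K. x <# C = C) \<longleftrightarrow> (\<forall>x\<in>K. x <# C = C)"
proof
  assume "\<forall>x\<in>K. x <# C = C"
  then have "K \<subseteq> {g \<in> carrier S. g <# C = C}" using K by auto
  then have "generate S K \<subseteq> {g \<in> carrier S. g <# C = C}"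
    by (rule generate_subgroup_incl[OF _ monomial_set.subgroup_point_stabilizer[OF induced[OF q] C]])
  then show "\<forall>x\<in>generate S K. x <# C = C" by blast
qed (auto intro: generate.incl)

text \<open>A point fixed by \<open>R\<close> and \<open>n\<close> is fixed by the group they
  generate, which acts on its line through some extension of \<rho>. For \<open>n\<close> outside
  \<open>R\<close> this expresses a Burnside summand by marks of a strictly larger subgroup.\<close>

lemma fix_total_generate:
  assumes R: "subgroup R S" and n: "n \<in> carrier S" and Qdef: "Q = generate S (insert n R)"
  shows "fix_total c R \<rho> n = (\<Sum>\<rho>'\<in>{\<rho>' \<in> Ch Q. \<forall>r\<in>R. \<rho>' r = \<rho> r}. total c Q \<rho>')"
proof -
  have ins: "insert n R \<subseteq> carrier S" using n subgroup.subset[OF R] by blast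
  have Q: "subgroup Q S" unfolding Qdef by (rule generate_is_subgroup[OF ins])
  have RQ: "R \<subseteq> Q" unfolding Qdef by (auto intro: generate.incl)
  have "{C \<in> lcosets (fst q). (\<forall>r\<in>R. r <# C = C \<and> ind_weight S (snd q) r C = \<rho> r) \<and> n <# C = C} =
      {C \<in> lcosets (fst q). (\<forall>x\<in>Q. x <# C = C) \<and>
        (\<forall>r\<in>R. restrict (\<lambda>x. ind_weight S (snd q) x C) Q r = \<rho> r)}" if q: "q \<in> pairs" for q
  proof (rule Collect_cong)
    fix C
    have "(\<forall>r\<in>R. restrict (\<lambda>x. ind_weight S (snd q) x C) Q r = \<rho> r) \<longleftrightarrow> (\<forall>r\<in>R. ind_weight S (snd q) r C = \<rho> r)"
      by (rule ball_cong) (use RQ in auto)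
    then show "(C \<in> lcosets (fst q) \<and> (\<forall>r\<in>R. r <# C = C \<and> ind_weight S (snd q) r C = \<rho> r) \<and> n <# C = C) =
      (C \<in> lcosets (fst q) \<and> (\<forall>x\<in>Q. x <# C = C) \<and>
        (\<forall>r\<in>R. restrict (\<lambda>x. ind_weight S (snd q) x C) Q r = \<rho> r))"
      using generate_fixes_iff[OF q _ ins, of C] unfolding Qdef by blast
  qed
  then show ?thesis
    unfolding fix_total_def sum_card_fixed_by_character[OF Q, symmetric] by (intro sum.cong) auto
qed

lemma sum_Ch_transport:
  assumes Q: "subgroup Q S" and st: "stable c Q" and phi: "\<phi> \<in> F Q (carrier S)"
    and AB: "\<And>\<sigma>. A (restrict (\<lambda>x. \<sigma> (\<phi> x)) Q) \<longleftrightarrow> B \<sigma>"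
  shows "(\<Sum>\<sigma>\<in>{\<sigma> \<in> Ch (\<phi> ` Q). B \<sigma>}. total c (\<phi> ` Q) \<sigma>) = (\<Sum>\<sigma>\<in>{\<sigma> \<in> Ch Q. A \<sigma>}. total c Q \<sigma>)"
proof -
  let ?h = "\<lambda>\<sigma>. restrict (\<lambda>x. \<sigma> (\<phi> x)) Q"
  have bij: "bij_betw ?h (Ch (\<phi> ` Q)) (Ch Q)" by (rule Ch_bij[OF Q phi])
  have "bij_betw ?h {\<sigma> \<in> Ch (\<phi> ` Q). B \<sigma>} {\<sigma> \<in> Ch Q. A \<sigma>}"
    unfolding bij_betw_def
  proof
    show "inj_on ?h {\<sigma> \<in> Ch (\<phi> ` Q). B \<sigma>}"
      using bij by (rule inj_on_subset[OF bij_betw_imp_inj_on]) auto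
    show "?h ` {\<sigma> \<in> Ch (\<phi> ` Q). B \<sigma>} = {\<sigma> \<in> Ch Q. A \<sigma>}"
      unfolding bij_betw_imp_surj_on[OF bij, symmetric] using AB by blast
  qed
  then have "(\<Sum>\<sigma>\<in>{\<sigma> \<in> Ch (\<phi> ` Q). B \<sigma>}. total c Q (?h \<sigma>)) = (\<Sum>\<sigma>\<in>{\<sigma> \<in> Ch Q. A \<sigma>}. total c Q \<sigma>)"
    by (rule sum.reindex_bij_betw)
  moreover have "(\<Sum>\<sigma>\<in>{\<sigma> \<in> Ch (\<phi> ` Q). B \<sigma>}. total c Q (?h \<sigma>)) =
      (\<Sum>\<sigma>\<in>{\<sigma> \<in> Ch (\<phi> ` Q). B \<sigma>}. total c (\<phi> ` Q) \<sigma>)"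
    by (rule sum.cong) (use st phi in \<open>auto simp: stable_def\<close>)
  ultimately show ?thesis by simp
qed

lemma mor_image_generate:
  assumes N: "subgroup N S" and Phi: "\<Phi> \<in> F N (carrier S)" and K: "K \<subseteq> N"
  shows "\<Phi> ` generate S K = generate S (\<Phi> ` K)"
  using group_hom.generate_img[OF mor_group_hom[OF N Phi], of K] generate_consistent[OF K N] K by simp

text \<open>
  Burnside's lemma for the actions of \<open>N\<close> and \<open>\<Phi>(N)\<close> on the fixed points of \<open>(R, \<rho>)\<close> and \<open>(R\<^sub>0, \<rho>\<^sub>0)\<close>.
  For \<open>n\<close> outside \<open>R\<close>, the fixed points of \<open>n\<close> and of \<open>\<Phi> n\<close> are counted by marks of larger subgroups,
  where stability applies.
\<close>

lemma total_congruence: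
  assumes R: "subgroup R S" and rho: "\<rho> \<in> Ch R" and N: "N = char_normalizer S R \<rho>"
    and Phi: "\<Phi> \<in> F N (carrier S)" and R0: "R\<^sub>0 = \<Phi> ` R" and hom_rho: "\<And>x. x \<in> R \<Longrightarrow> \<rho>\<^sub>0 (\<Phi> x) = \<rho> x"
    and st: "\<And>Q. subgroup Q S \<Longrightarrow> card R < card Q \<Longrightarrow> stable c Q"
  shows "int (card N) dvd int (card R) * (total c R \<rho> - total c R\<^sub>0 \<rho>\<^sub>0)"
proof -
  have subN: "subgroup N S" unfolding N by (rule subgroup_char_normalizer[OF R])
  have RN: "R \<subseteq> N" unfolding N by (rule char_normalizer_contains[OF R Ch_character[OF R rho]])
  have Nc: "n \<in> carrier S" if "n \<in> N" for n using that subgroup.mem_carrier[OF subN] by blast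
  have Rc: "R \<subseteq> carrier S" by (rule subgroup.subset[OF R])
  have norm: "inv n \<otimes> r \<otimes> n \<in> R \<and> \<rho> (inv n \<otimes> r \<otimes> n) = \<rho> r" if "n \<in> N" "r \<in> R" for n r
    using char_normalizer_iff[OF finite_carrier R Nc[OF that(1)]] that N by blast
  have 1: "int (card N) dvd (\<Sum>n\<in>N. fix_total c R \<rho> n)"
    by (rule dvd_sum_fix_total[OF subN Rc norm])
  have PhiN: "subgroup (\<Phi> ` N) S" by (rule mor_image_subgroup[OF subN Phi])
  have subR0: "subgroup R\<^sub>0 S"
  proof -
    have "restrict \<Phi> R \<in> F R (carrier S)" by (rule mor_restrict[OF subN R subgroup_self RN Phi])
    then have "subgroup (restrict \<Phi> R ` R) S" by (rule mor_image_subgroup[OF R])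
    then show ?thesis using R0 by simp
  qed
  have inj: "inj_on \<Phi> N" by (rule mor_inj[OF subN subgroup_self Phi])
  have "int (card (\<Phi> ` N)) dvd (\<Sum>n\<in>\<Phi> ` N. fix_total c R\<^sub>0 \<rho>\<^sub>0 n)"
  proof (rule dvd_sum_fix_total[OF PhiN subgroup.subset[OF subR0]])
    fix n' r' assume "n' \<in> \<Phi> ` N" "r' \<in> R\<^sub>0"
    then obtain n r where n: "n \<in> N" "n' = \<Phi> n" and r: "r \<in> R" "r' = \<Phi> r" using R0 by blast
    have rN: "r \<in> N" using r RN by blast
    have "\<Phi> (inv n \<otimes> r \<otimes> n) = inv n' \<otimes> r' \<otimes> n'"
      using n r rN subgroup.m_inv_closed[OF subN] subgroup.m_closed[OF subN]
      by (simp add: mor_mult[OF subN subgroup_self Phi] mor_inv[OF subN Phi])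
    then show "inv n' \<otimes> r' \<otimes> n' \<in> R\<^sub>0 \<and> \<rho>\<^sub>0 (inv n' \<otimes> r' \<otimes> n') = \<rho>\<^sub>0 r'"
      using norm[OF n(1) r(1)] hom_rho[OF r(1)] hom_rho[of "inv n \<otimes> r \<otimes> n"] R0 r(2) by (metis imageI)
  qed
  then have 2: "int (card N) dvd (\<Sum>n\<in>N. fix_total c R\<^sub>0 \<rho>\<^sub>0 (\<Phi> n))"
    using inj by (simp add: card_image sum.reindex)
  have diff: "fix_total c R \<rho> n - fix_total c R\<^sub>0 \<rho>\<^sub>0 (\<Phi> n) =
      (if n \<in> R then total c R \<rho> - total c R\<^sub>0 \<rho>\<^sub>0 else 0)" if n: "n \<in> N" for n
  proof (cases "n \<in> R")
    case True
    then have "\<Phi> n \<in> R\<^sub>0" using R0 by blast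
    then show ?thesis using True fix_total_self by simp
  next
    case False
    define Q where "Q = generate S (insert n R)"
    have ins: "insert n R \<subseteq> N" using n RN by blast
    then have insc: "insert n R \<subseteq> carrier S" using Nc by blast
    have Q: "subgroup Q S" unfolding Q_def by (rule generate_is_subgroup[OF insc])
    have insQ: "insert n R \<subseteq> Q" unfolding Q_def by (auto intro: generate.incl)
    have QN: "Q \<subseteq> N" unfolding Q_def by (rule generate_subgroup_incl[OF ins subN])
    define \<phi> where "\<phi> = restrict \<Phi> Q"
    have phi: "\<phi> \<in> F Q (carrier S)" unfolding \<phi>_def by (rule mor_restrict[OF subN Q subgroup_self QN Phi])
    have "R \<subset> Q" using insQ False by blast
    then have less: "card R < card Q"
      using psubset_card_mono finite_subset_carrier[OF subgroup.subset[OF Q]] by blast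
    have img: "\<phi> ` Q = generate S (insert (\<Phi> n) R\<^sub>0)"
      using mor_image_generate[OF subN Phi ins] by (simp add: \<phi>_def R0 Q_def)
    have "fix_total c R\<^sub>0 \<rho>\<^sub>0 (\<Phi> n) =
        (\<Sum>\<sigma>\<in>{\<sigma> \<in> Ch (\<phi> ` Q). \<forall>r\<in>R\<^sub>0. \<sigma> r = \<rho>\<^sub>0 r}. total c (\<phi> ` Q) \<sigma>)"
      by (rule fix_total_generate[OF subR0 _ img]) (use mor_closed[OF subN subgroup_self Phi n] in simp)
    also have "\<dots> = (\<Sum>\<sigma>\<in>{\<sigma> \<in> Ch Q. \<forall>r\<in>R. \<sigma> r = \<rho> r}. total c Q \<sigma>)"
      by (rule sum_Ch_transport[OF Q st[OF Q less] phi]) (use insQ hom_rho in \<open>auto simp: R0 \<phi>_def subset_iff\<close>)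
    also have "\<dots> = fix_total c R \<rho> n"
      by (rule fix_total_generate[OF R Nc[OF n] Q_def, symmetric])
    finally show ?thesis using False by simp
  qed
  \<comment> \<open>In the difference of the two Burnside sums only the elements of \<open>R\<close>
    survive, each with the same contribution.\<close>
  have "(\<Sum>n\<in>N. fix_total c R \<rho> n) - (\<Sum>n\<in>N. fix_total c R\<^sub>0 \<rho>\<^sub>0 (\<Phi> n)) =
      (\<Sum>n\<in>N. if n \<in> R then total c R \<rho> - total c R\<^sub>0 \<rho>\<^sub>0 else 0)"
    unfolding sum_subtractf[symmetric] by (rule sum.cong) (use diff in auto)
  also have "\<dots> = int (card R) * (total c R \<rho> - total c R\<^sub>0 \<rho>\<^sub>0)"
    using finite_subset_carrier[OF subgroup.subset[OF subN]] RN
    by (simp add: sum.If_cases Int_absorb1 Int_commute)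
  finally show ?thesis using 1 2 by (metis dvd_diff)
qed

section \<open>Conjugacy of pairs in the fusion system and in S\<close>

definition fequiv :: "'a set \<times> ('a \<Rightarrow> complex) \<Rightarrow> 'a set \<times> ('a \<Rightarrow> complex) \<Rightarrow> bool" where
  "fequiv q q' \<longleftrightarrow> (\<exists>\<phi>\<in>F (fst q) (carrier S). \<phi> ` fst q = fst q' \<and> (\<forall>x\<in>fst q. snd q' (\<phi> x) = snd q x))"

text \<open>Pairs conjugate in \<open>S\<close> have the same marks under every combination, so a
  correction term is needed for only one member of each class.\<close>

definition sequiv :: "'a set \<times> ('a \<Rightarrow> complex) \<Rightarrow> 'a set \<times> ('a \<Rightarrow> complex) \<Rightarrow> bool" where
  "sequiv q q' \<longleftrightarrow> (\<exists>t\<in>carrier S. (\<lambda>r. t \<otimes> r \<otimes> inv t) ` fst q = fst q' \<and>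
    (\<forall>x\<in>fst q. snd q' (t \<otimes> x \<otimes> inv t) = snd q x))"

lemma fequiv_sym:
  assumes q: "q \<in> pairs" and eq: "fequiv q q'"
  shows "fequiv q' q"
proof -
  obtain \<phi> where phi: "\<phi> \<in> F (fst q) (carrier S)" "\<phi> ` fst q = fst q'"
    "\<And>x. x \<in> fst q \<Longrightarrow> snd q' (\<phi> x) = snd q x"
    using eq by (auto simp: fequiv_def)
  have R: "subgroup (fst q) S" using q by (auto simp: pairs_def)
  let ?i = "restrict (inv_into (fst q) \<phi>) (fst q')"
  have inj: "inv_into (fst q) \<phi> (\<phi> x) = x" if "x \<in> fst q" for x
    using mor_inj[OF R subgroup_self phi(1)] that by simp
  have "?i \<in> F (fst q') (carrier S)" using mor_inverse[OF R phi(1)] phi(2) by simp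
  moreover have "?i ` fst q' = fst q" unfolding phi(2)[symmetric] using inj by (force simp: image_iff)
  moreover have "snd q (?i y) = snd q' y" if "y \<in> fst q'" for y
    using that phi(3) inj unfolding phi(2)[symmetric] by auto
  ultimately show ?thesis unfolding fequiv_def by blast
qed

lemma fequiv_trans:
  assumes q: "q \<in> pairs" and q': "q' \<in> pairs" and eq: "fequiv q q'" and eq': "fequiv q' q''"
  shows "fequiv q q''"
proof -
  obtain \<phi> where phi: "\<phi> \<in> F (fst q) (carrier S)" "\<phi> ` fst q = fst q'"
    "\<And>x. x \<in> fst q \<Longrightarrow> snd q' (\<phi> x) = snd q x"
    using eq by (auto simp: fequiv_def)
  obtain \<psi> where psi: "\<psi> \<in> F (fst q') (carrier S)" "\<psi> ` fst q' = fst q''"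
    "\<And>x. x \<in> fst q' \<Longrightarrow> snd q'' (\<psi> x) = snd q' x"
    using eq' by (auto simp: fequiv_def)
  have R: "subgroup (fst q) S" "subgroup (fst q') S" using q q' by (auto simp: pairs_def)
  have "compose (fst q) \<psi> \<phi> \<in> F (fst q) (carrier S)"
    using mor_compose[OF R phi(1) psi(1)] phi(2) by simp
  moreover have "compose (fst q) \<psi> \<phi> ` fst q = fst q''"
    using phi(2) psi(2) by (simp add: image_compose_self)
  moreover have "snd q'' (compose (fst q) \<psi> \<phi> x) = snd q x" if "x \<in> fst q" for x
  proof -
    have "\<phi> x \<in> fst q'" using that phi(2) by blast
    then show ?thesis using that phi(3) psi(3) by (simp add: compose_def)
  qed
  ultimately show ?thesis unfolding fequiv_def by blast
qed

lemma sequiv_imp_fequiv: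
  assumes q: "q \<in> pairs" and eq: "sequiv q q'"
  shows "fequiv q q'"
proof -
  obtain t where t: "t \<in> carrier S" "(\<lambda>r. t \<otimes> r \<otimes> inv t) ` fst q = fst q'"
    "\<And>x. x \<in> fst q \<Longrightarrow> snd q' (t \<otimes> x \<otimes> inv t) = snd q x"
    using eq by (auto simp: sequiv_def)
  have R: "subgroup (fst q) S" using q by (auto simp: pairs_def)
  have "conj_map S t (fst q) \<in> F (fst q) (carrier S)"
    using t(1) subgroup.mem_carrier[OF R] by (intro mor_conj[OF R subgroup_self]) auto
  moreover have "conj_map S t (fst q) ` fst q = fst q'" using t(2) by (simp add: conj_map_def)
  moreover have "\<forall>x\<in>fst q. snd q' (conj_map S t (fst q) x) = snd q x"
    using t(3) by (simp add: conj_map_def)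
  ultimately show ?thesis unfolding fequiv_def by blast
qed

lemma sequiv_refl: "q \<in> pairs \<Longrightarrow> sequiv q q"
proof -
  assume "q \<in> pairs"
  then have c: "x \<in> carrier S" if "x \<in> fst q" for x
    using that subgroup.mem_carrier by (fastforce simp: pairs_def)
  have "(\<lambda>r. \<one> \<otimes> r \<otimes> inv \<one>) ` fst q = (\<lambda>r. r) ` fst q" by (rule image_cong) (use c in auto)
  then show ?thesis unfolding sequiv_def using c by (intro bexI[of _ \<one>]) auto
qed

lemma sequiv_sym:
  assumes q: "q \<in> pairs" and eq: "sequiv q q'"
  shows "sequiv q' q"
proof -
  obtain t where t: "t \<in> carrier S" "(\<lambda>r. t \<otimes> r \<otimes> inv t) ` fst q = fst q'"
    "\<And>x. x \<in> fst q \<Longrightarrow> snd q' (t \<otimes> x \<otimes> inv t) = snd q x"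
    using eq by (auto simp: sequiv_def)
  have c: "x \<in> carrier S" if "x \<in> fst q" for x
    using q that subgroup.mem_carrier by (fastforce simp: pairs_def)
  have undo: "inv t \<otimes> (t \<otimes> x \<otimes> inv t) \<otimes> inv (inv t) = x" if "x \<in> fst q" for x
    using that t(1) c by (simp add: m_assoc inv_mult_cancel)
  have "(\<lambda>r. inv t \<otimes> r \<otimes> inv (inv t)) ` fst q' = (\<lambda>r. r) ` fst q"
    unfolding t(2)[symmetric] image_image by (rule image_cong) (use undo in auto)
  moreover have "snd q (inv t \<otimes> y \<otimes> inv (inv t)) = snd q' y" if "y \<in> fst q'" for y
  proof -
    obtain x where x: "x \<in> fst q" "y = t \<otimes> x \<otimes> inv t" using \<open>y \<in> fst q'\<close> t(2) by blast
    then show ?thesis using undo[OF x(1)] t(3)[OF x(1)] by simp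
  qed
  ultimately show ?thesis unfolding sequiv_def using t(1) by (intro bexI[of _ "inv t"]) auto
qed

lemma sequiv_trans:
  assumes q: "q \<in> pairs" and eq: "sequiv q q'" and eq': "sequiv q' q''"
  shows "sequiv q q''"
proof -
  obtain t where t: "t \<in> carrier S" "(\<lambda>r. t \<otimes> r \<otimes> inv t) ` fst q = fst q'"
    "\<And>x. x \<in> fst q \<Longrightarrow> snd q' (t \<otimes> x \<otimes> inv t) = snd q x"
    using eq by (auto simp: sequiv_def)
  obtain s where s: "s \<in> carrier S" "(\<lambda>r. s \<otimes> r \<otimes> inv s) ` fst q' = fst q''"
    "\<And>x. x \<in> fst q' \<Longrightarrow> snd q'' (s \<otimes> x \<otimes> inv s) = snd q' x"
    using eq' by (auto simp: sequiv_def)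
  have c: "x \<in> carrier S" if "x \<in> fst q" for x
    using q that subgroup.mem_carrier by (fastforce simp: pairs_def)
  have e: "s \<otimes> t \<otimes> x \<otimes> inv (s \<otimes> t) = s \<otimes> (t \<otimes> x \<otimes> inv t) \<otimes> inv s" if "x \<in> fst q" for x
    using that t(1) s(1) c by (simp add: m_assoc inv_mult_group)
  have "(\<lambda>r. s \<otimes> t \<otimes> r \<otimes> inv (s \<otimes> t)) ` fst q = fst q''"
    unfolding s(2)[symmetric] t(2)[symmetric] image_image by (rule image_cong) (use e in auto)
  moreover have "snd q'' (s \<otimes> t \<otimes> x \<otimes> inv (s \<otimes> t)) = snd q x" if x: "x \<in> fst q" for x
  proof -
    have "t \<otimes> x \<otimes> inv t \<in> fst q'" using x t(2) by blast
    then show ?thesis using e[OF x] s(3) t(3)[OF x] by simp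
  qed
  ultimately show ?thesis unfolding sequiv_def using t(1) s(1) by (intro bexI[of _ "s \<otimes> t"]) auto
qed

lemma fequiv_card: "q \<in> pairs \<Longrightarrow> fequiv q q' \<Longrightarrow> card (fst q') = card (fst q)"
  unfolding fequiv_def pairs_def using mor_inj[OF _ subgroup_self] card_image by fastforce

lemma sequiv_total:
  assumes q: "q \<in> pairs" and eq: "sequiv q q'"
  shows "total c (fst q') (snd q') = total c (fst q) (snd q)"
    and "r \<in> pairs \<Longrightarrow> mark S (fst r) (snd r) (fst q') (snd q') = mark S (fst r) (snd r) (fst q) (snd q)"
proof -
  obtain t where t: "t \<in> carrier S" "(\<lambda>r. t \<otimes> r \<otimes> inv t) ` fst q = fst q'"
    "\<And>x. x \<in> fst q \<Longrightarrow> snd q' (t \<otimes> x \<otimes> inv t) = snd q x"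
    using eq by (auto simp: sequiv_def)
  have c: "fst q \<subseteq> carrier S" using q subgroup.subset[of "fst q" S] by (auto simp: pairs_def)
  show "total c (fst q') (snd q') = total c (fst q) (snd q)"
    by (rule total_conj(2)[OF t(1) c t(2)[symmetric]]) (rule t(3))
  show "r \<in> pairs \<Longrightarrow> mark S (fst r) (snd r) (fst q') (snd q') = mark S (fst r) (snd r) (fst q) (snd q)"
    by (rule mark_conj[OF t(1) c t(2)[symmetric]]) (rule t(3))
qed

text \<open>Among subgroups of one order the table of marks is diagonal up to conjugacy in
  \<open>S\<close>: conjugation into a subgroup of equal order is conjugation onto it.\<close>

lemma mark_nonzero_sequiv:
  assumes q: "(P, \<chi>) \<in> pairs" and q': "(R, \<rho>) \<in> pairs" and card: "card P = card R"
    and nz: "mark S P \<chi> R \<rho> \<noteq> 0"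
  shows "sequiv (R, \<rho>) (P, \<chi>)"
proof -
  have P: "subgroup P S" and R: "subgroup R S" using q q' by (auto simp: pairs_def)
  obtain t where t: "t \<in> carrier S" "\<And>r. r \<in> R \<Longrightarrow> inv t \<otimes> r \<otimes> t \<in> P \<and> \<chi> (inv t \<otimes> r \<otimes> t) = \<rho> r"
    using mark_pos_imp_conj[OF P subgroup.subset[OF R] nz] by blast
  have "(\<lambda>r. inv t \<otimes> r \<otimes> t) ` R = P"
  proof (rule card_subset_eq[OF finite_subset_carrier[OF subgroup.subset[OF P]]])
    show "(\<lambda>r. inv t \<otimes> r \<otimes> t) ` R \<subseteq> P" using t by blast
    show "card ((\<lambda>r. inv t \<otimes> r \<otimes> t) ` R) = card P"
      using card_conj_subset[OF t(1) subgroup.subset[OF R]] card by simp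
  qed
  then show ?thesis unfolding sequiv_def using t by (intro bexI[of _ "inv t"]) auto
qed

definition receptive :: "'a set \<times> ('a \<Rightarrow> complex) \<Rightarrow> bool" where
  "receptive q \<longleftrightarrow> q \<in> pairs \<and> (\<forall>q'\<in>pairs. fequiv q' q \<longrightarrow>
    (\<exists>\<Phi>\<in>F (char_normalizer S (fst q') (snd q')) (carrier S).
      \<Phi> ` fst q' = fst q \<and> (\<forall>x\<in>fst q'. snd q (\<Phi> x) = snd q' x)))"

text \<open>Transfers \<open>receptive_pair\<close> to members of \<open>pairs\<close>; the
  character obtained there is restricted to become extensional.\<close>

lemma receptive_exists:
  assumes q: "q \<in> pairs"
  shows "\<exists>q'. receptive q' \<and> fequiv q q'"
proof -
  have R: "subgroup (fst q) S" and rho: "snd q \<in> Ch (fst q)" using q by (auto simp: pairs_def)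
  show ?thesis
  proof (rule receptive_pair[OF R, where \<rho> = "snd q"])
    fix \<phi> R\<^sub>0 \<rho>\<^sub>0
    assume phi: "\<phi> \<in> F (fst q) (carrier S)" "\<phi> ` fst q = R\<^sub>0"
        "\<And>x. x \<in> fst q \<Longrightarrow> \<rho>\<^sub>0 (\<phi> x) = snd q x"
      and rec: "\<And>R' \<rho>' \<phi>'. subgroup R' S \<Longrightarrow> character S R' \<rho>' \<Longrightarrow> \<phi>' \<in> F R' (carrier S) \<Longrightarrow>
        \<phi>' ` R' = R\<^sub>0 \<Longrightarrow> (\<And>x. x \<in> R' \<Longrightarrow> \<rho>\<^sub>0 (\<phi>' x) = \<rho>' x) \<Longrightarrow>
        \<exists>\<Phi>\<in>F (char_normalizer S R' \<rho>') (carrier S). \<Phi> ` R' = R\<^sub>0 \<and> (\<forall>x\<in>R'. \<rho>\<^sub>0 (\<Phi> x) = \<rho>' x)"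
    let ?q = "(R\<^sub>0, restrict \<rho>\<^sub>0 R\<^sub>0)"
    have inj: "inv_into (fst q) \<phi> (\<phi> x) = x" if "x \<in> fst q" for x
      using mor_inj[OF R subgroup_self phi(1)] that by simp
    have "restrict \<rho>\<^sub>0 R\<^sub>0 = restrict (\<lambda>y. snd q (inv_into (fst q) \<phi> y)) (\<phi> ` fst q)"
      unfolding phi(2)[symmetric] by (rule restrict_ext) (use inj phi(3) in auto)
    then have "restrict \<rho>\<^sub>0 R\<^sub>0 \<in> Ch R\<^sub>0" using Ch_pushforward[OF R phi(1) rho] phi(2) by simp
    then have qp: "?q \<in> pairs" using mor_image_subgroup[OF R phi(1)] phi(2) by (simp add: pairs_def)
    have "fequiv q ?q" unfolding fequiv_def using phi by (intro bexI[of _ \<phi>]) auto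
    moreover have "receptive ?q"
      unfolding receptive_def
    proof (intro conjI qp ballI impI)
      fix q' assume q': "q' \<in> pairs" "fequiv q' ?q"
      then obtain \<phi>' where phi': "\<phi>' \<in> F (fst q') (carrier S)" "\<phi>' ` fst q' = R\<^sub>0"
          "\<forall>x\<in>fst q'. restrict \<rho>\<^sub>0 R\<^sub>0 (\<phi>' x) = snd q' x"
        by (auto simp: fequiv_def)
      have R': "subgroup (fst q') S" and chi: "character S (fst q') (snd q')"
        using q'(1) Ch_character by (auto simp: pairs_def)
      have "\<rho>\<^sub>0 (\<phi>' x) = snd q' x" if "x \<in> fst q'" for x
        using phi'(2,3) that by auto
      then obtain \<Phi> where Phi: "\<Phi>\<in>F (char_normalizer S (fst q') (snd q')) (carrier S)"
          "\<Phi> ` fst q' = R\<^sub>0" "\<forall>x\<in>fst q'. \<rho>\<^sub>0 (\<Phi> x) = snd q' x"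
        using rec[OF R' chi phi'(1,2)] by blast
      then show "\<exists>\<Phi>\<in>F (char_normalizer S (fst q') (snd q')) (carrier S). \<Phi> ` fst q' = fst ?q \<and>
          (\<forall>x\<in>fst q'. snd ?q (\<Phi> x) = snd q' x)"
        by (intro bexI[of _ \<Phi>]) auto
    qed
    ultimately show ?thesis by blast
  qed
qed

text \<open>Raise the mark of every pair of order \<open>k\<close> to the old mark of the receptive
  pair in its F-class, by adding multiples of induced sets of order \<open>k\<close>. They are
  invisible at larger subgroups, and at order \<open>k\<close> each is seen only by its own
  \<open>S\<close>-class.\<close>

lemma stabilize_step:
  assumes st: "\<And>Q. subgroup Q S \<Longrightarrow> k < card Q \<Longrightarrow> stable c Q"
  shows "\<exists>c'. (\<forall>q. card (fst q) \<noteq> k \<longrightarrow> c' q = c q) \<and>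
    (\<forall>Q. subgroup Q S \<longrightarrow> k \<le> card Q \<longrightarrow> stable c' Q)"
proof -
  define X\<^sub>k where "X\<^sub>k = {q \<in> pairs. card (fst q) = k}"
  \<comment> \<open>The choice depends only on the predicate, hence is literally the same for
    F-equivalent pairs; \<open>srep\<close> exploits the same effect for
    \<open>S\<close>-classes.\<close>
  define rep where "rep q = (SOME t. receptive t \<and> fequiv q t)" for q
  define e where "e q = total c (fst (rep q)) (snd (rep q)) - total c (fst q) (snd q)" for q
  define w where "w q = mark S (fst q) (snd q) (fst q) (snd q)" for q
  define srep where "srep q = (SOME q'. q' \<in> pairs \<and> sequiv q q')" for q
  \<comment> \<open>Only one pair of each \<open>S\<close>-class receives a coefficient, since its
    conjugates would correct the same marks again. The division is exact by \<open>dvd\<close>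
    below.\<close>
  define d where "d q = (if q \<in> X\<^sub>k \<and> srep q = q then e q div int (w q) else 0)" for q
  have rep: "receptive (rep q) \<and> fequiv q (rep q)" if "q \<in> pairs" for q
    unfolding rep_def by (rule someI_ex[OF receptive_exists[OF that]])
  have rep_eq: "rep q = rep q'" if q: "q \<in> pairs" "q' \<in> pairs" and eq: "fequiv q q'" for q q'
  proof -
    have "fequiv q t \<longleftrightarrow> fequiv q' t" for t
      using fequiv_trans[OF q eq] fequiv_trans[OF q(2,1) fequiv_sym[OF q(1) eq]] by blast
    then show ?thesis by (simp add: rep_def)
  qed
  have srep: "srep q \<in> pairs \<and> sequiv q (srep q)" if "q \<in> pairs" for q
    unfolding srep_def by (rule someI_ex) (use that sequiv_refl in blast)
  have srep_eq: "srep q = srep q'" if q: "q \<in> pairs" "q' \<in> pairs" and eq: "sequiv q q'" for q q'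
  proof -
    have "sequiv q t \<longleftrightarrow> sequiv q' t" for t
      using sequiv_trans[OF q(1) eq] sequiv_trans[OF q(2) sequiv_sym[OF q(1) eq]] by blast
    then show ?thesis by (simp add: srep_def)
  qed
  \<comment> \<open>The stabilizer of the pair has order \<open>card (fst q) * w q\<close>;
    cancelling \<open>card (fst q)\<close> in the Burnside congruence leaves the diagonal
    mark.\<close>
  have dvd: "int (w q) dvd e q" if q: "q \<in> X\<^sub>k" for q
  proof -
    have qp: "q \<in> pairs" and k: "card (fst q) = k" using q by (auto simp: X\<^sub>k_def)
    have R: "subgroup (fst q) S" and rho: "snd q \<in> Ch (fst q)" using qp by (auto simp: pairs_def)
    obtain \<Phi> where Phi: "\<Phi> \<in> F (char_normalizer S (fst q) (snd q)) (carrier S)"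
        "\<Phi> ` fst q = fst (rep q)" "\<And>x. x \<in> fst q \<Longrightarrow> snd (rep q) (\<Phi> x) = snd q x"
      using rep[OF qp] qp unfolding receptive_def by blast
    have "int (card (char_normalizer S (fst q) (snd q))) dvd int (card (fst q)) *
        (total c (fst q) (snd q) - total c (fst (rep q)) (snd (rep q)))"
      by (rule total_congruence[OF R rho refl Phi(1) Phi(2)[symmetric] Phi(3)]) (use st k in auto)
    moreover have "int (card (char_normalizer S (fst q) (snd q))) = int (card (fst q)) * int (w q)"
      using card_mult_mark_self[OF finite_carrier R Ch_character[OF R rho]] unfolding w_def
      by (metis of_nat_mult)
    moreover have "card (fst q) \<noteq> 0"
      using subgroup.one_closed[OF R] finite_subset_carrier[OF subgroup.subset[OF R]] by auto
    ultimately have "int (w q) dvd total c (fst q) (snd q) - total c (fst (rep q)) (snd (rep q))"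
      by simp
    then show ?thesis unfolding e_def by (metis dvd_minus_iff minus_diff_eq)
  qed
  have total_add: "total (\<lambda>q. c q + d q) R \<rho> = total c R \<rho> + total d R \<rho>" for R \<rho>
    by (simp add: total_def distrib_right sum.distrib)
  have big: "total d R \<rho> = 0" if R: "R \<subseteq> carrier S" "k < card R" for R \<rho>
    unfolding total_def
  proof (rule sum.neutral, rule ballI)
    fix q assume "q \<in> pairs"
    then have "subgroup (fst q) S" by (auto simp: pairs_def)
    then show "d q * int (mark S (fst q) (snd q) R \<rho>) = 0"
      using mark_smaller_eq_0[OF finite_carrier _ R(1), of "fst q" "snd q" \<rho>] R(2)
      by (auto simp: d_def X\<^sub>k_def)
  qed
  have level: "total (\<lambda>q. c q + d q) (fst q) (snd q) = total c (fst (rep q)) (snd (rep q))"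
    if q: "q \<in> X\<^sub>k" for q
  proof -
    have qp: "q \<in> pairs" and k: "card (fst q) = k" using q by (auto simp: X\<^sub>k_def)
    let ?s = "srep q"
    have s: "?s \<in> pairs" "sequiv q ?s" using srep[OF qp] by auto
    have fs: "fequiv q ?s" by (rule sequiv_imp_fequiv[OF qp s(2)])
    have sX: "?s \<in> X\<^sub>k" using s(1) fequiv_card[OF qp fs] k by (simp add: X\<^sub>k_def)
    have ss: "srep ?s = ?s" using srep_eq[OF qp s] by simp
    have ms: "mark S (fst ?s) (snd ?s) (fst q) (snd q) = w ?s"
      unfolding w_def by (rule sequiv_total(2)[OF qp s(2), symmetric]) (use s(1) in simp)
    \<comment> \<open>By diagonality only the chosen member of the \<open>S\<close>-class of
      \<open>q\<close> contributes, with the diagonal mark as factor.\<close>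
    have "total d (fst q) (snd q) = (\<Sum>q'\<in>{?s}. d q' * int (mark S (fst q') (snd q') (fst q) (snd q)))"
      unfolding total_def
    proof (rule sum.mono_neutral_right[OF finite_pairs])
      show "\<forall>q'\<in>pairs - {?s}. d q' * int (mark S (fst q') (snd q') (fst q) (snd q)) = 0"
      proof (rule ballI, rule ccontr)
        fix q' assume q': "q' \<in> pairs - {?s}"
          and nz: "d q' * int (mark S (fst q') (snd q') (fst q) (snd q)) \<noteq> 0"
        have "q' \<in> X\<^sub>k" "srep q' = q'" using nz by (auto simp: d_def split: if_splits)
        moreover have "sequiv q q'"
          using mark_nonzero_sequiv[of "fst q'" "snd q'" "fst q" "snd q"] nz q' qp k \<open>q' \<in> X\<^sub>k\<close>
          by (auto simp: X\<^sub>k_def)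
        ultimately show False using srep_eq[OF qp, of q'] q' by auto
      qed
    qed (use s in auto)
    also have "\<dots> = e ?s div int (w ?s) * int (w ?s)" using sX ss ms by (simp add: d_def)
    also have "\<dots> = e ?s" using dvd[OF sX] by simp
    also have "\<dots> = e q"
      using rep_eq[OF qp s(1) fs] sequiv_total(1)[OF qp s(2)] by (simp add: e_def)
    finally show ?thesis by (simp add: total_add e_def)
  qed
  have "stable (\<lambda>q. c q + d q) Q" if Q: "subgroup Q S" and kQ: "k \<le> card Q" for Q
    unfolding stable_def
  proof (intro ballI)
    fix \<phi> \<rho> assume phi: "\<phi> \<in> F Q (carrier S)" and rho: "\<rho> \<in> Ch (\<phi> ` Q)"
    have phiQ: "subgroup (\<phi> ` Q) S" by (rule mor_image_subgroup[OF Q phi])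
    have card: "card (\<phi> ` Q) = card Q" using mor_inj[OF Q subgroup_self phi] by (simp add: card_image)
    let ?q = "(Q, restrict (\<lambda>x. \<rho> (\<phi> x)) Q)" and ?q' = "(\<phi> ` Q, \<rho>)"
    have q: "?q \<in> pairs" "?q' \<in> pairs"
      using Q phiQ rho Ch_pullback[OF phiQ Q phi _ rho] by (auto simp: pairs_def)
    have fq: "fequiv ?q ?q'" unfolding fequiv_def using phi by (intro bexI[of _ \<phi>]) auto
    show "total (\<lambda>q. c q + d q) Q (restrict (\<lambda>x. \<rho> (\<phi> x)) Q) = total (\<lambda>q. c q + d q) (\<phi> ` Q) \<rho>"
    proof (cases "card Q = k")
      case True
      then have "?q \<in> X\<^sub>k" "?q' \<in> X\<^sub>k" using q card by (auto simp: X\<^sub>k_def)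
      then show ?thesis using level[of ?q] level[of ?q'] rep_eq[OF q fq] by simp
    next
      case False
      then have kl: "k < card Q" using kQ by simp
      then have "stable c Q" using st[OF Q] by blast
      then show ?thesis
        using phi rho kl card big[OF subgroup.subset[OF Q]] big[OF subgroup.subset[OF phiQ]]
        by (simp add: total_add stable_def)
    qed
  qed
  moreover have "c q + d q = c q" if "card (fst q) \<noteq> k" for q
    using that by (simp add: d_def X\<^sub>k_def)
  ultimately show ?thesis by (intro exI[of _ "\<lambda>q. c q + d q"]) blast
qed

lemma stable_combination_exists:
  "\<exists>c. c (carrier S, restrict lam (carrier S)) = 1 \<and> (\<forall>Q. subgroup Q S \<longrightarrow> stable c Q)"
proof -
  let ?top = "(carrier S, restrict lam (carrier S))"
  \<comment> \<open>\<open>j\<close> measures how far below the order of \<open>S\<close> stability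
    has been reached. It passes through all numbers; those that are not orders of subgroups impose
    no condition.\<close>
  have "\<exists>c. c ?top = 1 \<and> (\<forall>Q. subgroup Q S \<longrightarrow> card (carrier S) \<le> card Q + j \<longrightarrow> stable c Q)" for j
  proof (induction j)
    case 0
    \<comment> \<open>At \<open>S\<close> itself there is only one character, so any coefficients
      are stable there. The value 1 at \<open>?top\<close> survives because later steps alter only
      pairs of smaller order.\<close>
    have "stable (\<lambda>_. 1) Q" if Q: "subgroup Q S" "card (carrier S) \<le> card Q" for Q
    proof -
      have Qc: "Q = carrier S"
        using Q card_seteq[OF finite_carrier subgroup.subset[OF Q(1)]] by simp
      have "\<phi> ` carrier S = carrier S" if "\<phi> \<in> F (carrier S) (carrier S)" for \<phi>
        using mor_inj[OF subgroup_self subgroup_self that] mor_image[OF subgroup_self subgroup_self that]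
          finite_carrier endo_inj_surj by blast
      moreover have "restrict (\<lambda>x. restrict lam (carrier S) (\<phi> x)) (carrier S) = restrict lam (carrier S)"
        if phi: "\<phi> \<in> F (carrier S) (carrier S)" for \<phi>
        by (rule restrict_ext)
          (use lam_stable[OF phi] mor_closed[OF subgroup_self subgroup_self phi] in auto)
      ultimately show ?thesis unfolding stable_def Qc by (simp add: Ch_carrier)
    qed
    then show ?case by (intro exI[of _ "\<lambda>_. 1"]) simp
  next
    case (Suc j)
    then obtain c where c: "c ?top = 1"
      "\<And>Q. subgroup Q S \<Longrightarrow> card (carrier S) \<le> card Q + j \<Longrightarrow> stable c Q" by blast
    show ?case
    proof (cases "j < card (carrier S)")
      case True
      define k where "k = card (carrier S) - Suc j"
      have k: "card (carrier S) = k + Suc j" using True by (simp add: k_def)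
      obtain c' where c': "\<And>q. card (fst q) \<noteq> k \<Longrightarrow> c' q = c q"
          "\<And>Q. subgroup Q S \<Longrightarrow> k \<le> card Q \<Longrightarrow> stable c' Q"
        using stabilize_step[of k c] c(2) k by (metis Suc_le_eq add_Suc_right add_Suc add_le_mono1)
      show ?thesis
      proof (intro exI[of _ c'] conjI allI impI)
        show "c' ?top = 1" using c'(1)[of ?top] c(1) k by simp
        show "stable c' Q" if "subgroup Q S" "card (carrier S) \<le> card Q + Suc j" for Q
          using c'(2)[OF that(1)] that(2) k by simp
      qed
    next
      case False
      show ?thesis
      proof (intro exI[of _ c] conjI allI impI c(1))
        show "stable c Q" if "subgroup Q S" for Q using c(2)[OF that] False by simp
      qed
    qed
  qed
  from this[of "card (carrier S)"] show ?thesis by simp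
qed

subsection \<open>The transfer of a stable combination\<close>

definition ind_transfer :: "'a set \<Rightarrow> ('a \<Rightarrow> complex) \<Rightarrow> 'a \<Rightarrow> complex" where
  "ind_transfer P \<chi> g = (\<Prod>C\<in>lcosets P. ind_weight S \<chi> g C)"

definition exact_total ::
  "('a set \<times> ('a \<Rightarrow> complex) \<Rightarrow> int) \<Rightarrow> 'a \<Rightarrow> nat \<Rightarrow> complex \<Rightarrow> int" where
  "exact_total c g d a = (\<Sum>q\<in>pairs. c q *
    int (card (monomial_set.exact S (lcosets (fst q)) (l_coset S) (ind_weight S (snd q)) g d a)))"

definition element_total ::
  "('a set \<times> ('a \<Rightarrow> complex) \<Rightarrow> int) \<Rightarrow> 'a \<Rightarrow> complex \<Rightarrow> int" where
  "element_total c h a = (\<Sum>q\<in>pairs. c q *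
    int (card {C \<in> lcosets (fst q). h <# C = C \<and> ind_weight S (snd q) h C = a}))"

text \<open>Up to permutation signs, the determinant of the virtual monomial representation given by
  \<open>c\<close>; negative coefficients invert.\<close>

definition det_total :: "('a set \<times> ('a \<Rightarrow> complex) \<Rightarrow> int) \<Rightarrow> 'a \<Rightarrow> complex" where
  "det_total c g = (\<Prod>q\<in>pairs. ind_transfer (fst q) (snd q) g powi c q)"

lemma ind_transfer_eq: "q \<in> pairs \<Longrightarrow>
    ind_transfer (fst q) (snd q) = monomial_set.transfer (lcosets (fst q)) (ind_weight S (snd q))"
  using monomial_set.transfer_def[OF induced] by (simp add: ind_transfer_def fun_eq_iff)

text \<open>Fixing a line under \<open>h\<close> is the same as fixing it under the cyclic group of
  \<open>h\<close>. In this way stability, which concerns subgroups, reaches single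
  elements.\<close>

lemma element_total_eq:
  assumes h: "h \<in> carrier S" and Qdef: "Q = generate S {h}"
  shows "element_total c h a = (\<Sum>\<rho>\<in>{\<rho> \<in> Ch Q. \<rho> h = a}. total c Q \<rho>)"
proof -
  have Q: "subgroup Q S" unfolding Qdef by (rule generate_is_subgroup) (use h in simp)
  have hQ: "h \<in> Q" unfolding Qdef by (auto intro: generate.incl)
  have "{C \<in> lcosets (fst q). h <# C = C \<and> ind_weight S (snd q) h C = a} =
      {C \<in> lcosets (fst q). (\<forall>x\<in>Q. x <# C = C) \<and> restrict (\<lambda>x. ind_weight S (snd q) x C) Q h = a}"
    if q: "q \<in> pairs" for q
    using generate_fixes_iff[OF q, of _ "{h}"] h hQ unfolding Qdef[symmetric]
    by (intro Collect_cong) (auto simp only: restrict_apply' simp_thms singleton_iff)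
  then show ?thesis
    unfolding element_total_def sum_card_fixed_by_character[OF Q, of c "\<lambda>\<rho>. \<rho> h = a", symmetric]
    by (intro sum.cong) auto
qed

lemma element_total_stable:
  assumes st: "\<And>Q. subgroup Q S \<Longrightarrow> stable c Q"
    and P: "subgroup P S" and phi: "\<phi> \<in> F P (carrier S)" and h: "h \<in> P"
  shows "element_total c (\<phi> h) a = element_total c h a"
proof -
  define Q where "Q = generate S {h}"
  have hc: "h \<in> carrier S" by (rule subgroup.mem_carrier[OF P h])
  have Q: "subgroup Q S" unfolding Q_def by (rule generate_is_subgroup) (use hc in simp)
  have hQ: "h \<in> Q" unfolding Q_def by (auto intro: generate.incl)
  have QP: "Q \<subseteq> P" unfolding Q_def by (rule generate_subgroup_incl[OF _ P]) (use h in simp)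
  define \<psi> where "\<psi> = restrict \<phi> Q"
  have psi: "\<psi> \<in> F Q (carrier S)" unfolding \<psi>_def by (rule mor_restrict[OF P Q subgroup_self QP phi])
  have img: "\<psi> ` Q = generate S {\<phi> h}"
    using mor_image_generate[OF P phi, of "{h}"] h by (simp add: \<psi>_def Q_def)
  have "element_total c (\<phi> h) a = (\<Sum>\<sigma>\<in>{\<sigma> \<in> Ch (\<psi> ` Q). \<sigma> (\<phi> h) = a}. total c (\<psi> ` Q) \<sigma>)"
    by (rule element_total_eq[OF mor_closed[OF P subgroup_self phi h] img])
  also have "\<dots> = (\<Sum>\<sigma>\<in>{\<sigma> \<in> Ch Q. \<sigma> h = a}. total c Q \<sigma>)"
    by (rule sum_Ch_transport[OF Q st[OF Q] psi]) (use hQ in \<open>simp add: \<psi>_def\<close>)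
  also have "\<dots> = element_total c h a" by (rule element_total_eq[OF hc Q_def, symmetric])
  finally show ?thesis .
qed

lemma order_pos: "0 < order S"
  using finite_carrier by (simp add: order_gt_0_iff_finite)

lemma element_total_pow:
  assumes g: "g \<in> carrier S"
  shows "element_total c (g [^] e) a =
    (\<Sum>(d, b) \<in> {(d, b). d dvd e \<and> d dvd order S \<and> b ^ order S = 1 \<and> b ^ (e div d) = a}. exact_total c g d b)"
proof -
  let ?I = "{(d, b). d dvd e \<and> d dvd order S \<and> b ^ order S = 1 \<and> b ^ (e div d) = a}"
  let ?E = "\<lambda>q. monomial_set.exact S (lcosets (fst q)) (l_coset S) (ind_weight S (snd q)) g"
  have "element_total c (g [^] e) a = (\<Sum>q\<in>pairs. c q * int (\<Sum>i\<in>?I. card (?E q (fst i) (snd i))))"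
    unfolding element_total_def
    by (rule sum.cong)
      (use monomial_set.card_weight_eq_sum_exact[OF induced g] in \<open>auto simp: case_prod_unfold\<close>)
  also have "\<dots> = (\<Sum>i\<in>?I. exact_total c g (fst i) (snd i))"
    unfolding exact_total_def by (subst sum.swap) (simp add: sum_distrib_left)
  finally show ?thesis by (simp add: case_prod_unfold)
qed

lemma exact_total_outside:
  assumes g: "g \<in> carrier S" and "\<not> (d dvd order S \<and> a ^ order S = 1)"
  shows "exact_total c g d a = 0"
  unfolding exact_total_def
proof (rule sum.neutral, rule ballI)
  fix q assume q: "q \<in> pairs"
  interpret M: monomial_set S "lcosets (fst q)" "l_coset S" "ind_weight S (snd q)" by (rule induced[OF q])
  have "M.exact g d a = {}"
  proof (rule equals0I)
    fix x assume x: "x \<in> M.exact g d a"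
    then have xO: "x \<in> lcosets (fst q)" and d: "M.period g x = d" "ind_weight S (snd q) (g [^] d) x = a"
      by (auto simp: M.exact_def)
    have "a ^ order S = 1"
      using M.weight_root_of_unity[of "g [^] d" x] M.act_pow[OF g xO] M.funpow_period[OF g xO] g xO d
      by simp
    then show False using M.period_dvd_order[OF g xO] d assms(2) by simp
  qed
  then show "c q * int (card (M.exact g d a)) = 0" by simp
qed

text \<open>Fixed points of the power \<open>x [^] d\<close> comprise the points of period
  \<open>d\<close> and points of smaller period. As the former count is determined by the rest,
  induction on \<open>d\<close> carries stability from powers to cycle numbers.\<close>

lemma exact_total_stable:
  assumes st: "\<And>Q. subgroup Q S \<Longrightarrow> stable c Q"
    and P: "subgroup P S" and phi: "\<phi> \<in> F P (carrier S)" and x: "x \<in> P"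
  shows "exact_total c (\<phi> x) d a = exact_total c x d a"
proof (induction d arbitrary: a rule: less_induct)
  case (less d)
  have xc: "x \<in> carrier S" by (rule subgroup.mem_carrier[OF P x])
  have px: "\<phi> x \<in> carrier S" by (rule mor_closed[OF P subgroup_self phi x])
  show ?case
  proof (cases "d dvd order S \<and> a ^ order S = 1")
    case False
    then show ?thesis using exact_total_outside xc px by simp
  next
    case True
    then have d0: "0 < d" using order_pos by (auto intro!: Nat.gr0I)
    let ?I = "{(d', b). d' dvd d \<and> d' dvd order S \<and> b ^ order S = 1 \<and> b ^ (d div d') = a}"
    have fin: "finite ?I" using finite_divisor_roots[OF finite_carrier] by (rule finite_subset[rotated]) auto
    have mem: "(d, a) \<in> ?I" using True d0 by simp
    have split: "exact_total c g d a = element_total c (g [^] d) a -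
        (\<Sum>i \<in> ?I - {(d, a)}. exact_total c g (fst i) (snd i))" if "g \<in> carrier S" for g
      unfolding element_total_pow[OF that] case_prod_unfold
      using sum.remove[OF fin mem, of "\<lambda>i. exact_total c g (fst i) (snd i)"] by (simp add: case_prod_unfold)
    have "element_total c (\<phi> x [^] d) a = element_total c (x [^] d) a"
      using element_total_stable[OF st P phi subgroup_nat_pow_closed[OF P x], of d a] mor_pow[OF P phi x] by simp
    moreover have "exact_total c (\<phi> x) (fst i) (snd i) = exact_total c x (fst i) (snd i)"
      if i: "i \<in> ?I - {(d, a)}" for i
    proof (rule less.IH)
      have "fst i dvd d" "i \<noteq> (d, a)" "snd i ^ (d div fst i) = a" using i by auto
      \<comment> \<open>For period \<open>d\<close> the exponent \<open>d div d\<close> is 1, which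
        forces the root to be \<open>a\<close>; every other index has a strictly smaller
        period.\<close>
      moreover from this have "fst i \<noteq> d" using d0 by (cases i) auto
      ultimately show "fst i < d" using d0 by (meson dvd_imp_le le_neq_implies_less)
    qed
    ultimately show ?thesis unfolding split[OF xc] split[OF px] by simp
  qed
qed

text \<open>Each cycle number is an integer for every single induced set, so division by the cycle
  length commutes with the integer combination, whatever the signs of its coefficients.\<close>

lemma det_total_eq:
  assumes g: "g \<in> carrier S"
  shows "det_total c g =
    (\<Prod>i \<in> {(d, b). d dvd order S \<and> b ^ order S = 1}. snd i powi (exact_total c g (fst i) (snd i) div int (fst i)))"
proof -
  let ?J = "{(d, b::complex). d dvd order S \<and> b ^ order S = 1}"
  let ?E = "\<lambda>q i. card (monomial_set.exact S (lcosets (fst q)) (l_coset S) (ind_weight S (snd q)) g (fst i) (snd i))"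
  have nz: "b \<noteq> 0" if "b ^ order S = 1" for b :: complex
    using that order_pos by (metis power_eq_0_iff zero_neq_one)
  have "det_total c g = (\<Prod>q\<in>pairs. \<Prod>i\<in>?J. snd i powi (int (?E q i div fst i) * c q))"
    unfolding det_total_def
  proof (rule prod.cong[OF refl])
    fix q assume q: "q \<in> pairs"
    have "ind_transfer (fst q) (snd q) g = (\<Prod>i\<in>?J. snd i ^ (?E q i div fst i))"
      using monomial_set.transfer_eq_prod_exact[OF induced[OF q] g] ind_transfer_eq[OF q]
      by (simp add: case_prod_unfold)
    then show "ind_transfer (fst q) (snd q) g powi c q = (\<Prod>i\<in>?J. snd i powi (int (?E q i div fst i) * c q))"
      by (simp add: prod_powi power_int_mult)
  qed
  also have "\<dots> = (\<Prod>i\<in>?J. \<Prod>q\<in>pairs. snd i powi (int (?E q i div fst i) * c q))"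
    by (rule prod.swap)
  also have "\<dots> = (\<Prod>i\<in>?J. snd i powi (exact_total c g (fst i) (snd i) div int (fst i)))"
  proof (rule prod.cong[OF refl])
    fix i assume i: "i \<in> ?J"
    then have d0: "0 < fst i" using order_pos by (auto intro!: Nat.gr0I)
    have b0: "snd i \<noteq> 0" using i nz by auto
    have "int (?E q i) = int (fst i) * int (?E q i div fst i)" if q: "q \<in> pairs" for q
      using monomial_set.exact_prod[OF induced[OF q] g d0, of "snd i"]
      by (metis dvd_mult_div_cancel of_nat_mult)
    then have "exact_total c g (fst i) (snd i) = (\<Sum>q\<in>pairs. int (fst i) * (int (?E q i div fst i) * c q))"
      unfolding exact_total_def by (intro sum.cong) (auto simp: mult_ac)
    then have "exact_total c g (fst i) (snd i) div int (fst i) = (\<Sum>q\<in>pairs. int (?E q i div fst i) * c q)"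
      using d0 by (simp flip: sum_distrib_left)
    then show "(\<Prod>q\<in>pairs. snd i powi (int (?E q i div fst i) * c q)) =
        snd i powi (exact_total c g (fst i) (snd i) div int (fst i))"
      by (simp only: powi_sum[OF b0])
  qed
  finally show ?thesis .
qed

lemma det_total_stable:
  assumes st: "\<And>Q. subgroup Q S \<Longrightarrow> stable c Q"
    and P: "subgroup P S" and phi: "\<phi> \<in> F P (carrier S)" and x: "x \<in> P"
  shows "det_total c (\<phi> x) = det_total c x"
  unfolding det_total_eq[OF subgroup.mem_carrier[OF P x]] det_total_eq[OF mor_closed[OF P subgroup_self phi x]]
  by (simp add: exact_total_stable[OF st P phi x])

lemma character_det_total: "character S (carrier S) (det_total c)"
proof -
  have ch: "character S (carrier S) (ind_transfer (fst q) (snd q))" if q: "q \<in> pairs" for q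
    using monomial_set.character_transfer[OF induced[OF q]] ind_transfer_eq[OF q] by simp
  show ?thesis
    unfolding character_def
  proof (intro conjI ballI)
    fix x assume x: "x \<in> carrier S"
    then show "det_total c x \<noteq> 0"
      unfolding det_total_def using character_nonzero[OF ch x] finite_pairs by simp
    fix y assume y: "y \<in> carrier S"
    show "det_total c (x \<otimes> y) = det_total c x * det_total c y"
      unfolding det_total_def prod.distrib[symmetric]
      by (rule prod.cong) (use character_mult[OF ch x y] in \<open>auto simp: power_int_mult_distrib\<close>)
  qed
qed

lemma det_total_focal:
  assumes st: "\<And>Q. subgroup Q S \<Longrightarrow> stable c Q" and u: "u \<in> focal"
  shows "det_total c u = 1"
proof -
  note ch = character_det_total[of c]
  have "subgroup {x \<in> carrier S. det_total c x = 1} S"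
    by (rule subgroupI)
      (use character_one[OF ch subgroup_self] character_inv[OF ch subgroup_self] character_mult[OF ch] in auto)
  then have "focal \<subseteq> {x \<in> carrier S. det_total c x = 1}"
    unfolding focal_def
  proof (rule generate_subgroup_incl[rotated], clarify)
    fix u \<phi> P assume P: "subgroup P S" and u: "u \<in> P" and phi: "\<phi> \<in> F P (carrier S)"
    have uc: "u \<in> carrier S" by (rule subgroup.mem_carrier[OF P u])
    have pc: "\<phi> u \<in> carrier S" by (rule mor_closed[OF P subgroup_self phi u])
    have "det_total c (inv u \<otimes> \<phi> u) = inverse (det_total c u) * det_total c (\<phi> u)"
      using character_mult[OF ch] character_inv[OF ch subgroup_self uc] uc pc by simp
    also have "\<dots> = 1"
      using det_total_stable[OF st P phi u] character_nonzero[OF ch uc] by simp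
    finally show "inv u \<otimes> \<phi> u \<in> carrier S \<and> det_total c (inv u \<otimes> \<phi> u) = 1" using uc pc by simp
  qed
  then show ?thesis using u by blast
qed

lemma ind_transfer_carrier:
  assumes g: "g \<in> carrier S"
  shows "ind_transfer (carrier S) (restrict lam (carrier S)) g = lam g"
proof -
  have abs: "a <# carrier S = carrier S" if "a \<in> carrier S" for a
    using that coset_join3 subgroup_self by blast
  then have lc: "lcosets (carrier S) = {carrier S}" by (auto simp: LCOSETS_def)
  then have t: "coset_rep (carrier S) \<in> carrier S"
    using coset_rep_closed[OF subgroup_self] by blast
  show ?thesis
    using abs[OF g] t g character_mult[OF lam_char] character_inv[OF lam_char subgroup_self t]
      character_nonzero[OF lam_char t] by (simp add: ind_transfer_def lc ind_weight_def)
qed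

lemma nontrivial_transfer_exists:
  assumes u: "u \<in> focal" and lu: "lam u \<noteq> 1"
  shows "\<exists>P \<chi>. subgroup P S \<and> P \<noteq> carrier S \<and> \<chi> \<in> Ch P \<and> ind_transfer P \<chi> u \<noteq> 1"
proof (rule ccontr)
  assume none: "\<not> ?thesis"
  obtain c where c: "c (carrier S, restrict lam (carrier S)) = 1" "\<And>Q. subgroup Q S \<Longrightarrow> stable c Q"
    using stable_combination_exists by blast
  let ?top = "(carrier S, restrict lam (carrier S))"
  have uc: "u \<in> carrier S" using u subgroup.mem_carrier[OF subgroup_focal] by blast
  have top: "?top \<in> pairs" using Ch_carrier subgroup_self by (simp add: pairs_def)
  have "ind_transfer (fst q) (snd q) u = 1" if q: "q \<in> pairs - {?top}" for q
  proof -
    have "fst q \<noteq> carrier S" using q Ch_carrier by (cases q) (auto simp: pairs_def)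
    then show ?thesis using none q by (auto simp: pairs_def)
  qed
  then have "(\<Prod>q\<in>pairs - {?top}. ind_transfer (fst q) (snd q) u powi c q) = 1" by (intro prod.neutral) simp
  then have "det_total c u = lam u"
    unfolding det_total_def using prod.remove[OF finite_pairs top, of "\<lambda>q. ind_transfer (fst q) (snd q) u powi c q"] ind_transfer_carrier[OF uc] c(1) by simp
  then show False using det_total_focal[OF c(2) u] lu by simp
qed

end

subsection \<open>Quotients of order p and the wreath product\<close>

text \<open>A largest proper subgroup \<open>Q\<close> above \<open>P\<close> is normal with abelian
  quotient, so an element outside it is separated by a character. Maximality is used in the form
  \<open>top\<close>: any subgroup containing \<open>Q\<close> and one more element is
  everything.\<close>

lemma (in group) proper_subgroup_character:
  assumes p: "Factorial_Ring.prime (p::nat)" and ord: "order G = p ^ n" and fin: "finite (carrier G)"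
    and P: "subgroup P G" and proper: "P \<noteq> carrier G"
  shows "\<exists>\<chi>. character G (carrier G) \<chi> \<and> (\<forall>x\<in>P. \<chi> x = 1) \<and> (\<exists>x\<in>carrier G. \<chi> x \<noteq> 1)"
proof -
  let ?M = "\<lambda>Q. subgroup Q G \<and> Q \<noteq> carrier G \<and> P \<subseteq> Q"
  have "\<exists>Q. ?M Q \<and> (\<forall>Q'. ?M Q' \<longrightarrow> card Q' \<le> card Q)"
    by (rule ex_has_greatest_nat[where b = "Suc (card (carrier G))" and k = P])
      (use P proper card_mono[OF fin] subgroup.subset in \<open>auto simp: less_Suc_eq_le\<close>)
  then obtain Q where Q: "subgroup Q G" "Q \<noteq> carrier G" "P \<subseteq> Q"
    and max: "\<And>Q'. ?M Q' \<Longrightarrow> card Q' \<le> card Q" by blast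
  interpret Q: subgroup Q G by fact
  have finQ: "finite Q" using fin Q.subset finite_subset by blast
  have top: "H = carrier G" if H: "subgroup H G" "Q \<subseteq> H" "a \<in> H" "a \<notin> Q" for H a
  proof (rule ccontr)
    assume "H \<noteq> carrier G"
    then have "card H \<le> card Q" using max[of H] H Q(3) by blast
    moreover have "finite H" using fin subgroup.subset[OF H(1)] finite_subset by blast
    ultimately show False using H card_seteq[of H Q] by blast
  qed
  obtain k where k: "card Q = p ^ k"
    using lagrange[OF Q(1)] ord p by (metis divides_primepow_nat dvd_triv_right)
  have lag: "card (lcosets Q) * card Q = p ^ n" using l_lagrange[OF fin Q(1)] ord by simp
  have "card (lcosets Q) dvd p ^ n" using lag by (metis dvd_triv_left)
  then obtain j where j: "card (lcosets Q) = p ^ j" using p by (auto simp: divides_primepow_nat)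
  have "card Q \<noteq> p ^ n"
    using Q(2) card_subset_eq[OF fin Q.subset] ord by (auto simp: order_def)
  then have "j \<noteq> 0" using lag j by (metis mult_1 power_0)
  then have pdvd: "p dvd card (lcosets Q)" using j by simp
  have Qmem: "Q \<in> lcosets Q"
    using lcos_mult_one[OF Q.subset] one_closed unfolding LCOSETS_def by blast
  have finL: "finite (lcosets Q)"
    using finite_subset[OF lcosets_subset_PowG[OF Q(1)]] fin by simp
  have cpos: "card (lcosets Q) > 0" using finL Qmem by (auto simp: card_gt_0_iff)
  \<comment> \<open>\<open>Q\<close> fixes itself as a coset, and the remaining number is -1 modulo
    p. A second fixed coset provides an element of the normalizer outside \<open>Q\<close>.\<close>
  have "\<not> p dvd card (lcosets Q - {Q})"
  proof
    assume "p dvd card (lcosets Q - {Q})"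
    then have "p dvd card (lcosets Q) - 1" using Qmem by simp
    then have "p dvd 1" using pdvd cpos by (metis One_nat_def Suc_leI dvd_diffD1)
    then show False using p by (simp add: not_prime_1)
  qed
  then have "\<exists>C\<in>lcosets Q - {Q}. \<forall>g\<in>carrier (G\<lparr>carrier := Q\<rparr>). g <# C = C"
  proof (rule p_group_fixed_point[OF Q.subgroup_is_group[OF is_group] p, rotated])
    show "order (G\<lparr>carrier := Q\<rparr>) = p ^ k" using k by (simp add: order_def)
    show "g <# C \<in> lcosets Q - {Q}" if gC: "g \<in> carrier (G\<lparr>carrier := Q\<rparr>)" "C \<in> lcosets Q - {Q}" for g C
    proof -
      have g: "g \<in> Q" using gC by simp
      have Cc: "C \<subseteq> carrier G" using gC Q.lcosets_carrier[OF is_group] by blast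
      have "g <# C \<noteq> Q"
      proof
        assume "g <# C = Q"
        then have "inv g <# (g <# C) = Q"
          using coset_join3[OF _ Q(1), of "inv g"] g by simp
        moreover have "inv g <# (g <# C) = C"
          using lcos_m_assoc[OF Cc, of "inv g" g] g lcos_mult_one[OF Cc] by simp
        ultimately show False using gC by simp
      qed
      then show ?thesis using lcosets_act(1)[OF Q(1), of C g] gC g by simp
    qed
    show "\<one>\<^bsub>G\<lparr>carrier := Q\<rparr>\<^esub> <# C = C" if "C \<in> lcosets Q - {Q}" for C
      using that lcos_mult_one Q.lcosets_carrier[OF is_group] by simp
    show "g \<otimes>\<^bsub>G\<lparr>carrier := Q\<rparr>\<^esub> h <# C = g <# (h <# C)"
      if "g \<in> carrier (G\<lparr>carrier := Q\<rparr>)" "h \<in> carrier (G\<lparr>carrier := Q\<rparr>)" "C \<in> lcosets Q - {Q}" for g h C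
      using that lcos_m_assoc[of C g h] Q.lcosets_carrier[OF is_group, of C] by simp
  qed
  then obtain C where C: "C \<in> lcosets Q" "C \<noteq> Q" "\<And>g. g \<in> Q \<Longrightarrow> g <# C = C" by auto
  let ?a = "coset_rep C"
  have a: "?a \<in> carrier G" "?a <# Q = C" using coset_rep[OF Q(1) C(1)] by auto
  have aQ: "?a \<notin> Q" using coset_join3[OF a(1) Q(1)] a(2) C(2) by auto
  have ainv: "inv ?a \<otimes> q \<otimes> ?a \<in> Q" if "q \<in> Q" for q
    using lcoset_fixed_iff[OF Q(1) a(1), of q] a(2) C(3)[OF that] that by simp
  have im: "(\<lambda>q. inv ?a \<otimes> q \<otimes> ?a) ` Q = Q"
    by (rule card_subset_eq[OF finQ]) (use ainv card_conj_subset[OF a(1) Q.subset] in auto)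
  have "inv ?a \<in> normalizer G Q"
    using im a(1) mem_normalizer_iff[OF Q.subset] by simp
  moreover have "inv ?a \<notin> Q" using aQ a(1) Q.m_inv_closed[of "inv ?a"] by auto
  moreover have "Q \<subseteq> normalizer G Q"
  proof
    fix q assume q: "q \<in> Q"
    have "(\<lambda>x. q \<otimes> x \<otimes> inv q) ` Q = Q"
    proof (rule card_subset_eq[OF finQ])
      show "(\<lambda>x. q \<otimes> x \<otimes> inv q) ` Q \<subseteq> Q" using q by auto
      show "card ((\<lambda>x. q \<otimes> x \<otimes> inv q) ` Q) = card Q"
        using card_conj_subset[of "inv q" Q] q Q.subset by simp
    qed
    then show "q \<in> normalizer G Q" using q mem_normalizer_iff[OF Q.subset] by simp
  qed
  ultimately have "normalizer G Q = carrier G"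
    using top[OF normalizer_imp_subgroup[OF Q.subset]] by blast
  then have norm: "g \<otimes> q \<otimes> inv g \<in> Q" if "g \<in> carrier G" "q \<in> Q" for g q
    using that mem_normalizer_iff[OF Q.subset, of g] by blast
  have comm: "x \<otimes> z \<otimes> inv x \<otimes> inv z \<in> Q" if x: "x \<in> carrier G" and z: "z \<in> carrier G" for x z
  proof -
    \<comment> \<open>The elements commuting with \<open>z\<close> modulo \<open>Q\<close>. They
      form a subgroup containing \<open>Q\<close> and \<open>z\<close>, so for \<open>z\<close>
      outside \<open>Q\<close> it is the whole group.\<close>
    let ?Z = "{y \<in> carrier G. y \<otimes> z \<otimes> inv y \<otimes> inv z \<in> Q}"
    have Qz: "Q \<subseteq> ?Z"
    proof
      fix q assume q: "q \<in> Q"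
      have "q \<otimes> (z \<otimes> inv q \<otimes> inv z) \<in> Q" using q norm[OF z, of "inv q"] by simp
      then show "q \<in> ?Z" using q z by (simp add: m_assoc)
    qed
    show ?thesis
    proof (cases "z \<in> Q")
      case True
      then show ?thesis using norm[OF x] by simp
    next
      case False
      have "subgroup ?Z G"
      proof (rule subgroupI)
        show "?Z \<noteq> {}" using Qz Q.one_closed by blast
        show "inv y \<in> ?Z" if y: "y \<in> ?Z" for y
        proof -
          have "inv y \<otimes> inv (y \<otimes> z \<otimes> inv y \<otimes> inv z) \<otimes> inv (inv y) \<in> Q"
            using y norm[of "inv y"] by simp
          moreover have "inv y \<otimes> inv (y \<otimes> z \<otimes> inv y \<otimes> inv z) \<otimes> inv (inv y) = inv y \<otimes> z \<otimes> inv (inv y) \<otimes> inv z"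
            using y z by (simp add: inv_mult_group m_assoc inv_mult_cancel)
          ultimately show ?thesis using y by simp
        qed
        show "y \<otimes> y' \<in> ?Z" if yy: "y \<in> ?Z" "y' \<in> ?Z" for y y'
        proof -
          have "y \<otimes> (y' \<otimes> z \<otimes> inv y' \<otimes> inv z) \<otimes> inv y \<otimes> (y \<otimes> z \<otimes> inv y \<otimes> inv z) \<in> Q"
            using yy norm[of y] by simp
          moreover have "y \<otimes> (y' \<otimes> z \<otimes> inv y' \<otimes> inv z) \<otimes> inv y \<otimes> (y \<otimes> z \<otimes> inv y \<otimes> inv z) =
              y \<otimes> y' \<otimes> z \<otimes> inv (y \<otimes> y') \<otimes> inv z"
            using yy z by (simp add: inv_mult_group m_assoc inv_mult_cancel)
          ultimately show ?thesis using yy by simp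
        qed
      qed auto
      moreover have "z \<in> ?Z" using z by (simp add: m_assoc)
      ultimately have "?Z = carrier G" using top[of ?Z z] Qz False by blast
      then show ?thesis using x by blast
    qed
  qed
  obtain g where g: "g \<in> carrier G" "g \<notin> Q" using Q(2) Q.subset by blast
  obtain \<chi> where "character G (carrier G) \<chi>" "\<forall>x\<in>Q. \<chi> x = 1" "\<chi> g \<noteq> 1"
    using exists_separating_character[OF fin Q(1) g comm] by blast
  then show ?thesis using Q(3) g(1) by blast
qed

text \<open>Raise the character to the last power \<open>p ^ i\<close> that is still nontrivial on
  \<open>A\<close>. The kernel only grows, so whatever the character killed stays killed.\<close>

lemma (in group) character_power_reduce:
  assumes p: "Factorial_Ring.prime (p::nat)" and ord: "order G = p ^ n" and fin: "finite (carrier G)"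
    and chi: "character G (carrier G) \<chi>" and A: "A \<subseteq> carrier G" and k: "k \<in> A" "\<chi> k \<noteq> 1"
  shows "\<exists>\<chi>'. character G (carrier G) \<chi>' \<and> (\<forall>x\<in>A. \<chi>' x ^ p = 1) \<and> (\<exists>x\<in>A. \<chi>' x \<noteq> 1) \<and>
    (\<forall>x\<in>carrier G. \<chi> x = 1 \<longrightarrow> \<chi>' x = 1)"
proof -
  let ?T = "\<lambda>j. \<forall>x\<in>A. \<chi> x ^ (p ^ j) = 1"
  have "\<chi> x ^ (p ^ n) = 1" if "x \<in> carrier G" for x
    using character_pow[OF chi subgroup_self that, of "p ^ n"] pow_order_eq_1[OF that] ord
      character_one[OF chi subgroup_self] by simp
  then have "?T n" using A by blast
  then obtain j where j: "?T j" "\<And>i. i < j \<Longrightarrow> \<not> ?T i" using exists_least_iff[of ?T] by blast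
  have "j \<noteq> 0"
  proof
    assume "j = 0"
    then show False using j(1) k by simp
  qed
  then obtain i where i: "j = Suc i" by (cases j) auto
  have "\<not> ?T i" using j(2) i by simp
  moreover have "character G (carrier G) (\<lambda>x. \<chi> x ^ (p ^ i))"
    using character_nonzero[OF chi] character_mult[OF chi] by (auto simp: character_def power_mult_distrib)
  moreover have "\<forall>x\<in>A. (\<chi> x ^ (p ^ i)) ^ p = 1"
    using j(1) i by (simp add: power_mult[symmetric] mult.commute)
  ultimately show ?thesis by (intro exI[of _ "\<lambda>x. \<chi> x ^ (p ^ i)"]) auto
qed

section \<open>Ideals of the group algebra of a cyclic group of order p\<close>

definition nabla :: "(int \<Rightarrow> int) \<Rightarrow> int \<Rightarrow> int" where
  "nabla v = (\<lambda>i. v i - v (i - 1))"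

text \<open>\<open>nabla\<close> is \<open>1 - T\<close> for the shift \<open>T\<close>, so this is
  the binomial theorem for its powers.\<close>

lemma nabla_binomial:
  "(nabla ^^ n) v i = (\<Sum>k\<le>n. (-1) ^ k * int (n choose k) * v (i - int k))"
proof (induction n arbitrary: i)
  case (Suc n)
  have "(nabla ^^ Suc n) v i = (nabla ^^ n) v i - (nabla ^^ n) v (i - 1)" by (simp add: nabla_def)
  also have "\<dots> = (\<Sum>k\<le>n. (-1) ^ k * int (n choose k) * v (i - int k)) +
      (\<Sum>k\<le>n. (-1) ^ Suc k * int (n choose k) * v (i - int (Suc k)))"
  proof -
    have "(\<Sum>k\<le>n. (-1) ^ Suc k * int (n choose k) * v (i - int (Suc k))) =
        - (\<Sum>k\<le>n. (-1) ^ k * int (n choose k) * v (i - 1 - int k))"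
      unfolding sum_negf[symmetric] by (rule sum.cong) (auto simp: algebra_simps)
    then show ?thesis unfolding Suc.IH by simp
  qed
  also have "(\<Sum>k\<le>n. (-1) ^ k * int (n choose k) * v (i - int k)) =
      v i + (\<Sum>k\<le>n. (-1) ^ Suc k * int (n choose Suc k) * v (i - int (Suc k)))"
  proof -
    have "(\<Sum>k\<le>n. (-1) ^ k * int (n choose k) * v (i - int k)) =
        (\<Sum>k\<le>Suc n. (-1) ^ k * int (n choose k) * v (i - int k))" by simp
    also have "\<dots> = v i + (\<Sum>k\<le>n. (-1) ^ Suc k * int (n choose Suc k) * v (i - int (Suc k)))"
      by (subst sum.atMost_Suc_shift) simp
    finally show ?thesis .
  qed
  also have "v i + (\<Sum>k\<le>n. (-1) ^ Suc k * int (n choose Suc k) * v (i - int (Suc k))) +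
      (\<Sum>k\<le>n. (-1) ^ Suc k * int (n choose k) * v (i - int (Suc k))) =
      v i + (\<Sum>k\<le>n. (-1) ^ Suc k * int (Suc n choose Suc k) * v (i - int (Suc k)))"
    unfolding add.assoc sum.distrib[symmetric] by (simp add: algebra_simps)
  also have "\<dots> = (\<Sum>k\<le>Suc n. (-1) ^ k * int (Suc n choose k) * v (i - int k))"
    by (subst sum.atMost_Suc_shift) simp
  finally show ?case .
qed simp

lemma nabla_diff: "(nabla ^^ n) (\<lambda>i. v i - w i) = (\<lambda>i. (nabla ^^ n) v i - (nabla ^^ n) w i)"
  by (induction n) (auto simp: nabla_def fun_eq_iff)

lemma nabla_scale: "(nabla ^^ n) (\<lambda>i. m * v i) = (\<lambda>i. m * (nabla ^^ n) v i)"
  by (induction n) (auto simp: nabla_def fun_eq_iff algebra_simps)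

text \<open>Neighbouring coefficients of order \<open>p - 1\<close> add up to a binomial coefficient
  of order p, which vanishes modulo p. Thus \<open>(1 - T) ^ (p - 1)\<close> is the sum of all
  powers of \<open>T\<close> below p.\<close>

lemma choose_prime_minus_one:
  assumes p: "Factorial_Ring.prime (p::nat)" and k: "k \<le> p - 1"
  shows "[(-1) ^ k * int ((p - 1) choose k) = 1] (mod int p)"
  using k
proof (induction k)
  case (Suc k)
  have pp: "p = Suc (p - 1)" using prime_gt_0_nat[OF p] by simp
  have "p dvd (p choose Suc k)" using Suc.prems p by (intro dvd_choose_prime) auto
  moreover have "p choose Suc k = ((p - 1) choose k) + ((p - 1) choose Suc k)"
    by (subst pp) (simp only: binomial_Suc_Suc)
  ultimately have "int p dvd int ((p - 1) choose k) + int ((p - 1) choose Suc k)"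
    by (metis int_dvd_int_iff of_nat_add)
  then have "int p dvd (-1) ^ k * (int ((p - 1) choose k) + int ((p - 1) choose Suc k))" by simp
  then have "[(-1) ^ k * int ((p - 1) choose k) = (-1) ^ Suc k * int ((p - 1) choose Suc k)] (mod int p)"
    by (simp add: cong_iff_dvd_diff algebra_simps)
  then show ?case using Suc by (metis Suc_leD cong_sym cong_trans)
qed simp

text \<open>
  \<open>V\<close> is an ideal of \<open>F\<^sub>p[C\<^sub>p]\<close>. Since \<open>\<nabla>\<^sup>p = 0\<close> and \<open>\<nabla>\<^sup>p\<^sup>-\<^sup>1 v\<^sub>0\<close> is the nonzero constant \<open>\<Sum> v\<^sub>0\<close>, every
  \<open>w\<close> is reduced to \<open>0\<close> by subtracting multiples of the \<open>\<nabla>\<^sup>k v\<^sub>0\<close>.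
\<close>

lemma cyclic_shift_span:
  assumes p: "Factorial_Ring.prime (p::nat)"
    and per: "\<And>v i. v \<in> V \<Longrightarrow> [v (i + int p) = v i] (mod int p)"
    and add: "\<And>v w. v \<in> V \<Longrightarrow> w \<in> V \<Longrightarrow> (\<lambda>i. v i + w i) \<in> V"
    and shift: "\<And>v. v \<in> V \<Longrightarrow> (\<lambda>i. v (i - 1)) \<in> V"
    and cong: "\<And>v w. v \<in> V \<Longrightarrow> (\<And>i. [w i = v i] (mod int p)) \<Longrightarrow> w \<in> V"
    and v0: "v\<^sub>0 \<in> V" "\<not> int p dvd (\<Sum>i<p. v\<^sub>0 (int i))"
    and w: "\<And>i. [w (i + int p) = w i] (mod int p)"
  shows "w \<in> V"
proof -
  have p0: "p > 0" using prime_gt_0_nat[OF p] .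
  have scale_nat: "(\<lambda>i. int (Suc m) * v i) \<in> V" if "v \<in> V" for v m
  proof (induction m)
    case (Suc m)
    from add[OF that this] show ?case by (simp add: algebra_simps)
  qed (use that in simp)
  have scale: "(\<lambda>i. m * v i) \<in> V" if v: "v \<in> V" for v m
  proof -
    \<comment> \<open>\<open>V\<close> is given as closed under sums only, so a scalar is replaced
      by a natural number congruent to it; adding \<open>p\<close> makes that number
      positive.\<close>
    define k where "k = nat (m mod int p) + p"
    obtain l where l: "k = Suc l" using p0 by (cases k) (auto simp: k_def)
    have "(\<lambda>i. int k * v i) \<in> V" using scale_nat[OF v] l by simp
    then show ?thesis
    proof (rule cong)
      fix i
      have "int k = m mod int p + int p" using p0 by (simp add: k_def)
      then have "[m = int k] (mod int p)" by (simp add: cong_def)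
      then show "[m * v i = int k * v i] (mod int p)" by (rule cong_scalar_right)
    qed
  qed
  have nab: "nabla v \<in> V" if v: "v \<in> V" for v
    using add[OF v scale[OF shift[OF v], of "-1"]] by (simp add: nabla_def)
  have nabs: "(nabla ^^ n) v \<in> V" if v: "v \<in> V" for v n
    by (induction n) (use v nab in auto)
  have zero: "w \<in> V" if "\<And>i. [w i = 0] (mod int p)" for w
    using cong[OF scale[OF v0(1), of 0], of w] that by simp
  have nabla_p: "[(nabla ^^ p) v i = 0] (mod int p)" if v: "\<And>i. [v (i + int p) = v i] (mod int p)" for v i
  proof -
    have "[(\<Sum>k\<le>p. (-1) ^ k * int (p choose k) * v (i - int k)) =
        (\<Sum>k\<le>p. if k = 0 then v i else if k = p then (-1) ^ p * v (i - int p) else 0)] (mod int p)"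
    proof (rule cong_sum)
      fix k assume k: "k \<in> {..p}"
      show "[(-1) ^ k * int (p choose k) * v (i - int k) =
        (if k = 0 then v i else if k = p then (-1) ^ p * v (i - int p) else 0)] (mod int p)"
      proof (cases "k = 0 \<or> k = p")
        case False
        then have "p dvd (p choose k)" using k p by (intro dvd_choose_prime) auto
        then have "int p dvd int (p choose k)" by (simp add: int_dvd_int_iff)
        then show ?thesis using False by (simp add: cong_0_iff)
      qed (use p0 in auto)
    qed
    also have "(\<Sum>k\<le>p. if k = 0 then v i else if k = p then (-1) ^ p * v (i - int p) else 0) =
        v i + (-1) ^ p * v (i - int p)"
    proof -
      have "(\<Sum>k\<le>p. if k = 0 then v i else if k = p then (-1) ^ p * v (i - int p) else 0) =
          (\<Sum>k\<le>p. (if k = 0 then v i else 0) + (if k = p then (-1) ^ p * v (i - int p) else 0))"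
        using p0 by (intro sum.cong) auto
      then show ?thesis by (simp add: sum.distrib)
    qed
    also have "[v i + (-1) ^ p * v (i - int p) = v i + (-1) ^ p * v i] (mod int p)"
      using v[of "i - int p"] by (intro cong_add cong_mult cong_refl) (simp add: cong_sym)
    also have "[v i + (-1) ^ p * v i = 0] (mod int p)"
    \<comment> \<open>Modulo p, \<open>(1 - T) ^ p\<close> is \<open>1 + (-1) ^ p T ^ p\<close>. For
      odd p the terms cancel by periodicity, for p = 2 they add up to an even number.\<close>
    proof (cases "even p")
      case True
      then have "p = 2" using p by (metis prime_nat_iff dvd_refl One_nat_def even_iff_mod_2_eq_zero primes_dvd_imp_eq two_is_prime_nat)
      then show ?thesis by (simp add: cong_0_iff)
    qed simp
    finally show ?thesis by (simp add: nabla_binomial)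
  qed
  define \<sigma> where "\<sigma> = (\<Sum>i<p. v\<^sub>0 (int i))"
  have const: "[u i = u j] (mod int p)" if u: "\<And>i. [nabla u i = 0] (mod int p)" for u i j
  proof -
    have step: "[u i = u (i - 1)] (mod int p)" for i
      using u[of i] by (simp add: nabla_def cong_iff_dvd_diff)
    have "[u (j + int n) = u j] (mod int p)" for j n
    proof (induction n)
      case (Suc n)
      then show ?case using step[of "j + int (Suc n)"] by (simp add: algebra_simps) (metis cong_trans)
    qed simp
    from this[of i "nat (j - i)"] this[of j "nat (i - j)"] show ?thesis
      by (cases "i \<le> j") (auto simp: cong_sym)
  qed
  \<comment> \<open>One more difference vanishes, so the value is constant. It is read off at
    \<open>p - 1\<close>, where the indices \<open>p - 1 - k\<close> run through exactly one
    period.\<close>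
  have sig: "[(nabla ^^ (p - 1)) v\<^sub>0 i = \<sigma>] (mod int p)" for i
  proof -
    have "[nabla ((nabla ^^ (p - 1)) v\<^sub>0) i = 0] (mod int p)" for i
      using nabla_p[where v = v\<^sub>0 and i = i, OF per[OF v0(1)]] p0 by (cases p) auto
    then have "[(nabla ^^ (p - 1)) v\<^sub>0 i = (nabla ^^ (p - 1)) v\<^sub>0 (int (p - 1))] (mod int p)"
      by (rule const[where u = "(nabla ^^ (p - 1)) v\<^sub>0"])
    also have "[(nabla ^^ (p - 1)) v\<^sub>0 (int (p - 1)) = (\<Sum>k\<le>p - 1. v\<^sub>0 (int (p - 1) - int k))] (mod int p)"
      unfolding nabla_binomial
    proof (rule cong_sum)
      fix k assume "k \<in> {..p - 1}"
      then show "[(-1) ^ k * int ((p - 1) choose k) * v\<^sub>0 (int (p - 1) - int k) = v\<^sub>0 (int (p - 1) - int k)] (mod int p)"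
        using cong_scalar_right[OF choose_prime_minus_one[OF p, of k], of "v\<^sub>0 (int (p - 1) - int k)"] by simp
    qed
    also have "(\<Sum>k\<le>p - 1. v\<^sub>0 (int (p - 1) - int k)) = \<sigma>"
    proof -
      have idx: "{..p - 1} = {..<p}" using p0 by auto
      have "int (p - 1) - int k = int (p - Suc k)" if "k < p" for k using that by linarith
      then have "(\<Sum>k\<le>p - 1. v\<^sub>0 (int (p - 1) - int k)) = (\<Sum>k<p. v\<^sub>0 (int (p - Suc k)))"
        by (intro sum.cong[OF idx] arg_cong[where f = v\<^sub>0]) blast
      also have "\<dots> = (\<Sum>k<p. v\<^sub>0 (int k))" by (rule sum.nat_diff_reindex)
      finally show ?thesis by (simp add: \<sigma>_def)
    qed
    finally show ?thesis .
  qed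
  obtain s where s: "[\<sigma> * s = 1] (mod int p)"
  proof -
    have "coprime (int p) \<sigma>"
      by (rule prime_imp_coprime) (use p v0(2) in \<open>simp_all add: \<sigma>_def\<close>)
    then have "\<exists>x. [\<sigma> * x = 1] (mod int p)"
      by (intro cong_solve_coprime_int) (simp add: coprime_commute)
    then show thesis using that by blast
  qed
  have main: "w \<in> V" if "n \<le> p" "\<And>i. [w (i + int p) = w i] (mod int p)" "\<And>i. [(nabla ^^ n) w i = 0] (mod int p)" for n w
    using that
  proof (induction n arbitrary: w)
    case 0
    then show ?case using zero by simp
  next
    case (Suc n)
    let ?c = "(nabla ^^ n) w 0"
    \<comment> \<open>If \<open>n + 1\<close> differences annihilate \<open>w\<close>, then
      \<open>n\<close> of them make it a constant. They turn \<open>?y\<close> into the invertible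
      constant \<sigma>, so subtracting a multiple of \<open>?y\<close> leaves something annihilated
      by \<open>n\<close> differences.\<close>
    let ?y = "(nabla ^^ (p - 1 - n)) v\<^sub>0"
    have cc: "[(nabla ^^ n) w i = ?c] (mod int p)" for i
      by (rule const[where u = "(nabla ^^ n) w"]) (use Suc.prems(3) in simp)
    have yV: "?y \<in> V" by (rule nabs[OF v0(1)])
    have myV: "(\<lambda>i. (?c * s) * ?y i) \<in> V" by (rule scale[OF yV])
    have ny: "(nabla ^^ n) ?y = (nabla ^^ (p - 1)) v\<^sub>0"
      using Suc.prems(1) by (simp add: funpow_add[symmetric, THEN fun_cong, unfolded comp_def])
    let ?w = "\<lambda>i. w i - (?c * s) * ?y i"
    have "?w \<in> V"
    proof (rule Suc.IH)
      show "[?w (i + int p) = ?w i] (mod int p)" for i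
        by (intro cong_diff Suc.prems(2) cong_scalar_left per[OF yV])
      fix i
      have "[(nabla ^^ n) w i - (?c * s) * (nabla ^^ (p - 1)) v\<^sub>0 i = ?c - (?c * s) * \<sigma>] (mod int p)"
        by (intro cong_diff cc cong_scalar_left sig)
      also have "[?c - (?c * s) * \<sigma> = ?c - ?c * 1] (mod int p)"
        using cong_scalar_left[OF s, of ?c] by (intro cong_diff cong_refl) (simp add: mult_ac)
      finally show "[(nabla ^^ n) ?w i = 0] (mod int p)"
        unfolding nabla_diff nabla_scale ny by simp
    qed (use Suc.prems in simp)
    from add[OF this myV] show ?case by simp
  qed
  show ?thesis by (rule main[of p]) (use w nabla_p[where v = w, OF w] in auto)
qed

text \<open>The kernel of \<chi> is the subgroup of index p, and \<chi> sorts the cosets of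
  \<open>P\<close> into p blocks. Multiplying the weights over each block gives the coordinates in
  the base group. The product of the coordinates of \<open>u\<close> is its transfer, which is all
  that is needed to generate the base group.\<close>

lemma (in group) wreath_epimorphism:
  assumes fin: "finite (carrier G)" and p: "Factorial_Ring.prime (p::nat)"
    and P: "subgroup P G" and nu: "character G P \<nu>" and nup: "\<And>x. x \<in> P \<Longrightarrow> \<nu> x ^ p = 1"
    and chi: "character G (carrier G) \<chi>" and chiP: "\<And>x. x \<in> P \<Longrightarrow> \<chi> x = 1"
    and chip: "\<And>x. x \<in> carrier G \<Longrightarrow> \<chi> x ^ p = 1"
    and g\<^sub>1: "g\<^sub>1 \<in> carrier G" "\<chi> g\<^sub>1 \<noteq> 1"
    and u: "u \<in> carrier G" "\<chi> u = 1" "(\<Prod>C\<in>lcosets P. ind_weight G \<nu> u C) \<noteq> 1"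
  shows "\<exists>h. h \<in> epi G (wreath_product (integer_mod_group p) (integer_mod_group p))"
proof -
  interpret M: monomial_set G "lcosets P" "l_coset G" "ind_weight G \<nu>"
    by (rule monomial_set_induced[OF fin P nu])
  interpret P: subgroup P G by fact
  have p0: "0 < p" using prime_gt_0_nat[OF p] .
  have p1: "p \<noteq> 1" using p by auto
  define \<omega> where "\<omega> = cis (2 * pi / real p)"
  have \<omega>k: "\<omega> ^ k = cis (2 * pi * real k / real p)" for k
    by (simp add: \<omega>_def DeMoivre mult_ac)
  have bij: "bij_betw (\<lambda>k. \<omega> ^ k) {..<p} {z. z ^ p = 1}"
    unfolding \<omega>k by (rule bij_betw_roots_unity[OF p0])
  have \<omega>p: "\<omega> ^ p = 1" using p0 by (simp add: \<omega>k)
  have \<omega>0: "\<omega> \<noteq> 0" by (simp add: \<omega>_def)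
  have \<omega>mod: "\<omega> powi m = \<omega> ^ nat (m mod int p)" for m
  proof -
    have "\<omega> powi m = \<omega> powi (int p * (m div int p) + m mod int p)" by simp
    also have "\<dots> = (\<omega> powi int p) powi (m div int p) * \<omega> powi (m mod int p)"
      by (simp only: power_int_add[OF disjI1[OF \<omega>0]] power_int_mult)
    finally show ?thesis using \<omega>p p0 by (simp add: power_int_def)
  qed
  have \<omega>eq: "\<omega> powi m = \<omega> powi n \<longleftrightarrow> [m = n] (mod int p)" for m n
  proof -
    have r: "nat (l mod int p) \<in> {..<p}" for l using p0 by (simp add: nat_less_iff)
    have A: "\<omega> ^ nat (m mod int p) = \<omega> ^ nat (n mod int p) \<longleftrightarrow> nat (m mod int p) = nat (n mod int p)"
      by (rule inj_on_eq_iff[OF bij_betw_imp_inj_on[OF bij] r r])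
    have B: "nat (m mod int p) = nat (n mod int p) \<longleftrightarrow> m mod int p = n mod int p"
      by (rule eq_nat_nat_iff) (use p0 in simp_all)
    show ?thesis by (simp only: \<omega>mod[of m] \<omega>mod[of n] cong_def A B)
  qed
  \<comment> \<open>The discrete logarithm to the base \<omega>, normalized to representatives used
    by \<open>integer_mod_group p\<close>; it translates roots of unity into additive
    coordinates.\<close>
  define L where "L z = (SOME k::int. 0 \<le> k \<and> k < int p \<and> \<omega> powi k = z)" for z
  have L: "0 \<le> L z \<and> L z < int p \<and> \<omega> powi L z = z" if "z ^ p = 1" for z
  proof -
    have "z \<in> (\<lambda>k. \<omega> ^ k) ` {..<p}" unfolding bij_betw_imp_surj_on[OF bij] using that by simp
    then obtain k where k: "k < p" "z = \<omega> ^ k" by auto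
    then have "0 \<le> int k \<and> int k < int p \<and> \<omega> powi int k = z" by simp
    then show ?thesis unfolding L_def by (rule someI)
  qed
  have Leq: "L z = k mod int p" if "\<omega> powi k = z" for z k
  proof -
    have "z ^ p = (\<omega> powi k) powi int p" using that by simp
    also have "\<dots> = (\<omega> powi int p) powi k" by (simp only: power_int_mult[symmetric] mult.commute)
    finally have "z ^ p = 1" using \<omega>p by simp
    then have "0 \<le> L z" "L z < int p" "\<omega> powi L z = \<omega> powi k" using L that by auto
    then show ?thesis unfolding \<omega>eq by (simp add: cong_def)
  qed
  define \<pi> where "\<pi> s = L (\<chi> s)" for s
  have \<pi>: "0 \<le> \<pi> s" "\<pi> s < int p" "\<omega> powi \<pi> s = \<chi> s" if "s \<in> carrier G" for s
    using L[OF chip[OF that]] by (auto simp: \<pi>_def)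
  have \<pi>mult: "\<pi> (s \<otimes> t) = (\<pi> s + \<pi> t) mod int p" if "s \<in> carrier G" "t \<in> carrier G" for s t
    unfolding \<pi>_def[of "s \<otimes> t"]
    by (rule Leq) (use \<pi> that \<omega>0 character_mult[OF chi] in \<open>simp add: power_int_add\<close>)
  have \<pi>0: "\<pi> s = 0" if "\<chi> s = 1" for s
    using Leq[of 0 "\<chi> s"] that by (simp add: \<pi>_def)
  \<comment> \<open>The number of the block of \<open>C\<close>. It does not depend on the
    representative because \<chi> is trivial on \<open>P\<close>.\<close>
  define pr where "pr C = \<pi> (coset_rep C)" for C
  have pr: "pr (g <# C) = (\<pi> g + pr C) mod int p" if g: "g \<in> carrier G" and C: "C \<in> lcosets P" for g C
  proof -
    let ?t = "coset_rep C" and ?t' = "coset_rep (g <# C)"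
    have t: "?t \<in> carrier G" "?t' \<in> carrier G"
      using coset_rep_closed[OF P] C lcosets_act(1)[OF P C g] by auto
    have "inv ?t' \<otimes> g \<otimes> ?t \<in> P" by (rule lcosets_act(2)[OF P C g])
    then have "\<chi> (inv ?t' \<otimes> g \<otimes> ?t) = 1" by (rule chiP)
    then have "\<chi> (?t' \<otimes> (inv ?t' \<otimes> g \<otimes> ?t)) = \<chi> ?t'"
      using character_mult[OF chi, of ?t' "inv ?t' \<otimes> g \<otimes> ?t"] g t by simp
    then have "\<chi> (g \<otimes> ?t) = \<chi> ?t'" using g t by (simp add: m_assoc inv_mult_cancel)
    then have "\<pi> ?t' = \<pi> (g \<otimes> ?t)" by (simp add: \<pi>_def)
    then show ?thesis using \<pi>mult[OF g t(1)] by (simp add: pr_def)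
  qed
  define B where "B i = {C \<in> lcosets P. [pr C = i] (mod int p)}" for i
  have Bcong: "B i = B j" if "[i = j] (mod int p)" for i j
    using that unfolding B_def by (auto intro: cong_trans cong_sym)
  have Bact: "bij_betw (l_coset G g) (B i) (B (\<pi> g + i))" if g: "g \<in> carrier G" for g i
  proof (rule bij_betw_byWitness[where f' = "l_coset G (inv g)"])
    have eq: "[pr (g <# C) = \<pi> g + i] (mod int p) \<longleftrightarrow> [pr C = i] (mod int p)" if C: "C \<in> lcosets P" for C i
      unfolding pr[OF g C] by (simp add: cong_add_lcancel)
    show "l_coset G g ` B i \<subseteq> B (\<pi> g + i)" using eq M.act_closed[OF g] by (auto simp: B_def)
    show "l_coset G (inv g) ` B (\<pi> g + i) \<subseteq> B i"
    proof
      fix C assume "C \<in> l_coset G (inv g) ` B (\<pi> g + i)"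
      then obtain C' where C': "C' \<in> B (\<pi> g + i)" "C = inv g <# C'" by blast
      then have l: "C' \<in> lcosets P" "C \<in> lcosets P" "g <# C = C'"
        using M.act_closed[of "inv g" C'] M.act_inv(2)[OF g, of C'] g by (auto simp: B_def)
      then show "C \<in> B i" using C' eq[OF l(2), of i] by (simp add: B_def)
    qed
  qed (use M.act_inv[OF g] in \<open>auto simp: B_def\<close>)
  \<comment> \<open>Coordinates are indexed by the block in which \<open>s\<close> arrives, hence
    the product runs over block \<open>i - \<pi> s\<close>. With this convention
    \<open>Kmult\<close> is the multiplication rule of the wreath product.\<close>
  define K where "K s i = (\<Prod>C\<in>B (i - \<pi> s). ind_weight G \<nu> s C)" for s i
  have Kcong: "K s i = K s j" if "[i = j] (mod int p)" for s i j
    using Bcong[of "i - \<pi> s" "j - \<pi> s"] that by (simp add: K_def cong_diff)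
  have Kmult: "K (s \<otimes> t) i = K s i * K t (i - \<pi> s)" if s: "s \<in> carrier G" and t: "t \<in> carrier G" for s t i
  proof -
    have "[i - \<pi> (s \<otimes> t) = i - \<pi> s - \<pi> t] (mod int p)"
      unfolding \<pi>mult[OF s t] by (simp add: cong_def mod_diff_right_eq diff_diff_eq)
    then have "K (s \<otimes> t) i = (\<Prod>C\<in>B (i - \<pi> s - \<pi> t). ind_weight G \<nu> (s \<otimes> t) C)"
      unfolding K_def using Bcong by metis
    also have "\<dots> = (\<Prod>C\<in>B (i - \<pi> s - \<pi> t). ind_weight G \<nu> s (t <# C) * ind_weight G \<nu> t C)"
      by (rule prod.cong) (use M.weight_mult[OF s t] in \<open>auto simp: B_def\<close>)
    also have "\<dots> = (\<Prod>C\<in>B (i - \<pi> s - \<pi> t). ind_weight G \<nu> s (t <# C)) * K t (i - \<pi> s)"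
      by (simp add: prod.distrib K_def)
    also have "(\<Prod>C\<in>B (i - \<pi> s - \<pi> t). ind_weight G \<nu> s (t <# C)) = K s i"
      using prod.reindex_bij_betw[OF Bact[OF t, of "i - \<pi> s - \<pi> t"], of "ind_weight G \<nu> s"]
      by (simp add: K_def)
    finally show ?thesis .
  qed
  have Kp: "K s i ^ p = 1" if s: "s \<in> carrier G" for s i
  proof -
    have "ind_weight G \<nu> s C ^ p = 1" if "C \<in> lcosets P" for C
      unfolding ind_weight_def by (rule nup[OF lcosets_act(2)[OF P that s]])
    then show ?thesis unfolding K_def prod_power_distrib by (intro prod.neutral) (simp add: B_def)
  qed
  have LK: "0 \<le> L (K s i)" "L (K s i) < int p" "\<omega> powi L (K s i) = K s i" if "s \<in> carrier G" for s i
    using L[OF Kp[OF that]] by auto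
  have LKmult: "L (K (s \<otimes> t) i) = (L (K s i) + L (K t (i - \<pi> s))) mod int p"
    if "s \<in> carrier G" "t \<in> carrier G" for s t i
    by (rule Leq) (use LK that \<omega>0 Kmult in \<open>simp add: power_int_add\<close>)
  let ?Z = "integer_mod_group p"
  have carZ: "carrier ?Z = {0..<int p}" using p0 by (simp add: carrier_integer_mod_group)
  define h where "h s = (\<lambda>i\<in>{0..<int p}. L (K s i), \<pi> s)" for s
  have carW: "carrier (wreath_product ?Z ?Z) = ({0..<int p} \<rightarrow>\<^sub>E {0..<int p}) \<times> {0..<int p}"
    by (simp add: wreath_product_def carZ)
  have hom: "h \<in> hom G (wreath_product ?Z ?Z)"
  proof (rule homI)
    show "h s \<in> carrier (wreath_product ?Z ?Z)" if "s \<in> carrier G" for s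
      unfolding carW using LK[OF that] \<pi>[OF that] by (auto simp: h_def)
    fix s t assume s: "s \<in> carrier G" and t: "t \<in> carrier G"
    have inr: "(- \<pi> s mod int p + i) mod int p \<in> {0..<int p}" for i using p0 by simp
    have sh: "K t ((- \<pi> s mod int p + i) mod int p) = K t (i - \<pi> s)" for i
      by (rule Kcong) (simp add: cong_def mod_add_left_eq)
    have inv: "inv\<^bsub>?Z\<^esub> (\<pi> s) = - \<pi> s mod int p"
      by (rule inv_integer_mod_group) (use \<pi>[OF s] in \<open>simp add: carZ\<close>)
    have "h s \<otimes>\<^bsub>wreath_product ?Z ?Z\<^esub> h t =
        (\<lambda>i\<in>{0..<int p}. (L (K s i) + L (K t (i - \<pi> s))) mod int p, (\<pi> s + \<pi> t) mod int p)"
      using inr sh by (auto simp: wreath_product_def h_def carZ inv fun_eq_iff)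
    also have "\<dots> = h (s \<otimes> t)"
      using LKmult[OF s t] \<pi>mult[OF s t] by (auto simp: h_def)
    finally show "h (s \<otimes> t) = h s \<otimes>\<^bsub>wreath_product ?Z ?Z\<^esub> h t" by simp
  qed
  have \<pi>surj: "\<exists>s\<in>carrier G. \<pi> s = b" if b: "b \<in> {0..<int p}" for b
  proof -
    have nd: "\<not> int p dvd \<pi> g\<^sub>1"
    proof
      assume "int p dvd \<pi> g\<^sub>1"
      then have "\<omega> powi \<pi> g\<^sub>1 = \<omega> powi 0" unfolding \<omega>eq by (simp add: cong_0_iff)
      then show False using \<pi>(3)[OF g\<^sub>1(1)] g\<^sub>1(2) by simp
    qed
    have "coprime (int p) (\<pi> g\<^sub>1)" by (rule prime_imp_coprime) (use p nd in simp_all)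
    then obtain m where m: "[\<pi> g\<^sub>1 * m = 1] (mod int p)"
      using cong_solve_coprime_int[of "\<pi> g\<^sub>1" "int p"] by (auto simp: coprime_commute)
    define n where "n = nat ((m * b) mod int p)"
    have n: "int n = (m * b) mod int p" using p0 by (simp add: n_def)
    have "\<chi> (g\<^sub>1 [^] n) = \<omega> powi (\<pi> g\<^sub>1 * int n)"
      using character_pow[OF chi subgroup_self g\<^sub>1(1)] \<pi>(3)[OF g\<^sub>1(1)] by (simp add: power_int_mult)
    then have "\<pi> (g\<^sub>1 [^] n) = (\<pi> g\<^sub>1 * int n) mod int p" unfolding \<pi>_def[of "g\<^sub>1 [^] n"] by (intro Leq) simp
    also have "\<dots> = (\<pi> g\<^sub>1 * m * b) mod int p" unfolding n by (simp add: mod_mult_right_eq mult.assoc)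
    also have "\<dots> = (1 * b) mod int p" using cong_scalar_right[OF m, of b] unfolding cong_def .
    also have "\<dots> = b" using b by simp
    finally show ?thesis using g\<^sub>1(1) by blast
  qed
  \<comment> \<open>Exponent vectors of base group elements that come from the kernel of \<chi>,
    indexed by all integers so that the cyclic shift becomes a translation.\<close>
  define V where "V = {v::int \<Rightarrow> int. \<exists>q\<in>carrier G. \<chi> q = 1 \<and> (\<forall>i. K q i = \<omega> powi v i)}"
  have span: "w \<in> V" if w: "\<And>i. [w (i + int p) = w i] (mod int p)" for w
  proof (rule cyclic_shift_span[where p = p and V = V and w = w and v\<^sub>0 = "\<lambda>i. L (K u i)"])
    show "Factorial_Ring.prime p" by (rule p)
    show "[w (i + int p) = w i] (mod int p)" for i by (rule w)
    show "[v (i + int p) = v i] (mod int p)" if v: "v \<in> V" for v i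
    proof -
      obtain q where q: "\<And>i. K q i = \<omega> powi v i" using v by (auto simp: V_def)
      have "K q (i + int p) = K q i" by (rule Kcong) (simp add: cong_def)
      then show ?thesis unfolding q \<omega>eq .
    qed
    show "(\<lambda>i. v i + w i) \<in> V" if vw: "v \<in> V" "w \<in> V" for v w
    proof -
      obtain q where q: "q \<in> carrier G" "\<chi> q = 1" "\<And>i. K q i = \<omega> powi v i" using vw(1) by (auto simp: V_def)
      obtain q' where q': "q' \<in> carrier G" "\<chi> q' = 1" "\<And>i. K q' i = \<omega> powi w i" using vw(2) by (auto simp: V_def)
      have "K (q \<otimes> q') i = \<omega> powi (v i + w i)" for i
        using Kmult[OF q(1) q'(1), of i] \<pi>0[OF q(2)] q(3) q'(3) \<omega>0 by (simp add: power_int_add)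
      moreover have "\<chi> (q \<otimes> q') = 1" using character_mult[OF chi] q q' by simp
      ultimately show ?thesis unfolding V_def using q(1) q'(1) by blast
    qed
    show "(\<lambda>i. v (i - 1)) \<in> V" if v: "v \<in> V" for v
    proof -
      obtain q where q: "q \<in> carrier G" "\<chi> q = 1" "\<And>i. K q i = \<omega> powi v i" using v by (auto simp: V_def)
      have "1 < p" using p0 p1 by linarith
      then obtain g where g: "g \<in> carrier G" "\<pi> g = 1" using \<pi>surj[of 1] by auto
      have gi: "inv g \<in> carrier G" using g by simp
      have "K \<one> i = 1" for i
        unfolding K_def by (rule prod.neutral) (use M.weight_one in \<open>auto simp: B_def\<close>)
      then have one: "K g i * K (inv g) (i - 1) = 1" for i using Kmult[OF g(1) gi, of i] g by simp
      \<comment> \<open>Conjugation by an element that moves each block to the next one shifts the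
        exponent vector.\<close>
      have "K (g \<otimes> (q \<otimes> inv g)) i = \<omega> powi v (i - 1)" for i
      proof -
        have "K (g \<otimes> (q \<otimes> inv g)) i = K g i * (K q (i - 1) * K (inv g) (i - 1))"
          using Kmult[OF g(1), of "q \<otimes> inv g" i] Kmult[OF q(1) gi, of "i - 1"] q g \<pi>0[OF q(2)] by simp
        also have "\<dots> = K q (i - 1) * (K g i * K (inv g) (i - 1))" by (simp add: mult_ac)
        finally show ?thesis using one q(3) by simp
      qed
      moreover have "\<chi> (g \<otimes> (q \<otimes> inv g)) = 1"
        using character_mult[OF chi] character_inv[OF chi subgroup_self g(1)] character_nonzero[OF chi g(1)] q g
        by simp
      ultimately show ?thesis unfolding V_def using q(1) g(1) gi by blast
    qed
    show "w \<in> V" if v: "v \<in> V" and c: "\<And>i. [w i = v i] (mod int p)" for v w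
      using v c unfolding V_def \<omega>eq[symmetric] by auto
    show "(\<lambda>i. L (K u i)) \<in> V" unfolding V_def using u LK[OF u(1)] by auto
    \<comment> \<open>The blocks partition the cosets, so \<omega> raised to the coordinate sum of
      \<open>u\<close> is its full transfer, assumed different from 1.\<close>
    show "\<not> int p dvd (\<Sum>i<p. L (K u (int i)))"
    proof
      assume "int p dvd (\<Sum>i<p. L (K u (int i)))"
      then have "\<omega> powi (\<Sum>i<p. L (K u (int i))) = \<omega> powi 0" unfolding \<omega>eq by (simp add: cong_0_iff)
      then have "(\<Prod>i<p. K u (int i)) = 1" unfolding powi_sum[OF \<omega>0] LK(3)[OF u(1)] by simp
      moreover have "(\<Prod>i<p. K u (int i)) = (\<Prod>C\<in>(\<Union>i\<in>{..<p}. B (int i)). ind_weight G \<nu> u C)"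
        unfolding K_def \<pi>0[OF u(2)] diff_0_right
      proof (rule prod.UNION_disjoint[symmetric])
        show "\<forall>i\<in>{..<p}. finite (B (int i))" using M.fin_points by (simp add: B_def)
        show "\<forall>i\<in>{..<p}. \<forall>j\<in>{..<p}. i \<noteq> j \<longrightarrow> B (int i) \<inter> B (int j) = {}"
        proof (intro ballI impI, rule ccontr)
          fix i j assume ij: "i \<in> {..<p}" "j \<in> {..<p}" "i \<noteq> j" "B (int i) \<inter> B (int j) \<noteq> {}"
          then obtain C where "[pr C = int i] (mod int p)" "[pr C = int j] (mod int p)" by (auto simp: B_def)
          then have "[int i = int j] (mod int p)" by (metis cong_sym cong_trans)
          then show False using ij by (simp add: cong_def)
        qed
      qed simp
      moreover have "(\<Union>i\<in>{..<p}. B (int i)) = lcosets P"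
      proof (intro equalityI subsetI)
        fix C assume C: "C \<in> lcosets P"
        then have "0 \<le> pr C" "pr C < int p" using \<pi>[OF coset_rep_closed[OF P C]] by (auto simp: pr_def)
        then have "C \<in> B (int (nat (pr C)))" "nat (pr C) \<in> {..<p}" using C by (auto simp: B_def)
        then show "C \<in> (\<Union>i\<in>{..<p}. B (int i))" by blast
      qed (auto simp: B_def)
      ultimately show False using u(3) by simp
    qed
  qed
  have "carrier (wreath_product ?Z ?Z) \<subseteq> h ` carrier G"
  proof
    fix y assume "y \<in> carrier (wreath_product ?Z ?Z)"
    then obtain f b where y: "y = (f, b)" and f: "f \<in> {0..<int p} \<rightarrow>\<^sub>E {0..<int p}" and b: "b \<in> {0..<int p}"
      unfolding carW by blast
    obtain s where s: "s \<in> carrier G" "\<pi> s = b" using \<pi>surj[OF b] by blast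
    \<comment> \<open>Start from any \<open>s\<close> with the right top component and repair its
      base coordinates by an element of the kernel of \<chi>, whose exponent vector \<open>w\<close>
      is available by \<open>span\<close>.\<close>
    define w where "w i = f (i mod int p) - L (K s i)" for i
    have "K s (i + int p) = K s i" for i by (rule Kcong) (simp add: cong_def)
    then have "w \<in> V" by (intro span) (simp add: w_def)
    then obtain q where q: "q \<in> carrier G" "\<chi> q = 1" "\<And>i. K q i = \<omega> powi w i" by (auto simp: V_def)
    have Kq: "K (q \<otimes> s) i = \<omega> powi f (i mod int p)" for i
    proof -
      have "K (q \<otimes> s) i = \<omega> powi w i * \<omega> powi L (K s i)"
        using Kmult[OF q(1) s(1), of i] \<pi>0[OF q(2)] q(3) LK[OF s(1)] by simp
      also have "\<dots> = \<omega> powi f (i mod int p)" using \<omega>0 by (simp add: w_def flip: power_int_add)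
      finally show ?thesis .
    qed
    have "L (K (q \<otimes> s) i) = f i" if i: "i \<in> {0..<int p}" for i
    proof -
      have "L (K (q \<otimes> s) i) = f i mod int p" by (rule Leq) (use Kq[of i] i in simp)
      moreover have "f i \<in> {0..<int p}" using f i by blast
      ultimately show ?thesis by simp
    qed
    then have "(\<lambda>i\<in>{0..<int p}. L (K (q \<otimes> s) i)) = f"
      using f by (intro extensionalityI[of _ "{0..<int p}"]) (auto simp: PiE_def)
    moreover have "\<pi> (q \<otimes> s) = b" using \<pi>mult[OF q(1) s(1)] \<pi>0[OF q(2)] s(2) b by simp
    ultimately have "h (q \<otimes> s) = y" by (simp add: h_def y)
    then show "y \<in> h ` carrier G" using q(1) s(1) by blast
  qed
  then have "h \<in> epi G (wreath_product ?Z ?Z)" using hom by (simp add: epi_iff_subset)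
  then show ?thesis by blast
qed

subsection \<open>Failure of control of transfer\<close>

context fusion_character
begin

text \<open>\<open>lam\<close> is defined on all of \<open>S\<close>, so its values at coset
  representatives cancel over the permutation of cosets and only a power of \<open>lam g\<close>
  remains.\<close>

lemma ind_transfer_split:
  assumes P: "subgroup P S" and chi: "\<chi> \<in> Ch P" and g: "g \<in> carrier S"
  shows "ind_transfer P \<chi> g = lam g ^ card (lcosets P) * ind_transfer P (\<lambda>x. \<chi> x / lam x) g"
proof -
  have "(P, \<chi>) \<in> pairs" using P chi by (simp add: pairs_def)
  then interpret M: monomial_set S "lcosets P" "l_coset S" "ind_weight S \<chi>" by (rule induced[of "(P, \<chi>)", simplified])
  have rep: "coset_rep C \<in> carrier S" if "C \<in> lcosets P" for C using coset_rep_closed[OF P that] .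
  have w: "ind_weight S \<chi> g C = lam g * (lam (coset_rep C) / lam (coset_rep (g <# C))) *
      ind_weight S (\<lambda>x. \<chi> x / lam x) g C" if C: "C \<in> lcosets P" for C
  proof -
    have c: "coset_rep C \<in> carrier S" "coset_rep (g <# C) \<in> carrier S"
      using rep C M.act_closed[OF g C] by auto
    have "lam (inv (coset_rep (g <# C)) \<otimes> g \<otimes> coset_rep C) =
        lam g * (lam (coset_rep C) / lam (coset_rep (g <# C)))"
      using c g by (simp add: character_mult[OF lam_char] character_inv[OF lam_char subgroup_self] field_simps)
    then show ?thesis
      using c g by (simp add: ind_weight_def character_nonzero[OF lam_char])
  qed
  have re: "(\<Prod>C\<in>lcosets P. lam (coset_rep (g <# C))) = (\<Prod>C\<in>lcosets P. lam (coset_rep C))"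
    using prod.reindex_bij_betw[OF M.act_bij[OF g], of "\<lambda>C. lam (coset_rep C)"] .
  have nz: "(\<Prod>C\<in>lcosets P. lam (coset_rep C)) \<noteq> 0"
    using M.fin_points rep character_nonzero[OF lam_char] by simp
  have "ind_transfer P \<chi> g = (\<Prod>C\<in>lcosets P. lam g * (lam (coset_rep C) / lam (coset_rep (g <# C))) *
      ind_weight S (\<lambda>x. \<chi> x / lam x) g C)"
    unfolding ind_transfer_def by (rule prod.cong) (use w in auto)
  also have "\<dots> = lam g ^ card (lcosets P) * ind_transfer P (\<lambda>x. \<chi> x / lam x) g"
    using re nz by (simp add: prod.distrib prod_dividef ind_transfer_def)
  finally show ?thesis .
qed

end

context saturated_fusion_system
begin

lemma Aut_normalizer_system:
  assumes al: "\<alpha> \<in> F (carrier S) (carrier S)"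
  shows "\<alpha> \<in> Aut_in (normalizer_system S F) (carrier S)"
proof -
  have surj: "\<beta> ` carrier S = carrier S" if "\<beta> \<in> F (carrier S) (carrier S)" for \<beta>
    using mor_inj[OF subgroup_self subgroup_self that] mor_image[OF subgroup_self subgroup_self that]
      finite_carrier endo_inj_surj by blast
  have mem: "\<beta> \<in> normalizer_system S F (carrier S) (carrier S)" if b: "\<beta> \<in> F (carrier S) (carrier S)" for \<beta>
  proof -
    have "restrict \<beta> (carrier S) = \<beta>"
      using mor_ext[OF subgroup_self subgroup_self b] by (rule extensional_restrict)
    moreover have "\<beta> \<in> Aut_in F (carrier S)" using Aut_in_eq[OF subgroup_self] surj[OF b] b by blast
    ultimately show ?thesis unfolding normalizer_system_def using b by blast
  qed
  have "\<alpha> \<in> Iso_in F (carrier S) (carrier S)" using Iso_in_eq[OF subgroup_self subgroup_self] surj[OF al] al by blast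
  then show ?thesis using mem unfolding Aut_in_def Iso_in_def by blast
qed

lemma Aut_normalizer_system_subset: "Aut_in (normalizer_system S F) P \<subseteq> Aut_in F P"
  unfolding Aut_in_def Iso_in_def normalizer_system_def by blast

lemma focal_normalizer_gen:
  assumes "\<alpha> \<in> F (carrier S) (carrier S)" "u \<in> carrier S"
  shows "inv u \<otimes> \<alpha> u \<in> focal_subgroup S (normalizer_system S F)"
  unfolding focal_subgroup_def
  by (rule generate.incl) (use assms subgroup_self Aut_normalizer_system in blast)

lemma focal_subgroup_chain:
  shows "focal_subgroup S (normalizer_system S F) \<subseteq> focal_subgroup S F" "focal_subgroup S F \<subseteq> focal"
    and "subgroup (focal_subgroup S (normalizer_system S F)) S"
proof -
  show "focal_subgroup S (normalizer_system S F) \<subseteq> focal_subgroup S F"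
    unfolding focal_subgroup_def
    by (rule mono_generate) (use Aut_normalizer_system_subset in blast)
  show "focal_subgroup S F \<subseteq> focal"
    unfolding focal_subgroup_def focal_def
    by (rule mono_generate) (use Aut_in_eq in blast)
  have "{inv u \<otimes> \<alpha> u | u \<alpha> P. subgroup P S \<and> u \<in> P \<and> \<alpha> \<in> Aut_in (normalizer_system S F) P} \<subseteq> carrier S"
  proof clarify
    fix u \<alpha> P assume P: "subgroup P S" and u: "u \<in> P" and al: "\<alpha> \<in> Aut_in (normalizer_system S F) P"
    have "\<alpha> \<in> F P (carrier S)" using al Aut_normalizer_system_subset Aut_in_eq[OF P] by blast
    then show "inv u \<otimes> \<alpha> u \<in> carrier S"
      using mor_closed[OF P subgroup_self _ u] subgroup.mem_carrier[OF P u] by simp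
  qed
  then show "subgroup (focal_subgroup S (normalizer_system S F)) S"
    unfolding focal_subgroup_def by (rule generate_is_subgroup)
qed

lemma wreath_quotient:
  assumes ne: "focal_subgroup S F \<noteq> focal_subgroup S (normalizer_system S F)"
  shows "\<exists>h. h \<in> epi S (wreath_product (integer_mod_group p) (integer_mod_group p))"
proof -
  let ?L = "focal_subgroup S (normalizer_system S F)"
  note L = focal_subgroup_chain(3)
  obtain k where k: "k \<in> focal" "k \<notin> ?L" using ne focal_subgroup_chain by blast
  have fc: "focal \<subseteq> carrier S" by (rule subgroup.subset[OF subgroup_focal])
  obtain n where ord: "order S = p ^ n" using p_group by blast
  \<comment> \<open>A commutator is a focal generator for the element \<open>inv x\<close> and the
    inner automorphism given by \<open>y\<close>, so a separating character can be found.\<close>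
  have comm: "x \<otimes> y \<otimes> inv x \<otimes> inv y \<in> ?L" if x: "x \<in> carrier S" and y: "y \<in> carrier S" for x y
  proof -
    have "conj_map S y (carrier S) \<in> F (carrier S) (carrier S)"
      using y by (intro mor_conj subgroup_self) auto
    from focal_normalizer_gen[OF this inv_closed[OF x]] show ?thesis
      using x y by (simp add: conj_map_def m_assoc)
  qed
  have kc: "k \<in> carrier S" using k(1) fc by blast
  obtain \<chi>\<^sub>0 where chi0: "character S (carrier S) \<chi>\<^sub>0" "\<forall>x\<in>?L. \<chi>\<^sub>0 x = 1" "\<chi>\<^sub>0 k \<noteq> 1"
    using exists_separating_character[OF finite_carrier L kc k(2) comm] by metis
  obtain lam where lam: "character S (carrier S) lam" "\<forall>x\<in>focal. lam x ^ p = 1"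
      "\<exists>x\<in>focal. lam x \<noteq> 1" "\<forall>x\<in>carrier S. \<chi>\<^sub>0 x = 1 \<longrightarrow> lam x = 1"
    using character_power_reduce[OF prime_p ord finite_carrier chi0(1) fc k(1) chi0(3)] by metis
  interpret fusion_character p S F lam
  proof unfold_locales
    show "character S (carrier S) lam" by (rule lam(1))
    fix \<alpha> x assume al: "\<alpha> \<in> F (carrier S) (carrier S)" and x: "x \<in> carrier S"
    have ax: "\<alpha> x \<in> carrier S" by (rule mor_closed[OF subgroup_self subgroup_self al x])
    have "lam (inv x \<otimes> \<alpha> x) = 1"
      using focal_normalizer_gen[OF al x] chi0(2) lam(4) x ax by simp
    then have "inverse (lam x) * lam (\<alpha> x) = 1"
      using character_mult[OF lam(1)] character_inv[OF lam(1) subgroup_self x] x ax by simp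
    then show "lam (\<alpha> x) = lam x"
      using character_nonzero[OF lam(1) x] by (simp add: field_simps)
  qed
  \<comment> \<open>The least such \<open>m\<close> makes \<open>u\<close> of minimal order among
    the elements of \<open>focal\<close> on which \<open>lam\<close> is nontrivial.\<close>
  let ?U = "\<lambda>m. \<exists>u\<in>focal. lam u \<noteq> 1 \<and> u [^] (p ^ m) = \<one>"
  have "?U n" using lam(3) fc pow_order_eq_1 ord by (metis subsetD)
  then obtain m where m: "?U m" "\<And>j. j < m \<Longrightarrow> \<not> ?U j" using exists_least_iff[of ?U] by blast
  then obtain u where u: "u \<in> focal" "lam u \<noteq> 1" "u [^] (p ^ m) = \<one>" by blast
  have uc: "u \<in> carrier S" using u(1) fc by blast
  have "m \<noteq> 0" using u uc character_one[OF lam_char subgroup_self] by (metis nat_pow_eone power_0)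
  then obtain l where l: "m = Suc l" by (cases m) auto
  have small: "lam v = 1" if "v \<in> focal" "v [^] (p ^ l) = \<one>" for v
    using m(2)[of l] l that by blast
  obtain P \<chi> where P: "subgroup P S" "P \<noteq> carrier S" and chi: "\<chi> \<in> Ch P" and nt: "ind_transfer P \<chi> u \<noteq> 1"
    using nontrivial_transfer_exists[OF u(1,2)] by blast
  obtain \<psi> where psi: "\<psi> \<in> F P (carrier S)" "\<chi> = restrict (\<lambda>x. lam (\<psi> x)) P"
    using chi by (auto simp: Ch_def)
  let ?\<nu> = "\<lambda>x. \<chi> x / lam x"
  have nu: "character S P ?\<nu>"
    using Ch_character[OF P(1) chi] lam_char subgroup.subset[OF P(1)] by (auto simp: character_def subset_iff)
  have nup: "?\<nu> x ^ p = 1" if x: "x \<in> P" for x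
  proof -
    have xc: "x \<in> carrier S" by (rule subgroup.mem_carrier[OF P(1) x])
    have pc: "\<psi> x \<in> carrier S" by (rule mor_closed[OF P(1) subgroup_self psi(1) x])
    \<comment> \<open>The quotient is a value of \<open>lam\<close> at a generator of
      \<open>focal\<close>, where \<open>lam\<close> takes only p-th roots of unity; \<chi> alone
      might have larger order.\<close>
    have "?\<nu> x = lam (inv x \<otimes> \<psi> x)"
      using character_mult[OF lam_char] character_inv[OF lam_char subgroup_self xc] xc pc x
      by (simp add: psi(2) field_simps)
    then show ?thesis using lam(2)[rule_format, OF focal_gen[OF P(1) x psi(1)]] by simp
  qed
  have "p dvd card (lcosets P)"
  proof -
    have lag: "card (lcosets P) * card P = p ^ n" using l_lagrange[OF finite_carrier P(1)] ord by simp
    then have "card (lcosets P) dvd p ^ n" by (metis dvd_triv_left)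
    then obtain j where j: "card (lcosets P) = p ^ j" using prime_p by (auto simp: divides_primepow_nat)
    have "card P \<noteq> p ^ n"
      using P card_subset_eq[OF finite_carrier subgroup.subset[OF P(1)]] ord by (auto simp: order_def)
    then have "j \<noteq> 0" using lag j by (metis mult_1 power_0)
    then show ?thesis using j by simp
  qed
  then have "lam u ^ card (lcosets P) = 1"
    using lam(2)[rule_format, OF u(1)] by (elim dvdE) (simp add: power_mult)
  then have tnu: "ind_transfer P ?\<nu> u \<noteq> 1" using ind_transfer_split[OF P(1) chi uc] nt by simp
  obtain \<chi>\<^sub>1 where chi1: "character S (carrier S) \<chi>\<^sub>1" "\<forall>x\<in>P. \<chi>\<^sub>1 x = 1"
      "\<exists>x\<in>carrier S. \<chi>\<^sub>1 x \<noteq> 1"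
    using proper_subgroup_character[OF prime_p ord finite_carrier P] by metis
  then obtain g\<^sub>0 where g0: "g\<^sub>0 \<in> carrier S" "\<chi>\<^sub>1 g\<^sub>0 \<noteq> 1" by blast
  obtain \<chi>\<^sub>2 where chi2: "character S (carrier S) \<chi>\<^sub>2" "\<forall>x\<in>carrier S. \<chi>\<^sub>2 x ^ p = 1"
      "\<exists>x\<in>carrier S. \<chi>\<^sub>2 x \<noteq> 1" "\<forall>x\<in>carrier S. \<chi>\<^sub>1 x = 1 \<longrightarrow> \<chi>\<^sub>2 x = 1"
    using character_power_reduce[OF prime_p ord finite_carrier chi1(1) subset_refl g0] by metis
  then obtain g\<^sub>1 where g1: "g\<^sub>1 \<in> carrier S" "\<chi>\<^sub>2 g\<^sub>1 \<noteq> 1" by blast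
  have chi2P: "\<chi>\<^sub>2 x = 1" if "x \<in> P" for x
    using chi2(4) chi1(2) that subgroup.mem_carrier[OF P(1)] by blast
  \<comment> \<open>Otherwise no conjugate of \<open>u\<close> lies in \<open>P\<close>, so every
    cycle of \<open>u\<close> has length divisible by p. Its weight is \<open>lam\<close> at an
    F-conjugate of a proper power of \<open>u\<close>, which is 1 by minimality, and the transfer
    would be trivial.\<close>
  have u2: "\<chi>\<^sub>2 u = 1"
  proof (rule ccontr)
    assume nu2: "\<chi>\<^sub>2 u \<noteq> 1"
    have pq: "(P, \<chi>) \<in> pairs" using P chi by (simp add: pairs_def)
    then interpret M: monomial_set S "lcosets P" "l_coset S" "ind_weight S \<chi>" by (rule induced[of "(P, \<chi>)", simplified])
    have triv: "b ^ (card (M.exact u d b) div d) = 1" if d: "d dvd order S" for d b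
    proof (cases "M.exact u d b = {}")
      case False
      then obtain C where C: "C \<in> lcosets P" "M.period u C = d" "ind_weight S \<chi> (u [^] d) C = b"
        by (auto simp: M.exact_def)
      let ?t = "coset_rep C" and ?v = "u [^] d"
      have t: "?t \<in> carrier S" "?t <# P = C" using coset_rep[OF P(1) C(1)] by auto
      have vf: "?v \<in> focal" by (rule subgroup_nat_pow_closed[OF subgroup_focal u(1)])
      have vc: "?v \<in> carrier S" using vf fc by blast
      have fixC: "?v <# C = C" using M.act_pow[OF uc C(1), of d] M.funpow_period[OF uc C(1)] C(2) by simp
      have tP: "inv ?t \<otimes> ?v \<otimes> ?t \<in> P" using lcoset_fixed_iff[OF P(1) t(1) vc] t(2) fixC by simp
      have "d \<noteq> 1"
      proof
        assume "d = 1"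
        then have "inv ?t \<otimes> u \<otimes> ?t \<in> P" using tP uc by simp
        then have "\<chi>\<^sub>2 (inv ?t \<otimes> u \<otimes> ?t) = 1" by (rule chi2P)
        then show False
          using nu2 character_mult[OF chi2(1)] character_inv[OF chi2(1) subgroup_self t(1)]
            character_nonzero[OF chi2(1) t(1)] t uc by (simp add: field_simps)
      qed
      moreover obtain j where "d = p ^ j" using d ord prime_p by (auto simp: divides_primepow_nat)
      ultimately obtain e where e: "d = p * e" by (cases j) auto
      have "conj_map S (inv ?t) (carrier S) \<in> F (carrier S) (carrier S)"
        using t by (intro mor_conj subgroup_self) auto
      from focal_closed[OF subgroup_self vc vf this]
      have w: "inv ?t \<otimes> ?v \<otimes> ?t \<in> focal" using t vc by (simp add: conj_map_def)
      \<comment> \<open>Here it matters that \<open>focal\<close> is built from all morphisms: it is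
        then visibly closed under \<psi>, so minimality can be applied to the image.\<close>
      have psif: "\<psi> (inv ?t \<otimes> ?v \<otimes> ?t) \<in> focal" by (rule focal_closed[OF P(1) tP w psi(1)])
      have "?v [^] (p ^ l) = (u [^] (p ^ m)) [^] e"
        using uc l e by (simp add: nat_pow_pow mult_ac)
      then have v1: "?v [^] (p ^ l) = \<one>" using u(3) by simp
      have "(inv ?t \<otimes> ?v \<otimes> ?t) [^] (p ^ l) = inv ?t \<otimes> ?v [^] (p ^ l) \<otimes> ?t"
        using mor_pow[OF subgroup_self \<open>conj_map S (inv ?t) (carrier S) \<in> F (carrier S) (carrier S)\<close> vc, of "p ^ l"]
          t vc by (simp add: conj_map_def)
      then have "(inv ?t \<otimes> ?v \<otimes> ?t) [^] (p ^ l) = \<one>" using v1 t by simp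
      then have "\<psi> (inv ?t \<otimes> ?v \<otimes> ?t) [^] (p ^ l) = \<one>"
        using mor_pow[OF P(1) psi(1) tP, of "p ^ l"] mor_one[OF P(1) psi(1)] by simp
      then have "lam (\<psi> (inv ?t \<otimes> ?v \<otimes> ?t)) = 1" using small[OF psif] by simp
      then have "b = 1" using C(3) ind_weight_fixed[OF fixC, of \<chi>] tP psi(2) by simp
      then show ?thesis by simp
    qed simp
    have "ind_transfer P \<chi> u = 1"
      using M.transfer_eq_prod_exact[OF uc] ind_transfer_eq[OF pq] triv
      by (simp add: case_prod_unfold)
    then show False using nt by simp
  qed
  have big: "(\<Prod>C\<in>lcosets P. ind_weight S ?\<nu> u C) \<noteq> 1" using tnu unfolding ind_transfer_def .
  show ?thesis
    by (rule wreath_epimorphism[OF finite_carrier prime_p P(1) nu nup chi2(1) chi2P chi2(2)[rule_format] g1 uc u2 big])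
qed

end

theorem theoremY:
  fixes p :: nat and S :: "('a, 'm) monoid_scheme" and F :: "'a hom_sets"
  assumes "saturated_fusion_system p S F"
    and "focal_subgroup S F \<noteq> focal_subgroup S (normalizer_system S F)"
  shows "\<exists>h. h \<in> epi S (wreath_product (integer_mod_group p) (integer_mod_group p))"
  using saturated_fusion_system.wreath_quotient[OF assms] .

end
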